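(* Let $\tau>0$ and $\rho>0$. There is $\varepsilon>0$, depending only on $\nu,\lambda_1,\tau$, such that if $g\in L^2_{loc}(\mathbb{R},H)$ is periodic with period $\rho$ (i.e. $g(t+\rho)=g(t)$ for a.e. $t$) and $\|g\|_{L^2_0(\tau)}\le\varepsilon$, then there is a strong solution $v$ of $\frac{d}{dt}v+\nu Av+B(v,v)=g$ on $\mathbb{R}$ which is periodic with period $\rho$, i.e. $v(t+\rho)=v(t)$ for all $t$; moreover $v$ is the unique Leray–Hopf weak solution on $(-\infty,\infty)$ with values in $X$.
   Context: Setting: $\Omega=\mathbb{T}^3$, $\nu>0$; $H$, $V$ closures in $L^2(\Omega)^3$, $H^1(\Omega)^3$ of smooth periodic divergence-free mean-zero vector fields; $|\cdot|$ the $L^2$ norm; $A=-\Delta$ with first eigenvalue $\lambda_1$; $\|u\|=|A^{1/2}u|$; $B(u,v)=P_\sigma(u\cdot\nabla v)$. $\|g\|_{L^2_0(\tau)}^2:=\sup_t\frac1\tau\int_t^{t+\tau}|g|^2$ (finite for periodic $g\in L^2_{loc}(\mathbb{R},H)$), $\|g\|_{L^2_b(\tau)}^2:=\sup_t\frac1\tau\int_t^{t+\tau}\|g\|_{V'}^2$. Leray–Hopf weak solution on $\mathbb{R}$: $u\in C(\mathbb{R};H_w)\cap L^2_{loc}(\mathbb{R};V)$, $u'\in L^1_{loc}(\mathbb{R};V')$, equation satisfied in $V'$ a.e., and $|u(t)|^2+2\nu\int_{t_0}^t\|u\|^2\le|u(t_0)|^2+2\int_{t_0}^t\langle g,u\rangle$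 for a.e. $t_0$ and all $t\ge t_0$. $X:=\{u\in H:|u|^2\le R\}$ with $R:=\frac{2\tau\|g\|_{L^2_b(\tau)}^2}{\nu(1-e^{-\nu\lambda_1\tau})}$. Strong means $v\in L^\infty_{loc}(\mathbb{R},V)$. *)

theory Defs
  imports "HOL-Analysis.Analysis"
begin

text \<open>Fourier representation on the torus T^3 = (R / L Z)^3.
 A (real, vector valued) field u(x) = sum_k u_k e^{i kappa_k . x}, kappa_k = (2 pi / L) k,
 is represented by its coefficient map int^3 => complex^3.\<close>

type_synonym fourier = "int^3 \<Rightarrow> complex^3"

definition kappa :: "real \<Rightarrow> int^3 \<Rightarrow> real^3" where
  "kappa L k = (\<chi> i. 2 * pi / L * of_int (k $ i))"

definition ksq :: "real \<Rightarrow> int^3 \<Rightarrow> real" where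
  "ksq L k = (norm (kappa L k))^2"

definition lambda1 :: "real \<Rightarrow> real" where
  "lambda1 L = (2 * pi / L)^2"

definition cdot :: "complex^3 \<Rightarrow> complex^3 \<Rightarrow> complex" where
  "cdot a b = (\<Sum>i\<in>UNIV. a $ i * b $ i)"

definition rvec :: "real^3 \<Rightarrow> complex^3" where
  "rvec x = (\<chi> i. complex_of_real (x $ i))"

definition vcnj :: "complex^3 \<Rightarrow> complex^3" where
  "vcnj a = (\<chi> i. cnj (a $ i))"

text \<open>H: real, mean-zero, divergence-free, square integrable fields.\<close>
definition H_sp :: "real \<Rightarrow> fourier set" where
  "H_sp L = {u. u 0 = 0 \<and> (\<forall>k. u (-k) = vcnj (u k))
     \<and> (\<forall>k. cdot (rvec (kappa L k)) (u k) = 0)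
     \<and> (\<lambda>k. (norm (u k))^2) summable_on UNIV}"

text \<open>L^2 inner product and squared norm (Parseval, including the volume factor L^3).\<close>
definition inner_H :: "real \<Rightarrow> fourier \<Rightarrow> fourier \<Rightarrow> real" where
  "inner_H L u v = L^3 * Re (\<Sum>\<^sub>\<infinity>k. cdot (u k) (vcnj (v k)))"

definition hnorm2 :: "real \<Rightarrow> fourier \<Rightarrow> real" where
  "hnorm2 L u = L^3 * (\<Sum>\<^sub>\<infinity>k. (norm (u k))^2)"

definition V_sp :: "real \<Rightarrow> fourier set" where
  "V_sp L = {u \<in> H_sp L. (\<lambda>k. ksq L k * (norm (u k))^2) summable_on UNIV}"

definition vnorm2 :: "real \<Rightarrow> fourier \<Rightarrow> real" where
  "vnorm2 L u = L^3 * (\<Sum>\<^sub>\<infinity>k. ksq L k * (norm (u k))^2)"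

definition dnorm2 :: "real \<Rightarrow> fourier \<Rightarrow> real" where
  "dnorm2 L w = L^3 * (\<Sum>\<^sub>\<infinity>k. (norm (w k))^2 / ksq L k)"

definition dsummable :: "real \<Rightarrow> fourier \<Rightarrow> bool" where
  "dsummable L w \<longleftrightarrow> (\<lambda>k. (norm (w k))^2 / ksq L k) summable_on UNIV"

text \<open>Leray projection at wavevector k, and B(u,v) = P_sigma (u . grad v).\<close>
definition proj :: "real \<Rightarrow> int^3 \<Rightarrow> complex^3 \<Rightarrow> complex^3" where
  "proj L k w = w - (cdot (rvec (kappa L k)) w / complex_of_real (ksq L k)) *s rvec (kappa L k)"

definition bil :: "real \<Rightarrow> fourier \<Rightarrow> fourier \<Rightarrow> fourier" where
  "bil L u v k = (if k = 0 then 0 else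
     proj L k (\<Sum>\<^sub>\<infinity>j. (\<i> * cdot (u j) (rvec (kappa L (k - j)))) *s v (k - j)))"

definition L2loc_H :: "real \<Rightarrow> (real \<Rightarrow> fourier) \<Rightarrow> bool" where
  "L2loc_H L g \<longleftrightarrow> (\<forall>k. (\<lambda>t. g t k) \<in> borel_measurable lborel)
     \<and> (AE t in lborel. g t \<in> H_sp L)
     \<and> (\<forall>a b. set_integrable lborel {a..b} (\<lambda>t. hnorm2 L (g t)))"

text \<open>Leray--Hopf weak solution on R of u' + nu A u + B(u,u) = g.
  u' in L^1_loc(V') is expressed by a function w with u(t) - u(s) = int_s^t w (coefficientwise),
  w in L^1_loc(V'), and the equation holds in V' for a.e. t.\<close>
definition LH_sol :: "real \<Rightarrow> real \<Rightarrow> (real \<Rightarrow> fourier) \<Rightarrow> (real \<Rightarrow> fourier) \<Rightarrow> bool" where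
  "LH_sol L nu g u \<longleftrightarrow>
     (\<forall>t. u t \<in> H_sp L)
   \<and> (\<forall>v \<in> H_sp L. continuous_on UNIV (\<lambda>t. inner_H L (u t) v))
   \<and> (AE t in lborel. u t \<in> V_sp L)
   \<and> (\<forall>a b. set_integrable lborel {a..b} (\<lambda>t. vnorm2 L (u t)))
   \<and> (\<exists>w :: real \<Rightarrow> fourier.
        (\<forall>k a b. set_integrable lborel {a..b} (\<lambda>t. w t k))
      \<and> (\<forall>k s t. s \<le> t \<longrightarrow> u t k - u s k = (LINT r:{s..t}|lborel. w r k))
      \<and> (AE t in lborel. dsummable L (w t))
      \<and> (\<forall>a b. set_integrable lborel {a..b} (\<lambda>t. sqrt (dnorm2 L (w t))))
      \<and> (AE t in lborel. \<forall>k. w t k = g t k - complex_of_real (nu * ksq L k) *s u t k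
                                   - bil L (u t) (u t) k))
   \<and> (AE t0 in lborel. \<forall>t \<ge> t0.
        hnorm2 L (u t) + 2 * nu * (LINT s:{t0..t}|lborel. vnorm2 L (u s))
        \<le> hnorm2 L (u t0) + 2 * (LINT s:{t0..t}|lborel. inner_H L (g s) (u s)))"

definition strong_sol :: "real \<Rightarrow> real \<Rightarrow> (real \<Rightarrow> fourier) \<Rightarrow> (real \<Rightarrow> fourier) \<Rightarrow> bool" where
  "strong_sol L nu g v \<longleftrightarrow> LH_sol L nu g v
     \<and> (\<forall>a b. \<exists>M. AE t in lborel. t \<in> {a..b} \<longrightarrow> v t \<in> V_sp L \<and> vnorm2 L (v t) \<le> M)"

definition L2b_sq :: "real \<Rightarrow> real \<Rightarrow> (real \<Rightarrow> fourier) \<Rightarrow> real" where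
  "L2b_sq L tau g = (SUP t. (1 / tau) * (LINT s:{t..t+tau}|lborel. dnorm2 L (g s)))"

definition Rad :: "real \<Rightarrow> real \<Rightarrow> real \<Rightarrow> (real \<Rightarrow> fourier) \<Rightarrow> real" where
  "Rad L nu tau g = 2 * tau * L2b_sq L tau g / (nu * (1 - exp (- nu * lambda1 L * tau)))"

definition X_set :: "real \<Rightarrow> real \<Rightarrow> real \<Rightarrow> (real \<Rightarrow> fourier) \<Rightarrow> fourier set" where
  "X_set L nu tau g = {u \<in> H_sp L. hnorm2 L u \<le> Rad L nu tau g}"

end

theory Submission
  imports Defs
begin

text \<open>
  Write \<open>S\<close> for the solution operator of the Stokes equation with data at time minus infinity,
  given on each Fourier mode by convolution with an exponential. The bound
  \<open>|B(u,v)|\<^sup>2 \<le> C |Au|\<^sup>2 \<parallel>v\<parallel>\<^sup>2\<close> makes \<open>v \<mapsto> S(g - B(v,v))\<close> a contraction on the trajectories whose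
  enstrophy stays below a threshold \<open>D\<close> proportional to \<open>nu\<^sup>2\<close>, once \<open>g\<close> is small on windows of length \<open>tau\<close>. Its fixed point \<open>v\<close> is the
  strong solution; it inherits the period of \<open>g\<close> because \<open>S\<close> commutes with translations in time.
  For another Leray-Hopf solution \<open>u\<close> with values in \<open>X\<close>, the energy inequality of \<open>u\<close>, the energy
  equality of \<open>v\<close> and the identity for the inner product of \<open>u\<close> and \<open>v\<close> show that \<open>w = u - v\<close> satisfies
  \<open>|w(t)|\<^sup>2 + nu lambda1 \<integral>|w|\<^sup>2 \<le> |w(s)|\<^sup>2\<close> for almost every \<open>s\<close> and all \<open>t \<ge> s\<close>. Since \<open>w\<close> is bounded on the
  whole line, letting \<open>s\<close> tend to minus infinity gives \<open>w = 0\<close>.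
\<close>

section \<open>Sums over the lattice\<close>

text \<open>The quadratic estimate consumes \<open>Au\<close> in L^2 of time, which a bound on the
  enstrophy at each instant does not supply. A trajectory is therefore measured by two quantities:
  the supremum of its enstrophy, and the integral of |Au|^2 over the past with weight
  \<open>exp (- a * (t - s))\<close>. The rate \<open>a = nu * lambda1 L / 2\<close> is half the
  slowest Stokes decay rate, so the weight is absorbed by every Stokes kernel at the cost of a
  factor 2. Being invariant under time shifts, this space serves all periods at once. A Leray-Hopf
  solution u may not be tested with itself, which is why only an inequality is available for it.
  Pairing u with v is legitimate because the enstrophy of v is bounded: the nonlinear terms are then
  dominated by the enstrophies, which are locally integrable in time. That v takes values in X is a
  separate point. The energy equality of v over one window, followed by a supremum over time, gives
  a bound with the factor \<open>1 + 1 / x\<close>, where \<open>x = nu * lambda1 L * tau\<close>;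
  it is at most the factor \<open>2 / (1 - exp (- x))\<close> of R.\<close>

abbreviation csum :: "('a \<Rightarrow> ennreal) \<Rightarrow> ennreal" where
  "csum f \<equiv> \<integral>\<^sup>+k. f k \<partial>count_space UNIV"

lemma csum_prod: "csum (\<lambda>(x, y). f x * g y) = csum f * csum g"
proof -
  have "csum (\<lambda>(x, y). f x * g y) = csum (\<lambda>x. csum (\<lambda>y. f x * g y))"
    using nn_integral_fst_count_space[of "\<lambda>(x, y). f x * g y"] by simp
  also have "\<dots> = csum f * csum g"
    by (simp add: nn_integral_cmult nn_integral_multc)
  finally show ?thesis .
qed

lemma csum_swap: "csum (\<lambda>x. csum (\<lambda>y. f x y)) = csum (\<lambda>y. csum (\<lambda>x. f x y))"
  using nn_integral_fst_count_space[of "\<lambda>(x, y). f x y"]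
    nn_integral_snd_count_space[of "\<lambda>(x, y). f x y"] by simp

lemma csum_bij: "bij g \<Longrightarrow> csum (\<lambda>x. f (g x)) = csum f"
  by (rule nn_integral_bij_count_space)

text \<open>The exponent 4/3 is a third of the 4 in |k|^(-4), so that a product of three such sums
  controls the sum over the lattice; it exceeds 1, hence convergence. In the enumeration
  \<open>int_decode\<close> the n-th integer has size about n/2, which reduces the claim to a
  p-series.\<close>

lemma csum_int_powr_finite: "csum (\<lambda>n::int. ennreal (1 / (1 + \<bar>real_of_int n\<bar>) powr (4/3))) < \<infinity>"
proof -
  have bd: "1 / (1 + \<bar>real_of_int (int_decode n)\<bar>) powr (4/3) \<le> 2 powr (4/3) * real (Suc n) powr (-4/3)" for n
  proof -
    have "real (Suc n) / 2 \<le> 1 + \<bar>real_of_int (int_decode n)\<bar>"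
      by (cases "even n") (auto simp: int_decode_def sum_decode_def field_simps)
    then have "(real (Suc n) / 2) powr (4/3) \<le> (1 + \<bar>real_of_int (int_decode n)\<bar>) powr (4/3)"
      by (intro powr_mono2) auto
    moreover have "0 < (real (Suc n) / 2) powr (4/3)" by simp
    ultimately have "1 / (1 + \<bar>real_of_int (int_decode n)\<bar>) powr (4/3) \<le> 1 / (real (Suc n) / 2) powr (4/3)"
      by (intro divide_left_mono) (auto intro!: mult_pos_pos)
    also have "\<dots> = 2 powr (4/3) * real (Suc n) powr (-4/3)"
      by (simp add: powr_divide powr_minus_divide)
    finally show ?thesis .
  qed
  have "summable (\<lambda>n. real n powr (-4/3))" by (simp add: summable_real_powr_iff)
  then have "summable (\<lambda>n. real (Suc n) powr (-4/3))" by (subst summable_Suc_iff)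
  then have sm: "summable (\<lambda>n. 2 powr (4/3) * real (Suc n) powr (-4/3))" by (rule summable_mult)
  have "csum (\<lambda>n::int. ennreal (1 / (1 + \<bar>real_of_int n\<bar>) powr (4/3)))
     = csum (\<lambda>n. ennreal (1 / (1 + \<bar>real_of_int (int_decode n)\<bar>) powr (4/3)))"
    using csum_bij[OF bij_int_decode, of "\<lambda>n. ennreal (1 / (1 + \<bar>real_of_int n\<bar>) powr (4/3))"] by simp
  also have "\<dots> \<le> csum (\<lambda>n. ennreal (2 powr (4/3) * real (Suc n) powr (-4/3)))"
    by (intro nn_integral_mono ennreal_leI bd)
  also have "\<dots> = (\<Sum>n. ennreal (2 powr (4/3) * real (Suc n) powr (-4/3)))"
    by (rule nn_integral_count_space_nat)
  also have "\<dots> < \<infinity>"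
    using ennreal_suminf_neq_top[OF sm] by (metis infinity_ennreal_def top.not_eq_extremum mult_nonneg_nonneg powr_ge_zero)
  finally show ?thesis .
qed

lemma ksq_eq: "ksq L k = lambda1 L * (\<Sum>i\<in>UNIV. (real_of_int (k $ i))\<^sup>2)"
  by (simp add: ksq_def kappa_def lambda1_def norm_vec_def L2_set_def sum_nonneg power_mult_distrib
      power_divide sum_distrib_left)

lemma ksq_nonneg [simp]: "0 \<le> ksq L k"
  by (simp add: ksq_def)

lemma ksq_0 [simp]: "ksq L 0 = 0"
  by (simp add: ksq_eq)

lemma ksq_minus [simp]: "ksq L (- k) = ksq L k"
  by (simp add: ksq_eq)

lemma lambda1_pos: "L > 0 \<Longrightarrow> lambda1 L > 0"
  by (simp add: lambda1_def)

lemma int_vec_sq_ge1: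
  assumes "k \<noteq> (0::int^3)" shows "1 \<le> (\<Sum>i\<in>UNIV. (real_of_int (k $ i))\<^sup>2)"
proof -
  obtain i where i: "k $ i \<noteq> 0" using assms by (auto simp: vec_eq_iff)
  then have "1 \<le> \<bar>k $ i\<bar>" by linarith
  then have "1 \<le> (k $ i)\<^sup>2" by (simp add: int_one_le_iff_zero_less i)
  then have "1 \<le> (real_of_int (k $ i))\<^sup>2" by (metis of_int_1_le_iff of_int_power)
  also have "\<dots> \<le> (\<Sum>i\<in>UNIV. (real_of_int (k $ i))\<^sup>2)" by (rule member_le_sum) auto
  finally show ?thesis .
qed

lemma ksq_ge: "L > 0 \<Longrightarrow> k \<noteq> 0 \<Longrightarrow> lambda1 L \<le> ksq L k"
  using int_vec_sq_ge1[of k] lambda1_pos[of L] by (simp add: ksq_eq)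

lemma ksq_pos: "L > 0 \<Longrightarrow> k \<noteq> 0 \<Longrightarrow> 0 < ksq L k"
  using ksq_ge[of L k] lambda1_pos[of L] by linarith

text \<open>The squared constant of the embedding of D(A) into fields with absolutely summable
  Fourier coefficients, hence into bounded fields. The zero mode contributes
  \<open>1 / 0 = 0\<close>.\<close>

definition CL :: "real \<Rightarrow> ennreal" where
  "CL L = csum (\<lambda>k. ennreal (1 / (ksq L k)\<^sup>2))"

text \<open>Since 2|k| dominates each \<open>1 + |k_i|\<close> for nonzero k, 16|k|^4 dominates the
  product of the three factors \<open>(1 + |k_i|) powr (4/3)\<close>, and the sum factorises into
  one-dimensional ones.\<close>

lemma CL_finite:
  assumes L: "L > 0" shows "CL L < \<infinity>"
proof -
  define h where "h n = 1 / (1 + \<bar>real_of_int n\<bar>) powr (4/3)" for n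
  have h0: "0 \<le> h n" for n by (simp add: h_def)
  define C where "C = 16 / (lambda1 L)\<^sup>2"
  have C0: "0 \<le> C" by (simp add: C_def)
  have bd: "1 / (ksq L k)\<^sup>2 \<le> C * (h (k $ 1) * (h (k $ 2) * h (k $ 3)))" for k :: "int^3"
  proof (cases "k = 0")
    case True then show ?thesis using h0 C0 by simp
  next
    case False
    define N where "N = (\<Sum>i\<in>UNIV. (real_of_int (k $ i))\<^sup>2)"
    define m where "m = sqrt N"
    have N1: "1 \<le> N" unfolding N_def using False by (rule int_vec_sq_ge1)
    then have m1: "1 \<le> m" by (simp add: m_def)
    have le: "1 + \<bar>real_of_int (k $ i)\<bar> \<le> 2 * m" for i
    proof -
      have "(real_of_int (k $ i))\<^sup>2 \<le> N" unfolding N_def by (rule member_le_sum) auto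
      then have "\<bar>real_of_int (k $ i)\<bar> \<le> m" unfolding m_def by (simp add: real_le_rsqrt)
      then show ?thesis using m1 by simp
    qed
    let ?P = "(1 + \<bar>real_of_int (k $ 1)\<bar>) * ((1 + \<bar>real_of_int (k $ 2)\<bar>) * (1 + \<bar>real_of_int (k $ 3)\<bar>))"
    have "?P \<le> (2*m) * ((2*m) * (2*m))"
      using le m1 by (intro mult_mono) auto
    then have P: "?P \<le> (2*m)^3" by (simp add: power3_eq_cube mult.assoc)
    have P0: "0 < ?P" by (intro mult_pos_pos) auto
    have "?P powr (4/3) \<le> ((2*m)^3) powr (4/3)" using P P0 by (intro powr_mono2) auto
    also have "\<dots> = ((2*m) powr 3) powr (4/3)" using m1 by (subst powr_numeral) auto
    also have "\<dots> = (2*m) powr (3 * (4/3))" by (rule powr_powr)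
    also have "\<dots> = (2*m) powr 4" by simp
    also have "\<dots> = (2*m)^4" using m1 by (subst powr_numeral) auto
    also have "\<dots> = 16 * N\<^sup>2" using N1 by (simp add: power_mult_distrib m_def power4_eq_xxxx power2_eq_square)
    finally have P4: "?P powr (4/3) \<le> 16 * N\<^sup>2" .
    have hh: "h (k $ 1) * (h (k $ 2) * h (k $ 3)) = 1 / ?P powr (4/3)"
      by (simp add: h_def powr_mult)
    have "1 / (16 * N\<^sup>2) \<le> 1 / ?P powr (4/3)" using P4 P0 N1
      by (intro divide_left_mono) (auto intro!: mult_pos_pos)
    then have "C * (1 / (16 * N\<^sup>2)) \<le> C * (1 / ?P powr (4/3))" using C0 by (intro mult_left_mono)
    moreover have "1 / (ksq L k)\<^sup>2 = C * (1 / (16 * N\<^sup>2))"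
      by (simp add: ksq_eq C_def N_def power_mult_distrib)
    ultimately show ?thesis unfolding hh by simp
  qed
  have bij: "bij (\<lambda>(a, b, c). vector [a, b, c] :: int^3)"
    by (rule bij_betwI[where g="\<lambda>k. (k $ 1, k $ 2, k $ 3)"]) (auto simp: vector_3 vec_eq_iff forall_3)
  have "CL L \<le> csum (\<lambda>k::int^3. ennreal (C * (h (k $ 1) * (h (k $ 2) * h (k $ 3)))))"
    unfolding CL_def by (intro nn_integral_mono ennreal_leI bd)
  also have "\<dots> = csum (\<lambda>k::int^3. ennreal C * (ennreal (h (k $ 1)) * (ennreal (h (k $ 2)) * ennreal (h (k $ 3)))))"
    using C0 h0 by (simp add: ennreal_mult)
  also have "\<dots> = ennreal C * csum (\<lambda>k::int^3. ennreal (h (k $ 1)) * (ennreal (h (k $ 2)) * ennreal (h (k $ 3))))"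
    by (simp add: nn_integral_cmult)
  also have "csum (\<lambda>k::int^3. ennreal (h (k $ 1)) * (ennreal (h (k $ 2)) * ennreal (h (k $ 3))))
     = csum (\<lambda>(a, bc). ennreal (h a) * (case bc of (b, c) \<Rightarrow> ennreal (h b) * ennreal (h c)))"
    by (subst csum_bij[OF bij, symmetric]) (simp add: case_prod_unfold vector_3)
  also have "\<dots> = csum (\<lambda>a. ennreal (h a)) * (csum (\<lambda>a. ennreal (h a)) * csum (\<lambda>a. ennreal (h a)))"
    by (simp only: csum_prod)
  also have "ennreal C * \<dots> < \<infinity>"
    using csum_int_powr_finite unfolding h_def by (auto simp: ennreal_mult_less_top)
  finally show ?thesis .
qed

section \<open>Convolution estimates\<close>

lemma Cauchy_Schwarz_csum:
  "(csum (\<lambda>k. f k * g k))\<^sup>2 \<le> csum (\<lambda>k. (f k)\<^sup>2) * csum (\<lambda>k. (g k)\<^sup>2)"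
  by (rule Cauchy_Schwarz_nn_integral) auto

lemma bij_diff: "bij (\<lambda>j. k - j :: 'a::ab_group_add)"
  by (rule bij_betwI[where g="\<lambda>j. k - j"]) auto

lemma bij_diff_right: "bij (\<lambda>j. j - k :: 'a::ab_group_add)"
  by (rule bij_betwI[where g="\<lambda>j. j + k"]) auto

lemma bij_add_right: "bij (\<lambda>j. j + k :: 'a::ab_group_add)"
  by (rule bij_betwI[where g="\<lambda>j. j - k"]) auto

lemma bij_minus: "bij (\<lambda>j. - j :: 'a::ab_group_add)"
  by (rule bij_betwI[where g="\<lambda>j. - j"]) auto

lemma conv_pointwise:
  fixes x y :: "'a::ab_group_add \<Rightarrow> ennreal"
  shows "(csum (\<lambda>j. x j * y (k - j)))\<^sup>2 \<le> csum (\<lambda>j. (x j)\<^sup>2) * csum (\<lambda>j. (y j)\<^sup>2)"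
proof -
  have "csum (\<lambda>j. (y (k - j))\<^sup>2) = csum (\<lambda>j. (y j)\<^sup>2)"
    by (rule csum_bij[OF bij_diff])
  then show ?thesis using Cauchy_Schwarz_csum[of x "\<lambda>j. y (k - j)"] by simp
qed

text \<open>Young's inequality for an l^1 and an l^2 sequence. Splitting \<open>x j\<close> into two
  square roots before applying Cauchy-Schwarz yields one factor of the l^1 norm; summing over
  \<open>k\<close> and translating yields the other.\<close>

lemma conv_young:
  fixes x :: "'a::ab_group_add \<Rightarrow> real" and y :: "'a \<Rightarrow> ennreal"
  assumes x: "\<And>j. 0 \<le> x j"
  shows "csum (\<lambda>k. (csum (\<lambda>j. ennreal (x j) * y (k - j)))\<^sup>2)
     \<le> (csum (\<lambda>j. ennreal (x j)))\<^sup>2 * csum (\<lambda>j. (y j)\<^sup>2)"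
proof -
  let ?X = "csum (\<lambda>j. ennreal (x j))"
  have sq: "(ennreal (sqrt (x j)))\<^sup>2 = ennreal (x j)" "ennreal (sqrt (x j)) * (ennreal (sqrt (x j)) * z) = ennreal (x j) * z" for j z
    using x by (simp_all add: ennreal_power flip: ennreal_mult mult.assoc)
  have "(csum (\<lambda>j. ennreal (x j) * y (k - j)))\<^sup>2 \<le> ?X * csum (\<lambda>j. ennreal (x j) * (y (k - j))\<^sup>2)" for k
    using Cauchy_Schwarz_csum[of "\<lambda>j. ennreal (sqrt (x j))" "\<lambda>j. ennreal (sqrt (x j)) * y (k - j)"]
    by (simp add: sq power_mult_distrib)
  then have "csum (\<lambda>k. (csum (\<lambda>j. ennreal (x j) * y (k - j)))\<^sup>2)
     \<le> csum (\<lambda>k. ?X * csum (\<lambda>j. ennreal (x j) * (y (k - j))\<^sup>2))"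
    by (rule nn_integral_mono)
  also have "\<dots> = ?X * csum (\<lambda>j. csum (\<lambda>k. ennreal (x j) * (y (k - j))\<^sup>2))"
    by (subst csum_swap) (simp add: nn_integral_cmult)
  also have "\<dots> = ?X * csum (\<lambda>j. ennreal (x j) * csum (\<lambda>k. (y k)\<^sup>2))"
  proof -
    have "csum (\<lambda>k. ennreal (x j) * (y (k - j))\<^sup>2) = ennreal (x j) * csum (\<lambda>k. (y k)\<^sup>2)" for j
      using csum_bij[OF bij_diff_right, of "\<lambda>k. (y k)\<^sup>2" j] by (simp add: nn_integral_cmult)
    then show ?thesis by simp
  qed
  also have "\<dots> = ?X\<^sup>2 * csum (\<lambda>j. (y j)\<^sup>2)"
    by (simp add: nn_integral_multc power2_eq_square mult.assoc)
  finally show ?thesis .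
qed

text \<open>Cauchy-Schwarz for \<open>x j\<close> written as \<open>1 / ksq L j\<close> times
  \<open>ksq L j * x j\<close>. The mode zero has to vanish because its weight does.\<close>

lemma csum_le_weighted:
  assumes L: "L > 0" and x: "\<And>j. 0 \<le> x j" "x 0 = 0"
  shows "(csum (\<lambda>j. ennreal (x j)))\<^sup>2 \<le> CL L * csum (\<lambda>j. ennreal ((ksq L j)\<^sup>2 * (x j)\<^sup>2))"
proof -
  have "ennreal (x j) = ennreal (1 / ksq L j) * ennreal (ksq L j * x j)" for j
    using x ksq_pos[OF L, of j] by (cases "j = 0") (auto simp flip: ennreal_mult)
  then have "csum (\<lambda>j. ennreal (x j)) = csum (\<lambda>j. ennreal (1 / ksq L j) * ennreal (ksq L j * x j))"
    by presburger
  then show ?thesis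
    using Cauchy_Schwarz_csum[of "\<lambda>j. ennreal (1 / ksq L j)" "\<lambda>j. ennreal (ksq L j * x j)"] x
    by (simp add: CL_def ennreal_power power_mult_distrib power_divide)
qed

text \<open>The inequality \<open>1 / (a * b) \<le> (1 / a^2 + 1 / b^2) / 2\<close> leaves two sums
  of |kappa|^(-4), each equal to \<open>CL L\<close> by translation; hence the uniformity in the
  shift \<open>m\<close>.\<close>

lemma kernel_bound:
  "csum (\<lambda>j. ennreal (1 / (ksq L j * ksq L (m + j)))) \<le> CL L"
proof -
  have ag: "1 / (a * b) \<le> 1/2 * (1 / a\<^sup>2) + 1/2 * (1 / b\<^sup>2)" for a b :: real
    using zero_le_power2[of "1/a - 1/b"] by (simp add: power2_diff power_divide)
  have half: "ennreal (1/2) + ennreal (1/2) = 1" by (subst ennreal_plus[symmetric]) auto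
  have "csum (\<lambda>j. ennreal (1 / (ksq L j * ksq L (m + j))))
    \<le> csum (\<lambda>j. ennreal (1/2) * ennreal (1 / (ksq L j)\<^sup>2) + ennreal (1/2) * ennreal (1 / (ksq L (j + m))\<^sup>2))"
  proof (rule nn_integral_mono)
    fix j
    have "ennreal (1 / (ksq L j * ksq L (m + j)))
      \<le> ennreal (1/2 * (1 / (ksq L j)\<^sup>2) + 1/2 * (1 / (ksq L (j + m))\<^sup>2))"
      using ag[of "ksq L j" "ksq L (j + m)"] by (intro ennreal_leI) (simp add: add.commute)
    also have "\<dots> = ennreal (1/2) * ennreal (1 / (ksq L j)\<^sup>2) + ennreal (1/2) * ennreal (1 / (ksq L (j + m))\<^sup>2)"
      by (subst ennreal_plus) (simp_all only: ennreal_mult' divide_nonneg_nonneg zero_le_power2 zero_le_one zero_le_numeral mult_nonneg_nonneg)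
    finally show "ennreal (1 / (ksq L j * ksq L (m + j)))
      \<le> ennreal (1/2) * ennreal (1 / (ksq L j)\<^sup>2) + ennreal (1/2) * ennreal (1 / (ksq L (j + m))\<^sup>2)" .
  qed
  also have "\<dots> = ennreal (1/2) * CL L + ennreal (1/2) * csum (\<lambda>j. ennreal (1 / (ksq L (j + m))\<^sup>2))"
    by (simp add: nn_integral_add nn_integral_cmult CL_def)
  also have "csum (\<lambda>j. ennreal (1 / (ksq L (j + m))\<^sup>2)) = CL L"
    unfolding CL_def by (rule csum_bij[OF bij_add_right])
  also have "ennreal (1/2) * CL L + ennreal (1/2) * CL L = CL L"
    by (simp only: distrib_right[symmetric] half mult_1)
  finally show ?thesis .
qed

text \<open>Cauchy--Schwarz over pairs \<open>(k, j)\<close>, grouping \<open>x j z k\<close> with its weights against \<open>y (k - j)\<close>.\<close>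
lemma trilinear_csum:
  fixes x y z :: "int^3 \<Rightarrow> real"
  assumes L: "L > 0" and x: "\<And>j. 0 \<le> x j" "x 0 = 0" and y: "\<And>j. 0 \<le> y j"
    and z: "\<And>j. 0 \<le> z j" "z 0 = 0"
  shows "(csum (\<lambda>k. csum (\<lambda>j. ennreal (x j * y (k - j) * z k))))\<^sup>2
    \<le> CL L * csum (\<lambda>j. ennreal (ksq L j * (x j)\<^sup>2)) * csum (\<lambda>j. ennreal ((y j)\<^sup>2))
        * csum (\<lambda>j. ennreal (ksq L j * (z j)\<^sup>2))"
proof -
  let ?q = "\<lambda>k. sqrt (ksq L k)"
  define F where "F p = (case p of (k, j) \<Rightarrow> ennreal (?q k * z k * (?q j * x j)))" for p
  define G where "G p = (case p of (k, j) \<Rightarrow> ennreal (y (k - j) / (?q j * ?q k)))" for p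
  have FG: "ennreal (x j * y (k - j) * z k) = F (k, j) * G (k, j)" for j k
    using x y z ksq_pos[OF L, of j] ksq_pos[OF L, of k]
    by (cases "j = 0"; cases "k = 0") (auto simp: F_def G_def simp flip: ennreal_mult)
  have "csum (\<lambda>k. csum (\<lambda>j. ennreal (x j * y (k - j) * z k))) = csum (\<lambda>p. F p * G p)"
    unfolding FG using nn_integral_fst_count_space[of "\<lambda>p. F p * G p"] by simp
  moreover have "csum (\<lambda>p. (F p)\<^sup>2) = csum (\<lambda>j. ennreal (ksq L j * (z j)\<^sup>2)) * csum (\<lambda>j. ennreal (ksq L j * (x j)\<^sup>2))"
  proof -
    have "(F p)\<^sup>2 = (case p of (k, j) \<Rightarrow> ennreal (ksq L k * (z k)\<^sup>2) * ennreal (ksq L j * (x j)\<^sup>2))" for p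
      using x z by (cases p) (simp add: F_def ennreal_power power_mult_distrib flip: ennreal_mult)
    then show ?thesis by (simp only: csum_prod)
  qed
  moreover have "csum (\<lambda>p. (G p)\<^sup>2) \<le> CL L * csum (\<lambda>j. ennreal ((y j)\<^sup>2))"
  proof -
    have "csum (\<lambda>p. (G p)\<^sup>2) = csum (\<lambda>j. csum (\<lambda>k. (G (k, j))\<^sup>2))"
      using nn_integral_snd_count_space[of "\<lambda>p. (G p)\<^sup>2"] by simp
    \<comment> \<open>The substitution \<open>k = m + j\<close> makes \<open>y\<close> depend on
      \<open>m\<close> alone; the remaining sum over \<open>j\<close> is that of
      \<open>kernel_bound\<close>.\<close>
    also have "\<dots> = csum (\<lambda>j. csum (\<lambda>m. (G (m + j, j))\<^sup>2))"
      by (rule nn_integral_cong) (rule csum_bij[OF bij_add_right, symmetric])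
    also have "\<dots> = csum (\<lambda>m. csum (\<lambda>j. (G (m + j, j))\<^sup>2))" by (rule csum_swap)
    also have "\<dots> = csum (\<lambda>m. ennreal ((y m)\<^sup>2) * csum (\<lambda>j. ennreal (1 / (ksq L j * ksq L (m + j)))))"
    proof -
      have "(G (m + j, j))\<^sup>2 = ennreal ((y m)\<^sup>2) * ennreal (1 / (ksq L j * ksq L (m + j)))" for m j
        using y by (simp add: G_def ennreal_power power_mult_distrib power_divide flip: ennreal_mult)
      then show ?thesis by (simp add: nn_integral_cmult)
    qed
    also have "\<dots> \<le> csum (\<lambda>m. ennreal ((y m)\<^sup>2) * CL L)"
      by (intro nn_integral_mono mult_left_mono kernel_bound) auto
    finally show ?thesis by (subst (asm) nn_integral_multc) (auto simp: mult.commute)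
  qed
  ultimately have "(csum (\<lambda>k. csum (\<lambda>j. ennreal (x j * y (k - j) * z k))))\<^sup>2 \<le>
     csum (\<lambda>j. ennreal (ksq L j * (z j)\<^sup>2)) * csum (\<lambda>j. ennreal (ksq L j * (x j)\<^sup>2)) *
     (CL L * csum (\<lambda>j. ennreal ((y j)\<^sup>2)))"
    using Cauchy_Schwarz_csum[of F G] by (simp add: order_trans[OF _ mult_left_mono])
  then show ?thesis by (simp add: ac_simps)
qed

section \<open>Fourier coefficient fields\<close>

lemma integrable_csum:
  fixes f :: "'a \<Rightarrow> 'b::{banach, second_countable_topology}"
  shows "csum (\<lambda>k. ennreal (norm (f k))) < \<infinity> \<Longrightarrow> integrable (count_space UNIV) f"
  by (rule integrableI_bounded) auto

lemma infsum_eq_integral: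
  fixes f :: "'a \<Rightarrow> 'b::{banach, second_countable_topology}"
  shows "integrable (count_space UNIV) f \<Longrightarrow> infsum f UNIV = (LINT k|count_space UNIV. f k)"
  using infsetsum_infsum[of f UNIV] by (simp add: infsetsum_def abs_summable_on_def)

lemma summable_on_csum:
  assumes "\<And>k. 0 \<le> f k"
  shows "f summable_on UNIV \<longleftrightarrow> csum (\<lambda>k. ennreal (f k)) < \<infinity>"
proof -
  have "f summable_on UNIV \<longleftrightarrow> integrable (count_space UNIV) f"
    using assms abs_summable_equivalent[of f UNIV] by (simp add: abs_summable_on_def)
  also have "\<dots> \<longleftrightarrow> csum (\<lambda>k. ennreal (f k)) < \<infinity>"
    using assms by (simp add: integrable_iff_bounded)
  finally show ?thesis .
qed

text \<open>Divergent sums are covered as well: \<open>infsum\<close> then defaults to 0, and so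
  does \<open>enn2real\<close> at infinity. The norms of the statement can thus be translated
  without a summability hypothesis.\<close>

lemma infsum_eq_csum:
  assumes f: "\<And>k. 0 \<le> f k"
  shows "infsum f UNIV = enn2real (csum (\<lambda>k. ennreal (f k)))"
proof (cases "csum (\<lambda>k. ennreal (f k)) < \<infinity>")
  case True
  then have "integrable (count_space UNIV) f"
    using f by (intro integrable_csum) simp
  then show ?thesis
    using f by (simp add: infsum_eq_integral integral_eq_nn_integral)
next
  case False
  then have "\<not> f summable_on UNIV" using summable_on_csum[of f] f by simp
  then show ?thesis using False by (simp add: infsum_not_exists not_less top_unique)
qed

text \<open>Weighted sums of squares; \<open>hn\<close>, \<open>vn\<close>, \<open>dn\<close> and \<open>an\<close> are the squared norms of
  \<open>H\<close>, \<open>V\<close>, \<open>V'\<close> and \<open>D(A)\<close> without the volume factor, with value infinity outside the respective space.\<close>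
definition wn :: "(int^3 \<Rightarrow> real) \<Rightarrow> fourier \<Rightarrow> ennreal" where
  "wn c u = csum (\<lambda>k. ennreal (c k * (norm (u k))\<^sup>2))"

abbreviation hn :: "fourier \<Rightarrow> ennreal" where "hn \<equiv> wn (\<lambda>_. 1)"
abbreviation vn :: "real \<Rightarrow> fourier \<Rightarrow> ennreal" where "vn L \<equiv> wn (ksq L)"
abbreviation dn :: "real \<Rightarrow> fourier \<Rightarrow> ennreal" where "dn L \<equiv> wn (\<lambda>k. 1 / ksq L k)"
abbreviation an :: "real \<Rightarrow> fourier \<Rightarrow> ennreal" where "an L \<equiv> wn (\<lambda>k. (ksq L k)\<^sup>2)"

lemma hn_eq: "hn u = csum (\<lambda>k. (ennreal (norm (u k)))\<^sup>2)"
  by (simp add: wn_def ennreal_power)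

lemma hnorm2_eq: "hnorm2 L u = L^3 * enn2real (hn u)"
  by (simp add: hnorm2_def wn_def infsum_eq_csum)

lemma vnorm2_eq: "vnorm2 L u = L^3 * enn2real (vn L u)"
  by (simp add: vnorm2_def wn_def infsum_eq_csum)

lemma dnorm2_eq: "dnorm2 L u = L^3 * enn2real (dn L u)"
  by (simp add: dnorm2_def wn_def infsum_eq_csum)

lemma dsummable_iff: "dsummable L u \<longleftrightarrow> dn L u < \<infinity>"
  by (simp add: dsummable_def wn_def summable_on_csum)

lemma wn_mono: "(\<And>k. c k * (norm (u k))\<^sup>2 \<le> d k * (norm (v k))\<^sup>2) \<Longrightarrow> wn c u \<le> wn d v"
  unfolding wn_def by (intro nn_integral_mono ennreal_leI)

lemma wn_cmult: "0 \<le> a \<Longrightarrow> wn (\<lambda>k. a * c k) u = ennreal a * wn c u"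
  unfolding wn_def by (subst nn_integral_cmult[symmetric]) (auto simp: mult.assoc ennreal_mult')

lemma wn_add:
  assumes c: "\<And>k. 0 \<le> c k" and n: "\<And>k. norm (w k) \<le> norm (u k) + norm (v k)"
  shows "wn c w \<le> 2 * wn c u + 2 * wn c v"
proof -
  have "(norm (w k))\<^sup>2 \<le> 2 * (norm (u k))\<^sup>2 + 2 * (norm (v k))\<^sup>2" for k
  proof -
    have "(norm (w k))\<^sup>2 \<le> (norm (u k) + norm (v k))\<^sup>2"
      using n by (intro power_mono) auto
    also have "\<dots> \<le> 2 * (norm (u k))\<^sup>2 + 2 * (norm (v k))\<^sup>2"
      using zero_le_power2[of "norm (u k) - norm (v k)"] by (simp add: power2_sum power2_diff)
    finally show ?thesis .
  qed
  then have "c k * (norm (w k))\<^sup>2 \<le> 2 * (c k * (norm (u k))\<^sup>2) + 2 * (c k * (norm (v k))\<^sup>2)" for k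
    using mult_left_mono[OF _ c, of "(norm (w k))\<^sup>2" "2 * (norm (u k))\<^sup>2 + 2 * (norm (v k))\<^sup>2" k]
    by (simp add: algebra_simps)
  then have "wn c w \<le> csum (\<lambda>k. ennreal (2 * (c k * (norm (u k))\<^sup>2) + 2 * (c k * (norm (v k))\<^sup>2)))"
    unfolding wn_def by (intro nn_integral_mono ennreal_leI)
  also have "\<dots> = csum (\<lambda>k. 2 * ennreal (c k * (norm (u k))\<^sup>2) + 2 * ennreal (c k * (norm (v k))\<^sup>2))"
    using c by (simp add: ennreal_plus ennreal_mult)
  also have "\<dots> = 2 * wn c u + 2 * wn c v"
    unfolding wn_def by (simp add: nn_integral_add nn_integral_cmult)
  finally show ?thesis .
qed

lemma wn_diff:
  "(\<And>k. 0 \<le> c k) \<Longrightarrow> wn c (\<lambda>k. u k - v k) \<le> 2 * wn c u + 2 * wn c v"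
  by (rule wn_add) (simp_all add: norm_triangle_ineq4)

lemma wn_finite_add:
  "wn c u < \<infinity> \<Longrightarrow> wn c v < \<infinity> \<Longrightarrow> (\<And>k. 0 \<le> c k) \<Longrightarrow>
   (\<And>k. norm (w k) \<le> norm (u k) + norm (v k)) \<Longrightarrow> wn c w < \<infinity>"
  using wn_add[of c w u v] by (auto simp: ennreal_mult_less_top intro: le_less_trans)

text \<open>Poincare's inequality: without the mean, the lowest wave number is
  \<open>lambda1 L\<close>.\<close>

lemma hn_le_vn:
  assumes "L > 0" "u 0 = 0" shows "ennreal (lambda1 L) * hn u \<le> vn L u"
proof -
  have "lambda1 L * 1 * (norm (u k))\<^sup>2 \<le> ksq L k * (norm (u k))\<^sup>2" for k
  proof (cases "k = 0")
    case False
    then show ?thesis using ksq_ge[OF assms(1) False] by (intro mult_right_mono) simp_all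
  qed (simp add: assms)
  then have "wn (\<lambda>k. lambda1 L * 1) u \<le> vn L u" by (rule wn_mono)
  then show ?thesis using lambda1_pos[OF assms(1)] wn_cmult[of "lambda1 L" "\<lambda>k. 1" u] by simp
qed

lemma wn_finite_mono:
  assumes "l > (0::real)" "ennreal l * x \<le> y" "y < \<infinity>" shows "x < \<infinity>"
  using assms by (cases "x = \<infinity>") (auto simp: ennreal_mult_top less_top top_unique)

lemma hn_finite: "L > 0 \<Longrightarrow> u 0 = 0 \<Longrightarrow> vn L u < \<infinity> \<Longrightarrow> hn u < \<infinity>"
  by (rule wn_finite_mono[OF lambda1_pos hn_le_vn])

text \<open>The pointwise part of membership in \<open>H_sp\<close>, separated from summability
  because it passes to coefficientwise limits and through time integrals by linearity alone.\<close>

definition fld :: "real \<Rightarrow> fourier \<Rightarrow> bool" where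
  "fld L u \<longleftrightarrow> u 0 = 0 \<and> (\<forall>k. u (-k) = vcnj (u k)) \<and> (\<forall>k. cdot (rvec (kappa L k)) (u k) = 0)"

lemma H_sp_iff: "u \<in> H_sp L \<longleftrightarrow> fld L u \<and> hn u < \<infinity>"
  by (auto simp: H_sp_def fld_def wn_def summable_on_csum)

lemma V_sp_iff: "L > 0 \<Longrightarrow> u \<in> V_sp L \<longleftrightarrow> fld L u \<and> vn L u < \<infinity>"
  using hn_finite[of L u] by (auto simp: V_sp_def H_sp_iff wn_def summable_on_csum fld_def)

section \<open>Vector algebra in complex space\<close>

lemma cdot_add_right: "cdot c (a + b) = cdot c a + cdot c b"
  and cdot_diff_left: "cdot (a - b) c = cdot a c - cdot b c"
  and cdot_diff_right: "cdot c (a - b) = cdot c a - cdot c b"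
  and cdot_scale_left: "cdot (z *s a) b = z * cdot a b"
  and cdot_scale_right: "cdot a (z *s b) = z * cdot a b"
  and cdot_commute: "cdot a b = cdot b a"
  and cdot_zero_left [simp]: "cdot 0 a = 0"
  and cdot_zero_right [simp]: "cdot a 0 = 0"
  by (simp_all add: cdot_def sum.distrib sum_subtractf sum_distrib_left algebra_simps)

lemma vcnj_add: "vcnj (a + b) = vcnj a + vcnj b"
  and vcnj_diff: "vcnj (a - b) = vcnj a - vcnj b"
  and vcnj_scale: "vcnj (z *s a) = cnj z *s vcnj a"
  and vcnj_vcnj [simp]: "vcnj (vcnj a) = a"
  and vcnj_zero [simp]: "vcnj 0 = 0"
  and vcnj_rvec [simp]: "vcnj (rvec x) = rvec x"
  and cnj_cdot: "cnj (cdot a b) = cdot (vcnj a) (vcnj b)"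
  by (simp_all add: vcnj_def vec_eq_iff cdot_def rvec_def)

lemma norm_vcnj [simp]: "norm (vcnj a) = norm a"
  by (simp add: norm_vec_def vcnj_def)

lemma inner_eq_cdot: "a \<bullet> b = Re (cdot a (vcnj b))"
  by (simp add: inner_vec_def cdot_def vcnj_def inner_complex_def Re_sum)

lemma norm_cdot_le: "norm (cdot a b) \<le> norm a * norm b"
proof -
  have "norm (cdot a b) \<le> (\<Sum>i\<in>UNIV. \<bar>norm (a $ i)\<bar> * \<bar>norm (b $ i)\<bar>)"
    unfolding cdot_def by (rule order_trans[OF norm_sum]) (simp add: norm_mult)
  also have "\<dots> \<le> norm a * norm b" unfolding norm_vec_def by (rule L2_set_mult_ineq)
  finally show ?thesis .
qed

lemma norm_rvec [simp]: "norm (rvec x) = norm x"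
  by (simp add: norm_vec_def rvec_def)

lemma norm_vscale: "norm (z *s a) = norm z * norm (a :: complex^3)"
  by (simp add: norm_vec_def norm_mult L2_set_right_distrib)

lemma norm_kappa: "norm (kappa L k) = sqrt (ksq L k)"
  by (simp add: ksq_def)

lemma kappa_diff: "kappa L (k - j) = kappa L k - kappa L j"
  and kappa_minus: "kappa L (- k) = - kappa L k"
  and kappa_0 [simp]: "kappa L 0 = 0"
  by (simp_all add: kappa_def vec_eq_iff algebra_simps diff_divide_distrib)

lemma rvec_diff: "rvec (x - y) = rvec x - rvec y"
  and rvec_minus: "rvec (- x) = - rvec x"
  and rvec_0 [simp]: "rvec 0 = 0"
  by (simp_all add: rvec_def vec_eq_iff)

lemma cdot_minus_right: "cdot a (- b) = - cdot a b"
  and cdot_minus_left: "cdot (- a) b = - cdot a b"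
  by (simp_all add: cdot_def sum_negf)

lemma cdot_rvec_self: "cdot (rvec (kappa L k)) (rvec (kappa L k)) = of_real (ksq L k)"
  by (simp add: cdot_def rvec_def ksq_def norm_vec_def L2_set_def sum_nonneg power2_eq_square)

lemma proj_div_free: "ksq L k \<noteq> 0 \<Longrightarrow> cdot (rvec (kappa L k)) (proj L k w) = 0"
  by (simp add: proj_def cdot_diff_right cdot_scale_right cdot_rvec_self)

lemma proj_add: "proj L k (a + b) = proj L k a + proj L k b"
  by (simp add: proj_def cdot_add_right add_divide_distrib vec_eq_iff algebra_simps)

lemma proj_diff: "proj L k (a - b) = proj L k a - proj L k b"
  by (simp add: proj_def cdot_diff_right diff_divide_distrib vec_eq_iff algebra_simps)

text \<open>Pythagoras: the removed part is a multiple of \<open>kappa L k\<close> and orthogonal to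
  the rest. Where \<open>ksq\<close> vanishes, division by zero turns \<open>proj\<close> into the
  identity.\<close>

lemma norm_proj_le: "norm (proj L k w) \<le> norm w"
proof (cases "ksq L k = 0")
  case True then show ?thesis by (simp add: proj_def)
next
  case False
  let ?c = "cdot (rvec (kappa L k)) w / complex_of_real (ksq L k)"
  let ?p = "?c *s rvec (kappa L k)"
  have w: "w = proj L k w + ?p" by (simp add: proj_def)
  have "cdot (proj L k w) (vcnj ?p) = 0"
    using proj_div_free[OF False, of w]
    by (simp add: vcnj_scale cdot_scale_right cdot_commute[of "proj L k w"])
  then have "proj L k w \<bullet> ?p = 0" by (simp add: inner_eq_cdot)
  then have "(norm w)\<^sup>2 = (norm (proj L k w))\<^sup>2 + (norm ?p)\<^sup>2"
    by (subst w) (simp add: power2_norm_eq_inner inner_add_left inner_add_right inner_commute)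
  then show ?thesis by (metis le_add_same_cancel1 norm_ge_zero power2_le_imp_le zero_le_power2)
qed

lemma inner_proj:
  assumes "cdot (rvec (kappa L k)) c = 0"
  shows "proj L k w \<bullet> c = w \<bullet> c"
proof -
  have "cdot (rvec (kappa L k)) (vcnj c) = cnj (cdot (rvec (kappa L k)) c)"
    by (simp add: cnj_cdot)
  then have "cdot (rvec (kappa L k)) (vcnj c) = 0" using assms by simp
  then show ?thesis by (simp add: inner_eq_cdot proj_def cdot_diff_left cdot_scale_left)
qed

section \<open>The bilinear term\<close>

definition bterm :: "real \<Rightarrow> fourier \<Rightarrow> fourier \<Rightarrow> int^3 \<Rightarrow> int^3 \<Rightarrow> complex^3" where
  "bterm L u v k j = (\<i> * cdot (u j) (rvec (kappa L (k - j)))) *s v (k - j)"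

lemma bil_bterm: "bil L u v k = (if k = 0 then 0 else proj L k (infsum (bterm L u v k) UNIV))"
  unfolding bil_def bterm_def[abs_def] ..

lemma norm_bterm:
  "norm (bterm L u v k j) \<le> norm (u j) * (sqrt (ksq L (k - j)) * norm (v (k - j)))"
proof -
  have "norm (bterm L u v k j) = norm (cdot (u j) (rvec (kappa L (k - j)))) * norm (v (k - j))"
    by (simp add: bterm_def norm_vscale norm_mult)
  also have "\<dots> \<le> norm (u j) * norm (rvec (kappa L (k - j))) * norm (v (k - j))"
    by (intro mult_right_mono norm_cdot_le) auto
  finally show ?thesis by (simp add: norm_kappa mult.assoc)
qed

lemma csum_bterm:
  "csum (\<lambda>j. ennreal (norm (bterm L u v k j)))
    \<le> csum (\<lambda>j. ennreal (norm (u j)) * ennreal (sqrt (ksq L (k - j)) * norm (v (k - j))))"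
  by (intro nn_integral_mono) (auto simp flip: ennreal_mult intro!: ennreal_leI norm_bterm)

lemma vn_eq_sq: "vn L v = csum (\<lambda>j. (ennreal (sqrt (ksq L j) * norm (v j)))\<^sup>2)"
  by (simp add: wn_def ennreal_power power_mult_distrib)

lemma bterm_finite:
  assumes "hn u < \<infinity>" "vn L v < \<infinity>"
  shows "csum (\<lambda>j. ennreal (norm (bterm L u v k j))) < \<infinity>"
proof -
  let ?S = "csum (\<lambda>j. ennreal (norm (u j)) * ennreal (sqrt (ksq L (k - j)) * norm (v (k - j))))"
  have "?S\<^sup>2 \<le> hn u * vn L v"
    using conv_pointwise[of "\<lambda>j. ennreal (norm (u j))" "\<lambda>j. ennreal (sqrt (ksq L j) * norm (v j))" k]
    by (simp add: hn_eq vn_eq_sq)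
  also have "\<dots> < \<infinity>" using assms by (simp add: ennreal_mult_less_top)
  finally have "?S < \<infinity>" by (auto simp: power2_eq_square ennreal_mult_less_top)
  with csum_bterm[of L u v k] show ?thesis by (rule le_less_trans)
qed

lemma integrable_bterm:
  "hn u < \<infinity> \<Longrightarrow> vn L v < \<infinity> \<Longrightarrow> integrable (count_space UNIV) (bterm L u v k)"
  by (intro integrable_csum bterm_finite)

lemma infsum_bterm:
  "hn u < \<infinity> \<Longrightarrow> vn L v < \<infinity> \<Longrightarrow> infsum (bterm L u v k) UNIV = (LINT j|count_space UNIV. bterm L u v k j)"
  by (rule infsum_eq_integral[OF integrable_bterm])

text \<open>If the convolution sum fails to converge absolutely, the upper bound is infinite, so no
  regularity of \<open>u\<close> or \<open>v\<close> has to be assumed.\<close>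

lemma norm_bil_le:
  "ennreal (norm (bil L u v k))
    \<le> csum (\<lambda>j. ennreal (norm (u j)) * ennreal (sqrt (ksq L (k - j)) * norm (v (k - j))))"
proof -
  have "ennreal (norm (bil L u v k)) \<le> csum (\<lambda>j. ennreal (norm (bterm L u v k j)))"
  proof (cases "csum (\<lambda>j. ennreal (norm (bterm L u v k j))) < \<infinity>")
    case True
    then have i: "integrable (count_space UNIV) (bterm L u v k)" by (rule integrable_csum)
    have "norm (bil L u v k) \<le> norm (infsum (bterm L u v k) UNIV)"
      by (simp add: bil_bterm norm_proj_le)
    also have "\<dots> \<le> (LINT j|count_space UNIV. norm (bterm L u v k j))"
      unfolding infsum_eq_integral[OF i] by (rule integral_norm_bound)
    finally have "ennreal (norm (bil L u v k)) \<le> ennreal (LINT j|count_space UNIV. norm (bterm L u v k j))"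
      by (rule ennreal_leI)
    also have "\<dots> = csum (\<lambda>j. ennreal (norm (bterm L u v k j)))"
      using i by (subst nn_integral_eq_integral) auto
    finally show ?thesis .
  qed (simp add: not_less top_unique)
  then show ?thesis using csum_bterm by (rule order_trans)
qed

text \<open>A convolution of \<open>u\<close> in l^1 with the gradient of \<open>v\<close> in l^2.
  The l^1 norm, which stands in for the supremum norm of \<open>u\<close>, is what costs two
  derivatives of \<open>u\<close>.\<close>

lemma hn_bil:
  assumes L: "L > 0" and u: "u 0 = 0"
  shows "hn (bil L u v) \<le> CL L * an L u * vn L v"
proof -
  have "hn (bil L u v) \<le> csum (\<lambda>k. (csum (\<lambda>j. ennreal (norm (u j)) * ennreal (sqrt (ksq L (k - j)) * norm (v (k - j)))))\<^sup>2)"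
    unfolding hn_eq by (intro nn_integral_mono power_mono norm_bil_le) auto
  also have "\<dots> \<le> (csum (\<lambda>j. ennreal (norm (u j))))\<^sup>2 * vn L v"
    unfolding vn_eq_sq by (rule conv_young) auto
  also have "\<dots> \<le> (CL L * an L u) * vn L v"
    unfolding wn_def[of "\<lambda>k. (ksq L k)\<^sup>2"]
    by (intro mult_right_mono csum_le_weighted[OF L]) (auto simp: u)
  finally show ?thesis .
qed

lemma tri_csum:
  assumes L: "L > 0" and u: "u 0 = 0" and c: "c 0 = 0"
  shows "(csum (\<lambda>k. csum (\<lambda>j. ennreal (norm (u j) * (sqrt (ksq L (k - j)) * norm (v (k - j))) * norm (c k)))))\<^sup>2
     \<le> CL L * vn L u * vn L v * vn L c"
  using trilinear_csum[OF L, of "\<lambda>j. norm (u j)" "\<lambda>j. sqrt (ksq L j) * norm (v j)" "\<lambda>k. norm (c k)"]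
  by (simp add: u c wn_def power_mult_distrib)

text \<open>The version of the estimate suited to Leray-Hopf solutions: one derivative on each of
  the three fields. It bounds a sum of absolute values, as needed to justify exchanging sums and
  time integrals.\<close>

lemma tri:
  assumes L: "L > 0" and u: "u 0 = 0" and c: "c 0 = 0"
  shows "(csum (\<lambda>k. ennreal (norm (bil L u v k) * norm (c k))))\<^sup>2 \<le> CL L * vn L u * vn L v * vn L c"
proof -
  have "ennreal (norm (bil L u v k) * norm (c k)) \<le>
     csum (\<lambda>j. ennreal (norm (u j) * (sqrt (ksq L (k - j)) * norm (v (k - j))) * norm (c k)))" for k
  proof -
    have "ennreal (norm (bil L u v k) * norm (c k)) \<le>
      csum (\<lambda>j. ennreal (norm (u j)) * ennreal (sqrt (ksq L (k - j)) * norm (v (k - j)))) * ennreal (norm (c k))"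
      by (subst ennreal_mult) (auto intro!: mult_right_mono norm_bil_le)
    also have "\<dots> = csum (\<lambda>j. ennreal (norm (u j) * (sqrt (ksq L (k - j)) * norm (v (k - j))) * norm (c k)))"
      by (subst nn_integral_multc[symmetric]) (auto simp: ennreal_mult)
    finally show ?thesis .
  qed
  then have "csum (\<lambda>k. ennreal (norm (bil L u v k) * norm (c k))) \<le>
    csum (\<lambda>k. csum (\<lambda>j. ennreal (norm (u j) * (sqrt (ksq L (k - j)) * norm (v (k - j))) * norm (c k))))"
    by (rule nn_integral_mono)
  then have "(csum (\<lambda>k. ennreal (norm (bil L u v k) * norm (c k))))\<^sup>2 \<le>
    (csum (\<lambda>k. csum (\<lambda>j. ennreal (norm (u j) * (sqrt (ksq L (k - j)) * norm (v (k - j))) * norm (c k)))))\<^sup>2"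
    by (intro power_mono) auto
  also have "\<dots> \<le> CL L * vn L u * vn L v * vn L c" by (rule tri_csum[where u=u and c=c, OF L u c])
  finally show ?thesis .
qed

lemma bil_diff_split:
  assumes "hn u < \<infinity>" "hn u' < \<infinity>" "vn L u < \<infinity>" "vn L u' < \<infinity>"
  shows "bil L u u k - bil L u' u' k = bil L (\<lambda>k. u k - u' k) u k + bil L u' (\<lambda>k. u k - u' k) k"
proof -
  let ?d = "\<lambda>k. u k - u' k"
  have d: "hn ?d < \<infinity>" "vn L ?d < \<infinity>"
    using wn_finite_add[OF assms(1,2), of ?d] wn_finite_add[OF assms(3,4), of ?d] by (simp_all add: norm_triangle_ineq4)
  have "bterm L u u k j - bterm L u' u' k j = bterm L ?d u k j + bterm L u' ?d k j" for j
    by (simp add: bterm_def cdot_diff_left vec_eq_iff algebra_simps)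
  then have "(LINT j|count_space UNIV. bterm L u u k j) - (LINT j|count_space UNIV. bterm L u' u' k j)
    = (LINT j|count_space UNIV. bterm L ?d u k j) + (LINT j|count_space UNIV. bterm L u' ?d k j)"
    using assms d by (simp add: integrable_bterm flip: Bochner_Integration.integral_diff Bochner_Integration.integral_add)
  then show ?thesis using assms d
    by (simp add: bil_bterm infsum_bterm flip: proj_add proj_diff)
qed

lemma bounded_linear_vcnj: "bounded_linear vcnj"
proof (rule bounded_linear_intro[where K=1])
  show "vcnj (r *\<^sub>R x) = r *\<^sub>R vcnj x" for r x by (simp add: vcnj_def vec_eq_iff)
qed (simp_all add: vcnj_add)

lemma fld_bil:
  assumes L: "L > 0" and u: "fld L u" "hn u < \<infinity>" and v: "fld L v" "vn L v < \<infinity>"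
  shows "fld L (bil L u v)"
proof -
  have "bil L u v (- k) = vcnj (bil L u v k)" for k
  proof (cases "k = 0")
    case True then show ?thesis by (simp add: bil_bterm)
  next
    case False
    have b: "bterm L u v (- k) (- j) = vcnj (bterm L u v k j)" for j
    proof -
      have 1: "- k - - j = - (k - j)" by simp
      have "u (- j) = vcnj (u j)" "v (- (k - j)) = vcnj (v (k - j))"
        using u v unfolding fld_def by blast+
      then show ?thesis
        unfolding bterm_def 1 kappa_minus rvec_minus
        by (simp add: vcnj_scale cnj_cdot cdot_minus_right)
    qed
    have "(LINT j|count_space UNIV. bterm L u v (- k) j) = (LINT j|count_space UNIV. bterm L u v (- k) (- j))"
      by (rule integral_bij_count_space[OF bij_minus, symmetric])
    also have "\<dots> = vcnj (LINT j|count_space UNIV. bterm L u v k j)"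
      unfolding b by (rule integral_bounded_linear[OF bounded_linear_vcnj integrable_bterm[OF u(2) v(2)]])
    finally have *: "infsum (bterm L u v (- k)) UNIV = vcnj (infsum (bterm L u v k) UNIV)"
      using u v by (simp add: infsum_bterm)
    have "proj L (- k) (vcnj w) = vcnj (proj L k w)" for w
      by (simp add: proj_def vcnj_diff vcnj_scale cnj_cdot kappa_minus rvec_minus cdot_minus_left)
    then show ?thesis using False by (simp add: bil_bterm *)
  qed
  moreover have "cdot (rvec (kappa L k)) (bil L u v k) = 0" for k
    using ksq_pos[OF L, of k] by (cases "k = 0") (auto simp: bil_bterm proj_div_free)
  ultimately show ?thesis by (simp add: fld_def bil_bterm)
qed

text \<open>The L^2 inner product without the volume factor \<open>L^3\<close>; on
  \<open>complex^3\<close> the product \<open>\<bullet>\<close> is the real part of the Hermitian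
  one. The integral over the counting measure makes Fubini's theorem directly applicable.\<close>

definition ip :: "fourier \<Rightarrow> fourier \<Rightarrow> real" where
  "ip u v = (LINT k|count_space UNIV. u k \<bullet> v k)"

text \<open>Both sides are sums over pairs \<open>(k, j)\<close>, exchanged by the involution \<open>(k, j) \<mapsto> (j - k, j)\<close>: the
  reality condition turns \<open>c (-k)\<close> into the conjugate of \<open>c k\<close>, and since \<open>a\<close> is divergence free \<open>a j\<close>
  does not see the difference between the wave vectors of \<open>k\<close> and \<open>k - j\<close>.\<close>
lemma b3_antisym:
  assumes L: "L > 0"
    and a: "fld L a" "vn L a < \<infinity>" and b: "fld L b" "vn L b < \<infinity>" and c: "fld L c" "vn L c < \<infinity>"
  shows "ip (bil L a b) c = - ip (bil L a c) b"
proof -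
  define T where "T b c p = (case p of (k, j) \<Rightarrow> bterm L a b k j \<bullet> c k)" for b c and p :: "(int^3) \<times> (int^3)"
  have a0: "a 0 = 0" and ha: "hn a < \<infinity>"
    using a hn_finite[OF L] by (auto simp: fld_def)
  have key: "ip (bil L a b) c = (LINT p|count_space UNIV. T b c p)"
    if b: "fld L b" "vn L b < \<infinity>" and c: "fld L c" "vn L c < \<infinity>" for b c
  proof -
    have c0: "c 0 = 0" using c by (simp add: fld_def)
    have "csum (\<lambda>p. ennreal (norm (T b c p))) = csum (\<lambda>k. csum (\<lambda>j. ennreal (norm (T b c (k, j)))))"
      using nn_integral_fst_count_space[of "\<lambda>p. ennreal (norm (T b c p))"] by simp
    also have "\<dots> \<le> csum (\<lambda>k. csum (\<lambda>j. ennreal (norm (a j) * (sqrt (ksq L (k - j)) * norm (b (k - j))) * norm (c k))))"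
    proof (intro nn_integral_mono ennreal_leI)
      fix k j
      have "norm (T b c (k, j)) \<le> norm (bterm L a b k j) * norm (c k)"
        by (simp add: T_def Cauchy_Schwarz_ineq2)
      also have "\<dots> \<le> norm (a j) * (sqrt (ksq L (k - j)) * norm (b (k - j))) * norm (c k)"
        by (intro mult_right_mono norm_bterm) auto
      finally show "norm (T b c (k, j)) \<le> norm (a j) * (sqrt (ksq L (k - j)) * norm (b (k - j))) * norm (c k)" .
    qed
    also have "\<dots> < \<infinity>"
    proof -
      have "CL L * vn L a * vn L b * vn L c < \<infinity>"
        using a b c CL_finite[OF L] by (simp add: ennreal_mult_less_top)
      from le_less_trans[OF tri_csum[where u=a and c=c and v=b, OF L a0 c0] this] show ?thesis
        by (auto simp: power2_eq_square ennreal_mult_less_top)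
    qed
    finally have "integrable (count_space UNIV) (T b c)" by (rule integrable_csum)
    then have i: "integrable (count_space UNIV \<Otimes>\<^sub>M count_space UNIV) (T b c)"
      by (simp add: pair_measure_countable)
    interpret pair_sigma_finite "count_space (UNIV :: (int^3) set)" "count_space (UNIV :: (int^3) set)"
      by (simp add: pair_sigma_finite_def sigma_finite_measure_count_space)
    have "bil L a b k \<bullet> c k = (LINT j|count_space UNIV. T b c (k, j))" for k
    proof (cases "k = 0")
      case True then show ?thesis by (simp add: c0 T_def)
    next
      case False
      have "bil L a b k \<bullet> c k = infsum (bterm L a b k) UNIV \<bullet> c k"
        using False c by (simp add: bil_bterm inner_proj fld_def)
      also have "\<dots> = (LINT j|count_space UNIV. bterm L a b k j \<bullet> c k)"
        using infsum_bterm[OF ha b(2)] integrable_bterm[OF ha b(2), of k] by simp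
      finally show ?thesis by (simp add: T_def)
    qed
    then have "ip (bil L a b) c = (LINT k|count_space UNIV. LINT j|count_space UNIV. T b c (k, j))"
      by (simp add: ip_def)
    also have "\<dots> = integral\<^sup>L (count_space UNIV \<Otimes>\<^sub>M count_space UNIV) (T b c)"
      using integral_fst'[OF i] by simp
    finally show ?thesis by (simp add: pair_measure_countable)
  qed
  have bij: "bij (\<lambda>(k, j). (j - k, j) :: (int^3) \<times> (int^3))"
    by (rule bij_betwI[where g="\<lambda>(k, j). (j - k, j)"]) auto
  have T: "T c b (j - k, j) = - T b c (k, j)" for k j
  proof -
    have d: "cdot (a j) (rvec (kappa L j)) = 0" using a by (simp add: fld_def cdot_commute)
    have cb: "c (- k) = vcnj (c k)" "b (j - k) = vcnj (b (k - j))"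
      using b c unfolding fld_def by (metis minus_diff_eq)+
    have 1: "j - k - j = - k" by simp
    show ?thesis
      unfolding T_def bterm_def prod.case 1 cb inner_eq_cdot kappa_minus rvec_minus kappa_diff rvec_diff
      by (simp add: cdot_diff_right d cdot_minus_right cdot_minus_left cdot_scale_left cdot_scale_right
          cdot_commute[of "vcnj (c k)" "b (k - j)"])
  qed
  have "ip (bil L a c) b = (LINT p|count_space UNIV. T c b p)" by (rule key[OF c b])
  also have "\<dots> = (LINT p|count_space UNIV. T c b (case p of (k, j) \<Rightarrow> (j - k, j)))"
    by (rule integral_bij_count_space[OF bij, symmetric])
  also have "\<dots> = (LINT p|count_space UNIV. - T b c p)"
    by (intro Bochner_Integration.integral_cong) (auto simp: T)
  also have "\<dots> = - ip (bil L a b) c" by (simp add: key[OF b c])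
  finally show ?thesis by simp
qed

section \<open>Primitives of locally integrable functions\<close>

text \<open>Local absolute continuity with prescribed density, in the integral form used by the
  definition of a weak solution; almost everywhere differentiation never enters.\<close>

definition is_primitive :: "(real \<Rightarrow> 'a::{banach, second_countable_topology}) \<Rightarrow> (real \<Rightarrow> 'a) \<Rightarrow> bool" where
  "is_primitive f f' \<longleftrightarrow> (\<forall>a b. set_integrable lborel {a..b} f')
     \<and> (\<forall>s t. s \<le> t \<longrightarrow> f t - f s = (LINT r:{s..t}|lborel. f' r))"

lemma is_primitiveI:
  assumes "\<And>a b. a \<le> b \<Longrightarrow> set_integrable lborel {a..b} f'"
    and "\<And>s t. s \<le> t \<Longrightarrow> f t - f s = (LINT r:{s..t}|lborel. f' r)"
  shows "is_primitive f f'"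
proof -
  have "set_integrable lborel {a..b} f'" for a b
    using assms(1)[of a b] by (cases "a \<le> b") (auto simp: set_integrable_def)
  then show ?thesis using assms(2) by (auto simp: is_primitive_def)
qed

lemma is_primitive_cong:
  assumes "is_primitive f f'" "\<And>t. f t = g t" "\<And>t. f' t = g' t"
  shows "is_primitive g g'"
proof -
  have "f = g" "f' = g'" using assms by auto
  then show ?thesis using assms by simp
qed

text \<open>Fubini on the square \<open>[s, t]\<^sup>2\<close>, split along the diagonal.\<close>
lemma product_rule:
  fixes prod :: "'a::euclidean_space \<Rightarrow> 'b::euclidean_space \<Rightarrow> 'c::euclidean_space"
  assumes bb: "bounded_bilinear prod" and f: "is_primitive f f'" and g: "is_primitive g g'"
  shows "is_primitive (\<lambda>t. prod (f t) (g t)) (\<lambda>t. prod (f' t) (g t) + prod (f t) (g' t))"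
proof -
  interpret bounded_bilinear prod by (rule bb)
  obtain K where K: "\<And>a b. norm (prod a b) \<le> norm a * norm b * K" "0 < K" using pos_bounded by blast
  have contprod: "continuous_on UNIV (\<lambda>x. prod (fst x) (snd x))"
    by (intro continuous_on continuous_intros)
  have *: "set_integrable lborel {s..t} (\<lambda>t. prod (f' t) (g t) + prod (f t) (g' t)) \<and>
     prod (f t) (g t) - prod (f s) (g s) = (LINT r:{s..t}|lborel. prod (f' r) (g r) + prod (f r) (g' r))"
    if st: "s \<le> t" for s t
  proof -
    define \<phi> where "\<phi> r = indicator {s..t} r *\<^sub>R f' r" for r
    define \<psi> where "\<psi> r = indicator {s..t} r *\<^sub>R g' r" for r
    have i\<phi>: "integrable lborel \<phi>" and i\<psi>: "integrable lborel \<psi>"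
      using f g unfolding is_primitive_def set_integrable_def \<phi>_def[abs_def] \<psi>_def[abs_def] by blast+
    then have [measurable]: "\<phi> \<in> borel_measurable lborel" "\<psi> \<in> borel_measurable lborel" by auto
    have I\<phi>: "(LINT r|lborel. \<phi> r) = f t - f s" and I\<psi>: "(LINT r|lborel. \<psi> r) = g t - g s"
      using f g st unfolding is_primitive_def set_lebesgue_integral_def \<phi>_def \<psi>_def by auto
    have part\<phi>: "(LINT q|lborel. indicator {..r} q *\<^sub>R \<phi> q) = f r - f s" if "r \<in> {s..t}" for r
    proof -
      have "(LINT q|lborel. indicator {..r} q *\<^sub>R \<phi> q) = (LINT q:{s..r}|lborel. f' q)"
        unfolding set_lebesgue_integral_def \<phi>_def using that
        by (intro Bochner_Integration.integral_cong) (auto simp: indicator_def)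
      then show ?thesis using f that by (simp add: is_primitive_def)
    qed
    have part\<psi>: "(LINT q|lborel. indicator {..r} q *\<^sub>R \<psi> q) = g r - g s" if "r \<in> {s..t}" for r
    proof -
      have "(LINT q|lborel. indicator {..r} q *\<^sub>R \<psi> q) = (LINT q:{s..r}|lborel. g' q)"
        unfolding set_lebesgue_integral_def \<psi>_def using that
        by (intro Bochner_Integration.integral_cong) (auto simp: indicator_def)
      then show ?thesis using g that by (simp add: is_primitive_def)
    qed
    define W where "W p = (case p of (r, q) \<Rightarrow> prod (\<phi> r) (\<psi> q))" for p
    have meas_prod: "(\<lambda>x. prod (a x) (b x)) \<in> borel_measurable M"
      if "a \<in> borel_measurable M" "b \<in> borel_measurable M" for a b and M :: "(real \<times> real) measure"
      using borel_measurable_continuous_Pair[OF that contprod] .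
    have W_meas [measurable]: "W \<in> borel_measurable (lborel \<Otimes>\<^sub>M lborel)"
      unfolding W_def[abs_def] case_prod_unfold by (rule meas_prod) measurable
    have "(\<integral>\<^sup>+p. ennreal (norm (W p)) \<partial>(lborel \<Otimes>\<^sub>M lborel))
       \<le> (\<integral>\<^sup>+p. ennreal K * (ennreal (norm (\<phi> (fst p))) * ennreal (norm (\<psi> (snd p)))) \<partial>(lborel \<Otimes>\<^sub>M lborel))"
    proof (rule nn_integral_mono)
      fix p :: "real \<times> real"
      have "norm (W p) \<le> K * (norm (\<phi> (fst p)) * norm (\<psi> (snd p)))"
        using K(1)[of "\<phi> (fst p)" "\<psi> (snd p)"] by (simp add: W_def case_prod_unfold mult.commute)
      then show "ennreal (norm (W p)) \<le> ennreal K * (ennreal (norm (\<phi> (fst p))) * ennreal (norm (\<psi> (snd p))))"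
        using K(2) by (simp flip: ennreal_mult add: ennreal_leI)
    qed
    also have "\<dots> = ennreal K * ((\<integral>\<^sup>+r. ennreal (norm (\<phi> r)) \<partial>lborel) * (\<integral>\<^sup>+r. ennreal (norm (\<psi> r)) \<partial>lborel))"
      by (subst lborel.nn_integral_fst[symmetric]) (simp_all add: nn_integral_cmult nn_integral_multc)
    also have "\<dots> < \<infinity>"
      using i\<phi> i\<psi> by (auto simp: ennreal_mult_less_top integrable_iff_bounded)
    finally have iW: "integrable (lborel \<Otimes>\<^sub>M lborel) W"
      by (intro integrableI_bounded W_meas)
    define A where "A p = indicator {p. snd p \<le> fst p} p *\<^sub>R W p" for p
    define B where "B p = indicator {p. fst p < snd p} p *\<^sub>R W p" for p
    have setA [measurable]: "{p. snd p \<le> fst p} \<in> sets (lborel \<Otimes>\<^sub>M lborel :: (real\<times>real) measure)"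
      "{p. fst p < snd p} \<in> sets (lborel \<Otimes>\<^sub>M lborel :: (real\<times>real) measure)"
    proof -
      have "closed {p :: real \<times> real. snd p \<le> fst p}" "open {p :: real \<times> real. fst p < snd p}"
        by (intro closed_Collect_le open_Collect_less continuous_intros)+
      then show "{p. snd p \<le> fst p} \<in> sets (lborel \<Otimes>\<^sub>M lborel :: (real\<times>real) measure)"
        "{p. fst p < snd p} \<in> sets (lborel \<Otimes>\<^sub>M lborel :: (real\<times>real) measure)"
        unfolding lborel_prod by (simp_all add: borel_closed borel_open)
    qed
    have iA: "integrable (lborel \<Otimes>\<^sub>M lborel) A" and iB: "integrable (lborel \<Otimes>\<^sub>M lborel) B"
      unfolding A_def[abs_def] B_def[abs_def] using iW setA by (auto intro!: integrable_mult_indicator)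
    have WAB: "W p = A p + B p" for p by (cases p) (auto simp: A_def B_def indicator_def)
    have EA: "(LINT q|lborel. A (r, q)) = prod (\<phi> r) (g r - g s)" for r
    proof (cases "r \<in> {s..t}")
      case True
      have "(LINT q|lborel. A (r, q)) = (LINT q|lborel. prod (\<phi> r) (indicator {..r} q *\<^sub>R \<psi> q))"
        by (intro Bochner_Integration.integral_cong) (auto simp: A_def W_def indicator_def zero_right)
      also have "\<dots> = prod (\<phi> r) (LINT q|lborel. indicator {..r} q *\<^sub>R \<psi> q)"
        by (rule integral_bounded_linear[OF bounded_linear_right]) (use i\<psi> in \<open>auto intro!: integrable_mult_indicator\<close>)
      finally show ?thesis using part\<psi>[OF True] by simp
    next
      case False
      then have "\<phi> r = 0" by (simp add: \<phi>_def)
      then show ?thesis by (simp add: A_def W_def zero_left)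
    qed
    have EB: "(LINT r|lborel. B (r, q)) = prod (f q - f s) (\<psi> q)" for q
    proof (cases "q \<in> {s..t}")
      case True
      have "(LINT r|lborel. B (r, q)) = (LINT r|lborel. prod (indicator {..q} r *\<^sub>R \<phi> r) (\<psi> q))"
      proof (rule integral_cong_AE)
        \<comment> \<open>\<open>B\<close> omits the diagonal, whereas \<open>{..q}\<close> contains
          \<open>q\<close>; the two sides differ only at the null set \<open>r = q\<close>.\<close>
        show "AE r in lborel. B (r, q) = prod (indicator {..q} r *\<^sub>R \<phi> r) (\<psi> q)"
          using AE_lborel_singleton[of q]
          by eventually_elim (auto simp: B_def W_def indicator_def zero_left)
        have [measurable]: "B \<in> borel_measurable (lborel \<Otimes>\<^sub>M lborel)" using iB by auto
        show "(\<lambda>r. B (r, q)) \<in> borel_measurable lborel" by measurable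
        have "bounded_linear (\<lambda>x. prod x (\<psi> q))" by (rule bounded_linear_left)
        then have "integrable lborel (\<lambda>r. prod (indicator {..q} r *\<^sub>R \<phi> r) (\<psi> q))"
          by (rule integrable_bounded_linear) (use i\<phi> in \<open>auto intro!: integrable_mult_indicator\<close>)
        then show "(\<lambda>r. prod (indicator {..q} r *\<^sub>R \<phi> r) (\<psi> q)) \<in> borel_measurable lborel" by auto
      qed
      also have "\<dots> = prod (LINT r|lborel. indicator {..q} r *\<^sub>R \<phi> r) (\<psi> q)"
        by (rule integral_bounded_linear[OF bounded_linear_left]) (use i\<phi> in \<open>auto intro!: integrable_mult_indicator\<close>)
      finally show ?thesis using part\<phi>[OF True] by simp
    next
      case False
      then have "\<psi> q = 0" by (simp add: \<psi>_def)
      then show ?thesis by (simp add: B_def W_def zero_right)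
    qed
    have EW: "(LINT q|lborel. W (r, q)) = prod (\<phi> r) (g t - g s)" for r
      unfolding W_def prod.case I\<psi>[symmetric]
      by (rule integral_bounded_linear[OF bounded_linear_right i\<psi>])
    have "(LINT r|lborel. prod (\<phi> r) (g t - g s)) = integral\<^sup>L (lborel \<Otimes>\<^sub>M lborel) W"
      using lborel_pair.integral_fst'[OF iW] by (simp add: EW)
    moreover have "(LINT r|lborel. prod (\<phi> r) (g t - g s)) = prod (f t - f s) (g t - g s)"
      unfolding I\<phi>[symmetric] by (rule integral_bounded_linear[OF bounded_linear_left i\<phi>])
    moreover have "integral\<^sup>L (lborel \<Otimes>\<^sub>M lborel) W = integral\<^sup>L (lborel \<Otimes>\<^sub>M lborel) A + integral\<^sup>L (lborel \<Otimes>\<^sub>M lborel) B"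
      unfolding WAB using iA iB by simp
    moreover have "integral\<^sup>L (lborel \<Otimes>\<^sub>M lborel) A = (LINT r|lborel. prod (\<phi> r) (g r - g s))"
      using lborel_pair.integral_fst'[OF iA] by (simp add: EA)
    moreover have "integral\<^sup>L (lborel \<Otimes>\<^sub>M lborel) B = (LINT q|lborel. prod (f q - f s) (\<psi> q))"
      using lborel_pair.integral_snd[of "\<lambda>r q. B (r, q)"] iB by (simp add: EB)
    ultimately have main: "prod (f t - f s) (g t - g s) =
       (LINT r|lborel. prod (\<phi> r) (g r - g s)) + (LINT q|lborel. prod (f q - f s) (\<psi> q))" by simp
    have i1: "integrable lborel (\<lambda>r. prod (\<phi> r) (g r - g s))"
      using lborel_pair.integrable_fst'[OF iA] by (simp add: EA)
    have i2: "integrable lborel (\<lambda>q. prod (f q - f s) (\<psi> q))"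
      using lborel_pair.integrable_snd[of "\<lambda>r q. B (r, q)"] iB by (simp add: EB)
    \<comment> \<open>The Fubini identity concerns increments from \<open>s\<close>; the next two
      integrals restore the boundary values \<open>g s\<close> and \<open>f s\<close>.\<close>
    have i3: "integrable lborel (\<lambda>r. prod (\<phi> r) (g s))"
      by (rule integrable_bounded_linear[OF bounded_linear_left i\<phi>])
    have i4: "integrable lborel (\<lambda>r. prod (f s) (\<psi> r))"
      by (rule integrable_bounded_linear[OF bounded_linear_right i\<psi>])
    have eq: "indicator {s..t} r *\<^sub>R (prod (f' r) (g r) + prod (f r) (g' r)) =
      (prod (\<phi> r) (g r - g s) + prod (f r - f s) (\<psi> r)) + (prod (\<phi> r) (g s) + prod (f s) (\<psi> r))" for r
      by (auto simp: \<phi>_def \<psi>_def indicator_def diff_left diff_right zero_left zero_right)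
    have "(LINT r|lborel. prod (\<phi> r) (g s)) = prod (f t - f s) (g s)"
      unfolding I\<phi>[symmetric] by (rule integral_bounded_linear[OF bounded_linear_left i\<phi>])
    moreover have "(LINT r|lborel. prod (f s) (\<psi> r)) = prod (f s) (g t - g s)"
      unfolding I\<psi>[symmetric] by (rule integral_bounded_linear[OF bounded_linear_right i\<psi>])
    ultimately have "(LINT r:{s..t}|lborel. prod (f' r) (g r) + prod (f r) (g' r)) =
       prod (f t - f s) (g t - g s) + (prod (f t - f s) (g s) + prod (f s) (g t - g s))"
      unfolding set_lebesgue_integral_def eq main using i1 i2 i3 i4 by simp
    moreover have "set_integrable lborel {s..t} (\<lambda>t. prod (f' t) (g t) + prod (f t) (g' t))"
      unfolding set_integrable_def eq by (intro Bochner_Integration.integrable_add i1 i2 i3 i4)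
    ultimately show ?thesis by (simp add: diff_left diff_right)
  qed
  show ?thesis by (rule is_primitiveI) (use * in blast)+
qed

lemma is_primitive_continuous:
  fixes f :: "real \<Rightarrow> 'a::euclidean_space"
  assumes "is_primitive f f'" shows "continuous_on UNIV f"
proof -
  have "continuous_on {a..b} f" for a b
  proof -
    have si: "set_integrable lborel {a..b} f'" using assms by (simp add: is_primitive_def)
    have eq: "f a + integral {a..x} f' = f x" if "x \<in> {a..b}" for x
    proof -
      have "set_integrable lborel {a..x} f'" using assms by (simp add: is_primitive_def)
      then have "(LINT r:{a..x}|lborel. f' r) = integral {a..x} f'" by (rule set_borel_integral_eq_integral)
      moreover have "f x - f a = (LINT r:{a..x}|lborel. f' r)" using assms that by (simp add: is_primitive_def)
      ultimately show ?thesis by (simp add: algebra_simps)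
    qed
    have "continuous_on {a..b} (\<lambda>x. f a + integral {a..x} f')"
      using set_borel_integral_eq_integral(1)[OF si]
      by (intro continuous_intros indefinite_integral_continuous_1)
    then show ?thesis by (rule continuous_on_eq) (rule eq)
  qed
  then have "isCont f x" for x
    using continuous_on_interior[of "{x - 1..x + 1}" f x] by simp
  then show ?thesis by (simp add: continuous_on_eq_continuous_at)
qed

lemma is_primitive_measurable:
  fixes f :: "real \<Rightarrow> 'a::euclidean_space"
  shows "is_primitive f f' \<Longrightarrow> f \<in> borel_measurable lborel"
  using borel_measurable_continuous_onI[OF is_primitive_continuous] by simp

lemma is_primitive_exp: "is_primitive (\<lambda>t. exp (c * t)) (\<lambda>t. c * exp (c * t) :: real)"
proof (rule is_primitiveI)
  fix a b :: real assume "a \<le> b"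
  show "set_integrable lborel {a..b} (\<lambda>t. c * exp (c * t))"
    unfolding set_integrable_def
  proof -
    have "continuous_on {a..b} (\<lambda>t. c * exp (c * t))" by (intro continuous_intros)
    then show "integrable lborel (\<lambda>t. indicator {a..b} t *\<^sub>R (c * exp (c * t)))"
      using borel_integrable_atLeastAtMost' unfolding set_integrable_def by blast
  qed
  have "(LINT r|lborel. indicator {a..b} r *\<^sub>R (c * exp (c * r))) = exp (c * b) - exp (c * a)"
    using \<open>a \<le> b\<close> by (intro integral_FTC_Icc) (auto intro!: derivative_eq_intros continuous_intros simp flip: has_real_derivative_iff_has_vector_derivative)
  then show "exp (c * b) - exp (c * a) = (LINT r:{a..b}|lborel. c * exp (c * r))"
    by (simp only: set_lebesgue_integral_def)
qed

section \<open>Exponential kernels\<close>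

definition ker :: "real \<Rightarrow> real \<Rightarrow> real \<Rightarrow> real" where
  "ker b t s = (if s \<le> t then exp (- (b * (t - s))) else 0)"

lemma ker_nonneg [simp]: "0 \<le> ker b t s"
  by (simp add: ker_def)

lemma ker_measurable [measurable]:
  "(\<lambda>p. ker b (fst p) (snd p)) \<in> borel_measurable (borel \<Otimes>\<^sub>M borel)"
  "ker b t \<in> borel_measurable borel" "(\<lambda>t. ker b t s) \<in> borel_measurable borel"
  unfolding ker_def[abs_def] by measurable

lemma ker_mult: "ker b t s * ker c t s = ker (b + c) t s"
  by (simp add: ker_def exp_add[symmetric] algebra_simps)

lemma ker_sq: "(ennreal (ker b t s))\<^sup>2 = ennreal (ker (2 * b) t s)"
  by (simp only: power2_eq_square ennreal_mult[symmetric] ker_nonneg ker_mult mult_2)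

lemma nn_integral_ker_half:
  assumes b: "b > 0" shows "(\<integral>\<^sup>+x. ennreal (ker b x 0) \<partial>lborel) = ennreal (1 / b)"
proof -
  have "((\<lambda>x. - exp (- (b * x)) / b) \<longlongrightarrow> - 0 / b) at_top"
    using b by (intro tendsto_intros filterlim_compose[OF exp_at_bot] filterlim_compose[OF filterlim_uminus_at_bot_at_top]
      filterlim_tendsto_pos_mult_at_top[OF tendsto_const _ filterlim_ident]) auto
  then have "(\<integral>\<^sup>+x. ennreal (exp (- (b * x))) * indicator {0..} x \<partial>lborel) = ennreal (0 - (- exp (- (b * 0)) / b))"
    using b by (intro nn_integral_FTC_atLeast) (auto intro!: derivative_eq_intros)
  moreover have "ennreal (ker b x 0) = ennreal (exp (- (b * x))) * indicator {0..} x" for x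
    by (simp add: ker_def)
  ultimately show ?thesis by simp
qed

lemma nn_integral_ker:
  assumes b: "b > 0" shows "(\<integral>\<^sup>+s. ennreal (ker b t s) \<partial>lborel) = ennreal (1 / b)"
    and "(\<integral>\<^sup>+t. ennreal (ker b t s) \<partial>lborel) = ennreal (1 / b)"
proof -
  have "ker b t (t + - 1 * x) = ker b x 0" for x by (simp add: ker_def)
  then show "(\<integral>\<^sup>+s. ennreal (ker b t s) \<partial>lborel) = ennreal (1 / b)"
    using nn_integral_real_affine[of "\<lambda>s. ennreal (ker b t s)" "-1" t] nn_integral_ker_half[OF b] by simp
  have "ker b (s + 1 * x) s = ker b x 0" for x by (simp add: ker_def)
  then show "(\<integral>\<^sup>+t. ennreal (ker b t s) \<partial>lborel) = ennreal (1 / b)"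
    using nn_integral_real_affine[of "\<lambda>t. ennreal (ker b t s)" 1 s] nn_integral_ker_half[OF b] by simp
qed

text \<open>An integral over the whole past, discounted at rate \<open>b\<close>. It takes the place
  of averages over windows because it composes with the kernels of Duhamel's formula.\<close>

definition wt :: "real \<Rightarrow> real \<Rightarrow> (real \<Rightarrow> ennreal) \<Rightarrow> ennreal" where
  "wt b t F = (\<integral>\<^sup>+s. ennreal (ker b t s) * F s \<partial>lborel)"

lemma wt_mono_AE: "(AE s in lborel. F s \<le> G s) \<Longrightarrow> wt b t F \<le> wt b t G"
  unfolding wt_def by (rule nn_integral_mono_AE) (auto elim!: eventually_mono intro!: mult_left_mono)

lemma wt_mono: "(\<And>s. F s \<le> G s) \<Longrightarrow> wt b t F \<le> wt b t G"
  by (rule wt_mono_AE) simp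

lemma wt_cmult: "F \<in> borel_measurable borel \<Longrightarrow> wt b t (\<lambda>s. c * F s) = c * wt b t F"
  unfolding wt_def by (subst nn_integral_cmult[symmetric]) (auto simp: ac_simps)

lemma wt_add: "F \<in> borel_measurable borel \<Longrightarrow> G \<in> borel_measurable borel \<Longrightarrow>
  wt b t (\<lambda>s. F s + G s) = wt b t F + wt b t G"
  unfolding wt_def by (subst nn_integral_add[symmetric]) (auto simp: distrib_left)

lemma wt_measurable [measurable]:
  "F \<in> borel_measurable borel \<Longrightarrow> (\<lambda>t. wt b t F) \<in> borel_measurable borel"
proof -
  assume [measurable]: "F \<in> borel_measurable borel"
  have "(\<lambda>t. \<integral>\<^sup>+s. (case (t, s) of (t, s) \<Rightarrow> ennreal (ker b t s) * F s) \<partial>lborel) \<in> borel_measurable borel"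
    unfolding ker_def by measurable
  then show ?thesis unfolding wt_def by simp
qed

text \<open>For \<open>s \<le> t \<le> T\<close> the product of the two kernels equals
  \<open>exp (- a * (T - s)) * exp (- (c - a) * (t - s))\<close>. Integrating over \<open>t\<close>
  first leaves the factor \<open>1 / (c - a)\<close>, and \<open>2 * a \<le> c\<close> turns it into
  \<open>2 / c\<close>.\<close>

lemma wt_wt:
  assumes [measurable]: "F \<in> borel_measurable borel" and a: "0 < a" "2 * a \<le> c"
  shows "wt a T (\<lambda>t. wt c t F) \<le> ennreal (2 / c) * wt a T F"
proof -
  have k: "ker a T t * ker c t s \<le> ker a T s * ker (c - a) t s" for t s
    by (auto simp: ker_def exp_add[symmetric] algebra_simps)
  have "wt a T (\<lambda>t. wt c t F) = (\<integral>\<^sup>+t. \<integral>\<^sup>+s. ennreal (ker a T t * ker c t s) * F s \<partial>lborel \<partial>lborel)"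
    unfolding wt_def by (subst nn_integral_cmult[symmetric]) (auto simp: ennreal_mult mult.assoc)
  also have "\<dots> \<le> (\<integral>\<^sup>+t. \<integral>\<^sup>+s. ennreal (ker a T s * ker (c - a) t s) * F s \<partial>lborel \<partial>lborel)"
    by (intro nn_integral_mono mult_right_mono ennreal_leI k) auto
  also have "\<dots> = (\<integral>\<^sup>+s. \<integral>\<^sup>+t. ennreal (ker a T s * ker (c - a) t s) * F s \<partial>lborel \<partial>lborel)"
  proof (rule lborel_pair.Fubini')
    show "(\<lambda>(s, t). ennreal (ker a T s * ker (c - a) t s) * F s) \<in> borel_measurable (lborel \<Otimes>\<^sub>M lborel)"
      unfolding ker_def by measurable
  qed
  also have "\<dots> = (\<integral>\<^sup>+s. ennreal (1 / (c - a)) * (ennreal (ker a T s) * F s) \<partial>lborel)"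
  proof (rule nn_integral_cong)
    fix s
    have "(\<integral>\<^sup>+t. ennreal (ker a T s * ker (c - a) t s) * F s \<partial>lborel) =
       (\<integral>\<^sup>+t. (ennreal (ker a T s) * F s) * ennreal (ker (c - a) t s) \<partial>lborel)"
      by (intro nn_integral_cong) (simp add: ennreal_mult ac_simps)
    also have "\<dots> = (ennreal (ker a T s) * F s) * ennreal (1 / (c - a))"
      using a by (subst nn_integral_cmult) (auto simp: nn_integral_ker)
    finally show "(\<integral>\<^sup>+t. ennreal (ker a T s * ker (c - a) t s) * F s \<partial>lborel) =
      ennreal (1 / (c - a)) * (ennreal (ker a T s) * F s)" by (simp add: mult.commute)
  qed
  also have "\<dots> = ennreal (1 / (c - a)) * wt a T F"
    unfolding wt_def by (subst nn_integral_cmult) auto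
  also have "\<dots> \<le> ennreal (2 / c) * wt a T F"
    using a by (intro mult_right_mono ennreal_leI) (auto simp: field_simps)
  finally show ?thesis .
qed

section \<open>The scalar heat semigroup\<close>

text \<open>Duhamel's formula for y' + c y = f with initial time minus infinity; \<open>ker\<close>
  vanishes on the future.\<close>

definition heat :: "real \<Rightarrow> (real \<Rightarrow> 'a::euclidean_space) \<Rightarrow> real \<Rightarrow> 'a" where
  "heat c f t = (LINT s|lborel. ker c t s *\<^sub>R f s)"

definition sqn :: "(real \<Rightarrow> 'a::real_normed_vector) \<Rightarrow> real \<Rightarrow> ennreal" where
  "sqn f s = (ennreal (norm (f s)))\<^sup>2"

lemma sqn_measurable [measurable]:
  "f \<in> borel_measurable borel \<Longrightarrow> sqn f \<in> borel_measurable borel"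
  unfolding sqn_def[abs_def] by measurable

text \<open>Cauchy-Schwarz after splitting the rate \<open>c\<close> into \<open>c - b/2\<close> and
  \<open>b/2\<close>. The first kernel, squared, integrates to \<open>1 / (2 * c - b)\<close>, at
  most \<open>1 / c\<close>; the second, squared, is the weight of \<open>wt b\<close>. The gain
  \<open>1 / c\<close> is what later pays for derivatives.\<close>

lemma heat_L1:
  fixes f :: "real \<Rightarrow> 'a::euclidean_space"
  assumes [measurable]: "f \<in> borel_measurable borel" and b: "0 < b" "b \<le> c"
  shows "(\<integral>\<^sup>+s. ennreal (norm (ker c t s *\<^sub>R f s)) \<partial>lborel)\<^sup>2 \<le> ennreal (1 / c) * wt b t (sqn f)"
proof -
  have 1: "(\<integral>\<^sup>+s. ennreal (norm (ker c t s *\<^sub>R f s)) \<partial>lborel)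
     = (\<integral>\<^sup>+s. ennreal (ker (c - b/2) t s) * (ennreal (ker (b/2) t s) * ennreal (norm (f s))) \<partial>lborel)"
    by (intro nn_integral_cong) (simp add: ker_mult mult.assoc[symmetric] flip: ennreal_mult)
  have "(\<integral>\<^sup>+s. ennreal (norm (ker c t s *\<^sub>R f s)) \<partial>lborel)\<^sup>2 \<le> (\<integral>\<^sup>+s. (ennreal (ker (c - b/2) t s))\<^sup>2 \<partial>lborel) * (\<integral>\<^sup>+s. (ennreal (ker (b/2) t s) * ennreal (norm (f s)))\<^sup>2 \<partial>lborel)"
    unfolding 1 by (rule Cauchy_Schwarz_nn_integral) auto
  also have "(\<integral>\<^sup>+s. (ennreal (ker (c - b/2) t s))\<^sup>2 \<partial>lborel) = (\<integral>\<^sup>+s. ennreal (ker (2 * (c - b/2)) t s) \<partial>lborel)"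
    by (simp add: ker_sq)
  also have "\<dots> = ennreal (1 / (2 * (c - b/2)))"
    using b by (intro nn_integral_ker) auto
  also have "(\<integral>\<^sup>+s. (ennreal (ker (b/2) t s) * ennreal (norm (f s)))\<^sup>2 \<partial>lborel) = wt b t (sqn f)"
    unfolding wt_def sqn_def by (simp add: power_mult_distrib ker_sq)
  also have "ennreal (1 / (2 * (c - b/2))) * wt b t (sqn f) \<le> ennreal (1 / c) * wt b t (sqn f)"
    using b by (intro mult_right_mono ennreal_leI) (auto simp: field_simps)
  finally show ?thesis .
qed

lemma heat_integrable:
  fixes f :: "real \<Rightarrow> 'a::euclidean_space"
  assumes [measurable]: "f \<in> borel_measurable borel" and b: "0 < b" "b \<le> c" and fin: "wt b t (sqn f) < \<infinity>"
  shows "integrable lborel (\<lambda>s. ker c t s *\<^sub>R f s)"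
proof (rule integrableI_bounded)
  have "(\<integral>\<^sup>+s. ennreal (norm (ker c t s *\<^sub>R f s)) \<partial>lborel)\<^sup>2 < \<infinity>"
    by (rule le_less_trans[OF heat_L1[OF assms(1) b]]) (use fin in \<open>simp add: ennreal_mult_less_top\<close>)
  then show "(\<integral>\<^sup>+s. ennreal (norm (ker c t s *\<^sub>R f s)) \<partial>lborel) < \<infinity>"
    by (auto simp: power2_eq_square ennreal_mult_less_top)
qed measurable

lemma heat_bound:
  assumes f: "f \<in> borel_measurable borel" and b: "0 < b" "b \<le> c"
  shows "sqn (heat c f) t \<le> ennreal (1 / c) * wt b t (sqn f)"
proof -
  have "ennreal (norm (heat c f t)) \<le> (\<integral>\<^sup>+s. ennreal (norm (ker c t s *\<^sub>R f s)) \<partial>lborel)"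
  proof (cases "integrable lborel (\<lambda>s. ker c t s *\<^sub>R f s)")
    case True
    then show ?thesis unfolding heat_def by (rule integral_norm_bound_ennreal)
  qed (simp add: heat_def not_integrable_integral_eq)
  then have "sqn (heat c f) t \<le> (\<integral>\<^sup>+s. ennreal (norm (ker c t s *\<^sub>R f s)) \<partial>lborel)\<^sup>2"
    unfolding sqn_def by (intro power_mono) auto
  then show ?thesis using heat_L1[OF f b] by (rule order_trans)
qed

text \<open>Variation of constants: \<open>exp (c * t)\<close> times the convolution is an ordinary
  integral \<open>P\<close> of \<open>exp (c * s) *\<^sub>R f s\<close>, and the product rule with
  \<open>exp (- c * t)\<close> recovers the equation.\<close>

lemma heat_primitive:
  fixes f :: "real \<Rightarrow> 'a::euclidean_space"
  assumes f [measurable]: "f \<in> borel_measurable borel" and b: "0 < b" "b \<le> c" and fin: "\<And>t. wt b t (sqn f) < \<infinity>"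
  shows "is_primitive (heat c f) (\<lambda>t. f t - c *\<^sub>R heat c f t)"
proof -
  define P where "P t = (LINT s:{..t}|lborel. exp (c * s) *\<^sub>R f s)" for t
  have ek: "indicator {..t} s *\<^sub>R (exp (c * s) *\<^sub>R f s) = exp (c * t) *\<^sub>R (ker c t s *\<^sub>R f s)" for s t
    by (auto simp: ker_def indicator_def exp_add[symmetric] algebra_simps)
  have iP: "set_integrable lborel {..t} (\<lambda>s. exp (c * s) *\<^sub>R f s)" for t
    unfolding set_integrable_def ek
    by (rule integrable_scaleR_right) (rule heat_integrable[OF f b fin])
  have P: "P t = exp (c * t) *\<^sub>R heat c f t" for t
    unfolding P_def set_lebesgue_integral_def ek heat_def by (rule integral_scaleR_right)
  have "is_primitive P (\<lambda>s. exp (c * s) *\<^sub>R f s)"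
  proof (rule is_primitiveI)
    fix s t :: real assume st: "s \<le> t"
    show i: "set_integrable lborel {s..t} (\<lambda>s. exp (c * s) *\<^sub>R f s)"
      by (rule set_integrable_subset[OF iP[of t]]) auto
    have i': "set_integrable lborel {s<..t} (\<lambda>s. exp (c * s) *\<^sub>R f s)"
      by (rule set_integrable_subset[OF iP[of t]]) auto
    have "{..t} = {..s} \<union> {s<..t}" using st by auto
    moreover have "{..s} \<inter> {s<..t} = {}" by auto
    ultimately have "P t = P s + (LINT r:{s<..t}|lborel. exp (c * r) *\<^sub>R f r)"
      unfolding P_def using set_integral_Un[OF _ iP[of s] i'] by metis
    moreover have "(LINT r:{s<..t}|lborel. exp (c * r) *\<^sub>R f r) = (LINT r:{s..t}|lborel. exp (c * r) *\<^sub>R f r)"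
      unfolding set_lebesgue_integral_def
    proof (rule integral_cong_AE)
      show "AE x in lborel. indicator {s<..t} x *\<^sub>R exp (c * x) *\<^sub>R f x = indicator {s..t} x *\<^sub>R exp (c * x) *\<^sub>R f x"
        using AE_lborel_singleton[of s] by eventually_elim (auto simp: indicator_def)
    qed measurable
    ultimately show "P t - P s = (LINT r:{s..t}|lborel. exp (c * r) *\<^sub>R f r)" by simp
  qed
  from product_rule[OF bounded_bilinear_scaleR is_primitive_exp[of "- c"] this]
  show ?thesis
  proof (rule is_primitive_cong)
    fix t
    show "exp (- c * t) *\<^sub>R P t = heat c f t" by (simp add: P flip: exp_add)
    show "(- c * exp (- c * t)) *\<^sub>R P t + exp (- c * t) *\<^sub>R exp (c * t) *\<^sub>R f t = f t - c *\<^sub>R heat c f t"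
      by (simp add: P flip: exp_add)
  qed
qed

lemma heat_measurable:
  fixes f :: "real \<Rightarrow> 'a::euclidean_space"
  assumes "f \<in> borel_measurable borel" "0 < b" "b \<le> c" "\<And>t. wt b t (sqn f) < \<infinity>"
  shows "heat c f \<in> borel_measurable borel"
  using is_primitive_measurable[OF heat_primitive[OF assms]] by simp

lemma heat_bounded_linear:
  assumes "f \<in> borel_measurable borel" "0 < b" "b \<le> c" "wt b t (sqn f) < \<infinity>" "bounded_linear T"
  shows "heat c (\<lambda>s. T (f s)) t = T (heat c f t)"
proof -
  interpret T: bounded_linear T by fact
  have "(LINT s|lborel. T (ker c t s *\<^sub>R f s)) = T (LINT s|lborel. ker c t s *\<^sub>R f s)"
    by (rule integral_bounded_linear[OF assms(5) heat_integrable[OF assms(1-4)]])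
  then show ?thesis by (simp add: heat_def T.scaleR)
qed

lemma heat_diff:
  assumes "f \<in> borel_measurable borel" "g \<in> borel_measurable borel" "0 < b" "b \<le> c"
    "wt b t (sqn f) < \<infinity>" "wt b t (sqn g) < \<infinity>"
  shows "heat c (\<lambda>s. f s - g s) t = heat c f t - heat c g t"
  unfolding heat_def using assms
  by (simp add: scaleR_diff_right heat_integrable[of f b] heat_integrable[of g b])

lemma heat_cong_AE:
  assumes [measurable]: "f \<in> borel_measurable borel" "g \<in> borel_measurable borel" and "AE s in lborel. f s = g s"
  shows "heat c f t = heat c g t"
  unfolding heat_def by (rule integral_cong_AE) (use assms(3) in \<open>auto elim!: eventually_mono\<close>)

lemma heat_shift:
  "heat c f (t + \<rho>) = heat c (\<lambda>s. f (s + \<rho>)) t"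
proof -
  have "heat c f (t + \<rho>) = (LINT s|lborel. ker c (t + \<rho>) (\<rho> + 1 * s) *\<^sub>R f (\<rho> + 1 * s))"
    unfolding heat_def by (subst lborel_integral_real_affine[where c=1 and t=\<rho>]) auto
  also have "\<dots> = heat c (\<lambda>s. f (s + \<rho>)) t"
    unfolding heat_def by (intro Bochner_Integration.integral_cong) (auto simp: ker_def add.commute)
  finally show ?thesis .
qed

section \<open>Pairings of trajectories\<close>

lemma measurable_pair_count:
  fixes F :: "'k::countable \<Rightarrow> 'a \<Rightarrow> 'b::topological_space"
  assumes "\<And>k. F k \<in> borel_measurable M"
  shows "(\<lambda>(x, k). F k x) \<in> borel_measurable (M \<Otimes>\<^sub>M count_space UNIV)"
proof -
  have "(\<lambda>p. F (snd p) (fst p)) \<in> borel_measurable (M \<Otimes>\<^sub>M count_space UNIV)"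
    by (rule measurable_compose_countable[where f="\<lambda>k p. F k (fst p)" and g=snd])
       (auto intro: measurable_compose[OF measurable_fst assms])
  then show ?thesis by (simp add: case_prod_unfold)
qed

lemma ennreal_assoc: "0 \<le> x \<Longrightarrow> ennreal x * (ennreal y * w) = ennreal (x * y) * w"
  by (simp add: ennreal_mult' mult.assoc)

lemma borel_measurable_csum [measurable (raw)]:
  fixes F :: "'k::countable \<Rightarrow> 'a \<Rightarrow> ennreal"
  assumes "\<And>k. F k \<in> borel_measurable M"
  shows "(\<lambda>x. csum (\<lambda>k. F k x)) \<in> borel_measurable M"
proof -
  interpret sigma_finite_measure "count_space (UNIV :: 'k set)"
    by (rule sigma_finite_measure_count_space)
  have "(\<lambda>(x, k). F k x) \<in> borel_measurable (M \<Otimes>\<^sub>M count_space UNIV)"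
    by (rule measurable_pair_count[OF assms])
  then show ?thesis by (rule borel_measurable_nn_integral)
qed

lemma integral_csum_measurable:
  fixes F :: "'k::countable \<Rightarrow> 'a \<Rightarrow> 'b::{banach, second_countable_topology}"
  assumes "\<And>k. F k \<in> borel_measurable M"
  shows "(\<lambda>x. LINT k|count_space UNIV. F k x) \<in> borel_measurable M"
proof -
  interpret sigma_finite_measure "count_space (UNIV :: 'k set)"
    by (rule sigma_finite_measure_count_space)
  have "(\<lambda>(x, k). F k x) \<in> borel_measurable (M \<Otimes>\<^sub>M count_space UNIV)"
    by (rule measurable_pair_count[OF assms])
  then show ?thesis by (rule borel_measurable_lebesgue_integral)
qed

lemma wn_measurable [measurable (raw)]:
  assumes "\<And>k. (\<lambda>t. u t k) \<in> borel_measurable M"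
  shows "(\<lambda>t. wn c (u t)) \<in> borel_measurable M"
proof -
  have "(\<lambda>t. ennreal (c k * (norm (u t k))\<^sup>2)) \<in> borel_measurable M" for k
    using assms[of k] by measurable
  then show ?thesis unfolding wn_def by (rule borel_measurable_csum)
qed

lemma csum_norm_mult:
  "(csum (\<lambda>k. ennreal (norm (u k) * norm (v k))))\<^sup>2 \<le> hn u * hn v"
  using Cauchy_Schwarz_csum[of "\<lambda>k. ennreal (norm (u k))" "\<lambda>k. ennreal (norm (v k))"]
  by (simp add: hn_eq ennreal_mult)

lemma csum_norm_mult_finite:
  assumes "hn u < \<infinity>" "hn v < \<infinity>" shows "csum (\<lambda>k. ennreal (norm (u k) * norm (v k))) < \<infinity>"
proof -
  have "hn u * hn v < \<infinity>" using assms by (simp add: ennreal_mult_less_top)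
  with csum_norm_mult[of u v] have "(csum (\<lambda>k. ennreal (norm (u k) * norm (v k))))\<^sup>2 < \<infinity>" by (rule le_less_trans)
  then show ?thesis by (auto simp: power2_eq_square ennreal_mult_less_top)
qed

lemma integrable_inner_csum:
  assumes "csum (\<lambda>k. ennreal (norm (u k) * norm (v k))) < \<infinity>"
  shows "integrable (count_space UNIV) (\<lambda>k. u k \<bullet> v k)"
proof (rule integrable_csum)
  have "csum (\<lambda>k. ennreal (norm (u k \<bullet> v k))) \<le> csum (\<lambda>k. ennreal (norm (u k) * norm (v k)))"
    by (intro nn_integral_mono ennreal_leI) (simp add: Cauchy_Schwarz_ineq2)
  then show "csum (\<lambda>k. ennreal (norm (u k \<bullet> v k))) < \<infinity>" using assms by (rule le_less_trans)
qed

lemma integrable_ip: "hn u < \<infinity> \<Longrightarrow> hn v < \<infinity> \<Longrightarrow> integrable (count_space UNIV) (\<lambda>k. u k \<bullet> v k)"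
  by (intro integrable_inner_csum csum_norm_mult_finite)

text \<open>The product rule holds in each mode; summing over the modes means exchanging the sum
  with the time integral, and the hypothesis \<open>L1\<close> supplies the absolute convergence
  that Fubini asks for. The two trajectories may differ, so that a weak solution can be paired with
  a more regular one.\<close>

lemma energy_pairing:
  fixes p q p' q' :: "real \<Rightarrow> fourier"
  assumes prim: "\<And>k. is_primitive (\<lambda>t. p t k) (\<lambda>t. p' t k)" "\<And>k. is_primitive (\<lambda>t. q t k) (\<lambda>t. q' t k)"
    and st: "s \<le> t" and fin: "hn (p s) < \<infinity>" "hn (p t) < \<infinity>" "hn (q s) < \<infinity>" "hn (q t) < \<infinity>"
    and L1: "(\<integral>\<^sup>+r. csum (\<lambda>k. ennreal (norm (p' r k) * norm (q r k) + norm (p r k) * norm (q' r k)))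
        * indicator {s..t} r \<partial>lborel) < \<infinity>"
  defines "E \<equiv> \<lambda>r. LINT k|count_space UNIV. p' r k \<bullet> q r k + p r k \<bullet> q' r k"
  shows "set_integrable lborel {s..t} E" and "ip (p t) (q t) - ip (p s) (q s) = (LINT r:{s..t}|lborel. E r)"
proof -
  define D where "D r k = indicator {s..t} r *\<^sub>R (p' r k \<bullet> q r k + p r k \<bullet> q' r k)" for r k
  have pr: "is_primitive (\<lambda>t. p t k \<bullet> q t k) (\<lambda>t. p' t k \<bullet> q t k + p t k \<bullet> q' t k)" for k
    by (rule product_rule[OF bounded_bilinear_inner prim])
  have iD: "integrable lborel (\<lambda>r. D r k)" for k
    using pr[of k] by (simp add: is_primitive_def set_integrable_def D_def)
  have ID: "(LINT r|lborel. D r k) = p t k \<bullet> q t k - p s k \<bullet> q s k" for k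
    using pr[of k] st by (simp add: is_primitive_def set_lebesgue_integral_def D_def)
  interpret cs: sigma_finite_measure "count_space (UNIV :: (int^3) set)"
    by (rule sigma_finite_measure_count_space)
  interpret P: pair_sigma_finite lborel "count_space (UNIV :: (int^3) set)" ..
  have mD: "case_prod D \<in> borel_measurable (lborel \<Otimes>\<^sub>M count_space UNIV)"
    using measurable_pair_count[of "\<lambda>k r. D r k" lborel] iD by simp
  have "(\<integral>\<^sup>+x. ennreal (norm (case_prod D x)) \<partial>(lborel \<Otimes>\<^sub>M count_space UNIV))
    = (\<integral>\<^sup>+r. csum (\<lambda>k. ennreal (norm (D r k))) \<partial>lborel)"
    using mD by (subst cs.nn_integral_fst[symmetric]) auto
  also have "\<dots> \<le> (\<integral>\<^sup>+r. csum (\<lambda>k. ennreal (norm (p' r k) * norm (q r k) + norm (p r k) * norm (q' r k)))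
        * indicator {s..t} r \<partial>lborel)"
  proof (rule nn_integral_mono)
    fix r
    have "norm (p' r k \<bullet> q r k + p r k \<bullet> q' r k) \<le> norm (p' r k) * norm (q r k) + norm (p r k) * norm (q' r k)" for k
      by (rule order_trans[OF norm_triangle_ineq]) (simp add: add_mono Cauchy_Schwarz_ineq2)
    then have le: "csum (\<lambda>k. ennreal (norm (p' r k \<bullet> q r k + p r k \<bullet> q' r k))) \<le>
        csum (\<lambda>k. ennreal (norm (p' r k) * norm (q r k) + norm (p r k) * norm (q' r k)))"
      by (intro nn_integral_mono ennreal_leI)
    show "csum (\<lambda>k. ennreal (norm (D r k))) \<le> csum (\<lambda>k. ennreal (norm (p' r k) * norm (q r k) + norm (p r k) * norm (q' r k))) * indicator {s..t} r"
      using le by (cases "r \<in> {s..t}") (simp_all add: D_def del: ennreal_plus)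
  qed
  finally have iDD: "integrable (lborel \<Otimes>\<^sub>M count_space UNIV) (case_prod D)"
    using L1 mD by (intro integrableI_bounded) auto
  have DE: "(LINT k|count_space UNIV. D r k) = indicator {s..t} r *\<^sub>R E r" for r
    by (simp add: D_def E_def)
  have "(LINT r|lborel. LINT k|count_space UNIV. D r k) = (LINT k|count_space UNIV. LINT r|lborel. D r k)"
    by (rule P.Fubini_integral[OF iDD, symmetric])
  also have "\<dots> = ip (p t) (q t) - ip (p s) (q s)"
    unfolding ID ip_def using fin by (intro Bochner_Integration.integral_diff integrable_ip)
  finally show "ip (p t) (q t) - ip (p s) (q s) = (LINT r:{s..t}|lborel. E r)"
    by (simp add: DE set_lebesgue_integral_def)
  show "set_integrable lborel {s..t} E"
    using P.integrable_fst[OF iDD] by (simp add: DE set_integrable_def)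
qed

section \<open>The Stokes solution operator\<close>

lemma bounded_linear_proj: "bounded_linear (proj L k)"
proof (rule bounded_linear_intro[where K=1])
  show "proj L k (r *\<^sub>R x) = r *\<^sub>R proj L k x" for r x
  proof -
    have sc: "r *\<^sub>R y = complex_of_real r *s y" for y :: "complex^3"
      by (simp add: vec_eq_iff scaleR_conv_of_real[where 'a=complex])
    show ?thesis unfolding sc by (simp add: proj_def cdot_scale_right vec_eq_iff algebra_simps)
  qed
qed (simp_all add: proj_add norm_proj_le)

lemma bil_measurable:
  assumes m: "\<And>k. (\<lambda>t. u t k) \<in> borel_measurable M" "\<And>k. (\<lambda>t. v t k) \<in> borel_measurable M"
    and fin: "\<And>t. hn (u t) < \<infinity>" "\<And>t. vn L (v t) < \<infinity>"
  shows "(\<lambda>t. bil L (u t) (v t) k) \<in> borel_measurable M"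
proof -
  have "(\<lambda>t. bterm L (u t) (v t) k j) \<in> borel_measurable M" for j
  proof -
    have "continuous_on UNIV (\<lambda>p. (\<i> * cdot (fst p) (rvec (kappa L (k - j)))) *s (snd p :: complex^3))"
      unfolding cdot_def vector_scalar_mult_def by (intro continuous_intros)
    from borel_measurable_continuous_Pair[OF m this] show ?thesis by (simp add: bterm_def)
  qed
  then have m1: "(\<lambda>t. LINT j|count_space UNIV. bterm L (u t) (v t) k j) \<in> borel_measurable M"
    by (rule integral_csum_measurable)
  have "continuous_on UNIV (proj L k)"
    by (intro linear_continuous_on bounded_linear_proj)
  from borel_measurable_continuous_on[OF this m1]
  show ?thesis by (cases "k = 0") (simp_all add: bil_bterm infsum_bterm[OF fin])
qed

lemma wt_csum:
  fixes F :: "'k::countable \<Rightarrow> real \<Rightarrow> ennreal"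
  assumes [measurable]: "\<And>k. F k \<in> borel_measurable borel"
  shows "wt b t (\<lambda>s. csum (\<lambda>k. F k s)) = csum (\<lambda>k. wt b t (F k))"
proof -
  have "wt b t (\<lambda>s. csum (\<lambda>k. F k s)) = (\<integral>\<^sup>+s. csum (\<lambda>k. ennreal (ker b t s) * F k s) \<partial>lborel)"
    unfolding wt_def by (simp add: nn_integral_cmult)
  also have "\<dots> = csum (\<lambda>k. wt b t (F k))"
    unfolding wt_def by (intro nn_integral_count_space_nn_integral) auto
  finally show ?thesis .
qed

definition fmeas :: "(real \<Rightarrow> fourier) \<Rightarrow> bool" where
  "fmeas u \<longleftrightarrow> (\<forall>k. (\<lambda>t. u t k) \<in> borel_measurable borel)"

lemma fmeasD: "fmeas u \<Longrightarrow> (\<lambda>t. u t k) \<in> borel_measurable borel"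
  by (simp add: fmeas_def)

lemma wn_fmeas: "fmeas u \<Longrightarrow> (\<lambda>t. wn c (u t)) \<in> borel_measurable borel"
  by (rule wn_measurable) (rule fmeasD)

lemma fmeas_diff: "fmeas u \<Longrightarrow> fmeas v \<Longrightarrow> fmeas (\<lambda>t k. u t k - v t k)"
  unfolding fmeas_def by (intro allI borel_measurable_diff) auto

lemma sqn_hn: "hn (f s) = csum (\<lambda>k. sqn (\<lambda>s. f s k) s)"
  by (simp add: hn_eq sqn_def)

lemma sqn_le_hn: "sqn (\<lambda>s. f s k) s \<le> hn (f s)"
proof -
  have "sqn (\<lambda>s. f s k) s = csum (\<lambda>j. sqn (\<lambda>s. f s j) s * indicator {k} j)"
    by (simp add: nn_integral_count_space_indicator[symmetric])
  also have "\<dots> \<le> hn (f s)" unfolding sqn_hn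
    by (intro nn_integral_mono) (simp add: indicator_def)
  finally show ?thesis .
qed

locale ns =
  fixes L nu :: real
  assumes L_pos: "L > 0" and nu_pos: "nu > 0"
begin

text \<open>Half the slowest decay rate \<open>nu * lambda1 L\<close>, which leaves the margin
  \<open>2 * a \<le> nu * ksq L k\<close> that \<open>wt_wt\<close> requires.\<close>

definition a :: real where "a = nu * lambda1 L / 2"

definition C :: real where "C = enn2real (CL L)"

lemma CL_eq: "CL L = ennreal C"
  using CL_finite[OF L_pos] by (simp add: C_def)

lemma C_nonneg: "0 \<le> C"
  by (simp add: C_def)

lemma a_pos: "0 < a"
  using nu_pos lambda1_pos[OF L_pos] by (simp add: a_def)

lemma two_a_le: "k \<noteq> 0 \<Longrightarrow> 2 * a \<le> nu * ksq L k"
  using ksq_ge[OF L_pos, of k] nu_pos by (simp add: a_def)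

lemma a_le: "k \<noteq> 0 \<Longrightarrow> a \<le> nu * ksq L k"
  using two_a_le[of k] a_pos by linarith

lemma nuksq_pos: "k \<noteq> 0 \<Longrightarrow> 0 < nu * ksq L k"
  using ksq_pos[OF L_pos, of k] nu_pos by simp

text \<open>The zero mode has decay rate 0 and would not be damped; it is set to 0, in accordance
  with mean-zero fields.\<close>

definition stokes :: "(real \<Rightarrow> fourier) \<Rightarrow> real \<Rightarrow> fourier" where
  "stokes f t k = (if k = 0 then 0 else heat (nu * ksq L k) (\<lambda>s. f s k) t)"

definition forcing :: "real \<Rightarrow> (real \<Rightarrow> fourier) \<Rightarrow> bool" where
  "forcing K f \<longleftrightarrow> fmeas f \<and> (\<forall>t. wt a t (\<lambda>s. hn (f s)) \<le> ennreal K)"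

text \<open>The closed ball of squared radius \<open>\<delta>\<close> in the trajectory space. The
  ratio \<open>2 / nu\<close> between its two bounds is the one that \<open>stokes\<close> produces,
  so that a single number records both.\<close>

definition ybound :: "real \<Rightarrow> (real \<Rightarrow> fourier) \<Rightarrow> bool" where
  "ybound \<delta> v \<longleftrightarrow> fmeas v \<and> (\<forall>t. v t 0 = 0) \<and> (\<forall>t. vn L (v t) \<le> ennreal \<delta>)
     \<and> (\<forall>t. wt a t (\<lambda>s. an L (v s)) \<le> ennreal (2 * \<delta> / nu))"

lemma forcing_mono: "forcing K f \<Longrightarrow> K \<le> K' \<Longrightarrow> forcing K' f"
  unfolding forcing_def by (meson ennreal_leI order_trans)

lemma ybound_mono: "ybound K f \<Longrightarrow> K \<le> K' \<Longrightarrow> ybound K' f"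
proof -
  assume f: "ybound K f" and "K \<le> K'"
  then have "2 * K / nu \<le> 2 * K' / nu" using nu_pos by (simp add: divide_right_mono)
  with \<open>K \<le> K'\<close> f show "ybound K' f"
    unfolding ybound_def by (meson ennreal_leI order_trans)
qed

lemma forcing_coeff:
  assumes "forcing K f" shows "(\<lambda>s. f s k) \<in> borel_measurable borel" "wt a t (sqn (\<lambda>s. f s k)) < \<infinity>"
proof -
  show "(\<lambda>s. f s k) \<in> borel_measurable borel" using assms by (simp add: forcing_def fmeas_def)
  have "wt a t (sqn (\<lambda>s. f s k)) \<le> wt a t (\<lambda>s. hn (f s))" by (intro wt_mono sqn_le_hn)
  also have "\<dots> \<le> ennreal K" using assms by (simp add: forcing_def)
  finally show "wt a t (sqn (\<lambda>s. f s k)) < \<infinity>" by (simp add: le_less_trans)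
qed

lemma stokes_0 [simp]: "stokes f t 0 = 0"
  by (simp add: stokes_def)

lemma stokes_measurable:
  assumes "forcing K f" shows "fmeas (stokes f)"
proof -
  have "(\<lambda>t. stokes f t k) \<in> borel_measurable borel" for k
    using heat_measurable[OF forcing_coeff(1)[OF assms] a_pos a_le[of k] forcing_coeff(2)[OF assms]]
    by (cases "k = 0") (auto simp: stokes_def[abs_def])
  then show ?thesis by (simp add: fmeas_def)
qed

lemma stokes_primitive:
  assumes f: "forcing K f" and k: "k \<noteq> 0"
  shows "is_primitive (\<lambda>t. stokes f t k) (\<lambda>t. f t k - (nu * ksq L k) *\<^sub>R stokes f t k)"
  using heat_primitive[OF forcing_coeff(1)[OF f] a_pos a_le[OF k] forcing_coeff(2)[OF f]] k
  by (simp add: stokes_def)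

text \<open>The gain \<open>1 / (nu * ksq L k)\<close> from \<open>heat_bound\<close> cancels the
  weight of the enstrophy, which gives a bound at every instant.\<close>

lemma stokes_vn:
  assumes f: "forcing K f" shows "vn L (stokes f t) \<le> ennreal (1 / nu) * wt a t (\<lambda>s. hn (f s))"
proof -
  have "ennreal (ksq L k * (norm (stokes f t k))\<^sup>2) \<le> ennreal (1 / nu) * wt a t (sqn (\<lambda>s. f s k))" for k
  proof (cases "k = 0")
    case False
    have "ennreal (ksq L k * (norm (stokes f t k))\<^sup>2) = ennreal (ksq L k) * sqn (heat (nu * ksq L k) (\<lambda>s. f s k)) t"
      using False by (simp add: stokes_def sqn_def ennreal_mult ennreal_power)
    also have "\<dots> \<le> ennreal (ksq L k) * (ennreal (1 / (nu * ksq L k)) * wt a t (sqn (\<lambda>s. f s k)))"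
      by (intro mult_left_mono heat_bound forcing_coeff(1)[OF f] a_pos a_le False) simp
    also have "\<dots> = ennreal (ksq L k * (1 / (nu * ksq L k))) * wt a t (sqn (\<lambda>s. f s k))"
      by (rule ennreal_assoc) simp
    also have "ksq L k * (1 / (nu * ksq L k)) = 1 / nu"
      using ksq_pos[OF L_pos False] by simp
    finally show ?thesis .
  qed simp
  then have "vn L (stokes f t) \<le> csum (\<lambda>k. ennreal (1 / nu) * wt a t (sqn (\<lambda>s. f s k)))"
    unfolding wn_def by (rule nn_integral_mono)
  also have "\<dots> = ennreal (1 / nu) * csum (\<lambda>k. wt a t (sqn (\<lambda>s. f s k)))"
    by (rule nn_integral_cmult) simp
  also have "csum (\<lambda>k. wt a t (sqn (\<lambda>s. f s k))) = wt a t (\<lambda>s. csum (\<lambda>k. sqn (\<lambda>s. f s k) s))"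
    by (rule wt_csum[symmetric]) (rule sqn_measurable[OF forcing_coeff(1)[OF f]])
  finally show ?thesis by (simp add: sqn_hn)
qed

text \<open>Maximal regularity. At a fixed time only one power of \<open>ksq\<close> is gained; the
  second comes from averaging in time. Therefore \<open>heat_bound\<close> is applied with the full
  rate \<open>nu * ksq L k\<close> in its weight, and \<open>wt_wt\<close> then yields another
  factor \<open>2 / (nu * ksq L k)\<close>.\<close>

lemma stokes_an:
  assumes f: "forcing K f"
  shows "wt a T (\<lambda>t. an L (stokes f t)) \<le> ennreal (2 / nu\<^sup>2) * wt a T (\<lambda>s. hn (f s))"
proof -
  have m: "(\<lambda>t. ennreal ((ksq L k)\<^sup>2 * (norm (stokes f t k))\<^sup>2)) \<in> borel_measurable borel" for k
    using fmeasD[OF stokes_measurable[OF f], of k] by measurable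
  have "wt a T (\<lambda>t. ennreal ((ksq L k)\<^sup>2 * (norm (stokes f t k))\<^sup>2)) \<le> ennreal (2 / nu\<^sup>2) * wt a T (sqn (\<lambda>s. f s k))" for k
  proof (cases "k = 0")
    case False
    let ?c = "nu * ksq L k" and ?F = "sqn (\<lambda>s. f s k)"
    have F [measurable]: "?F \<in> borel_measurable borel" by (rule sqn_measurable[OF forcing_coeff(1)[OF f]])
    have "ennreal ((ksq L k)\<^sup>2 * (norm (stokes f t k))\<^sup>2) \<le> ennreal (ksq L k / nu) * wt ?c t ?F" for t
    proof -
      have "ennreal ((ksq L k)\<^sup>2 * (norm (stokes f t k))\<^sup>2) = ennreal ((ksq L k)\<^sup>2) * sqn (heat ?c (\<lambda>s. f s k)) t"
        using False by (simp add: stokes_def sqn_def ennreal_mult ennreal_power)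
      also have "\<dots> \<le> ennreal ((ksq L k)\<^sup>2) * (ennreal (1 / ?c) * wt ?c t ?F)"
        by (rule mult_left_mono[OF heat_bound[OF forcing_coeff(1)[OF f] nuksq_pos[OF False] order_refl]]) simp
      also have "\<dots> = ennreal ((ksq L k)\<^sup>2 * (1 / ?c)) * wt ?c t ?F"
        by (rule ennreal_assoc) simp
      also have "(ksq L k)\<^sup>2 * (1 / ?c) = ksq L k / nu"
        using ksq_pos[OF L_pos False] by (simp add: power2_eq_square)
      finally show ?thesis .
    qed
    then have "wt a T (\<lambda>t. ennreal ((ksq L k)\<^sup>2 * (norm (stokes f t k))\<^sup>2)) \<le> wt a T (\<lambda>t. ennreal (ksq L k / nu) * wt ?c t ?F)"
      by (rule wt_mono)
    also have "\<dots> = ennreal (ksq L k / nu) * wt a T (\<lambda>t. wt ?c t ?F)"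
      by (rule wt_cmult) measurable
    also have "\<dots> \<le> ennreal (ksq L k / nu) * (ennreal (2 / ?c) * wt a T ?F)"
      by (intro mult_left_mono wt_wt F a_pos two_a_le False) simp
    also have "\<dots> = ennreal (ksq L k / nu * (2 / ?c)) * wt a T ?F"
      by (rule ennreal_assoc) (rule divide_nonneg_pos[OF ksq_nonneg nu_pos])
    also have "ksq L k / nu * (2 / ?c) = 2 / nu\<^sup>2"
      using ksq_pos[OF L_pos False] by (simp add: power2_eq_square)
    finally show ?thesis .
  qed (simp add: wt_def)
  then have "csum (\<lambda>k. wt a T (\<lambda>t. ennreal ((ksq L k)\<^sup>2 * (norm (stokes f t k))\<^sup>2))) \<le> csum (\<lambda>k. ennreal (2 / nu\<^sup>2) * wt a T (sqn (\<lambda>s. f s k)))"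
    by (rule nn_integral_mono)
  also have "\<dots> = ennreal (2 / nu\<^sup>2) * csum (\<lambda>k. wt a T (sqn (\<lambda>s. f s k)))"
    by (rule nn_integral_cmult) simp
  also have "csum (\<lambda>k. wt a T (sqn (\<lambda>s. f s k))) = wt a T (\<lambda>s. csum (\<lambda>k. sqn (\<lambda>s. f s k) s))"
    by (rule wt_csum[symmetric]) (rule sqn_measurable[OF forcing_coeff(1)[OF f]])
  also have "csum (\<lambda>k. wt a T (\<lambda>t. ennreal ((ksq L k)\<^sup>2 * (norm (stokes f t k))\<^sup>2))) = wt a T (\<lambda>t. an L (stokes f t))"
    unfolding wn_def by (rule wt_csum[symmetric]) (rule m)
  finally show ?thesis by (simp add: sqn_hn)
qed

lemma stokes_ybound:
  assumes f: "forcing K f" and K: "0 \<le> K"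
  shows "ybound (K / nu) (stokes f)"
proof -
  have h: "wt a t (\<lambda>s. hn (f s)) \<le> ennreal K" for t using f by (simp add: forcing_def)
  have "vn L (stokes f t) \<le> ennreal (K / nu)" for t
  proof -
    have "vn L (stokes f t) \<le> ennreal (1 / nu) * ennreal K"
      by (rule order_trans[OF stokes_vn[OF f]]) (intro mult_left_mono h, simp)
    then show ?thesis using nu_pos by (simp flip: ennreal_mult')
  qed
  moreover have "wt a t (\<lambda>s. an L (stokes f s)) \<le> ennreal (2 * (K / nu) / nu)" for t
  proof -
    have "wt a t (\<lambda>s. an L (stokes f s)) \<le> ennreal (2 / nu\<^sup>2) * ennreal K"
      by (rule order_trans[OF stokes_an[OF f]]) (intro mult_left_mono h, simp)
    then show ?thesis using nu_pos by (simp add: power2_eq_square flip: ennreal_mult')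
  qed
  ultimately show ?thesis using stokes_measurable[OF f] by (simp add: ybound_def)
qed

lemma stokes_diff:
  assumes "forcing K f" "forcing K' g"
  shows "stokes (\<lambda>t k. f t k - g t k) t k = stokes f t k - stokes g t k"
  using heat_diff[OF forcing_coeff(1)[OF assms(1)] forcing_coeff(1)[OF assms(2)] a_pos a_le[of k]
     forcing_coeff(2)[OF assms(1)] forcing_coeff(2)[OF assms(2)]]
  by (simp add: stokes_def)

lemma ybound_finite:
  assumes "ybound \<delta> v" shows "vn L (v t) < \<infinity>" "hn (v t) < \<infinity>" "v t 0 = 0"
proof -
  have "vn L (v t) \<le> ennreal \<delta>" "v t 0 = 0" using assms by (auto simp: ybound_def)
  then show "vn L (v t) < \<infinity>" "v t 0 = 0" by (auto intro: le_less_trans)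
  then show "hn (v t) < \<infinity>" by (intro hn_finite[OF L_pos])
qed

text \<open>In \<open>hn_bil\<close> the second field enters through its enstrophy, bounded at all
  times by \<open>\<eta>\<close>, and the first through |Au|^2, bounded in the weighted mean by
  \<open>2 * \<delta> / nu\<close>. Hence the asymmetric roles and the factor 2.\<close>

lemma forcing_bil:
  assumes u: "ybound \<delta> u" and v: "ybound \<eta> v" and "0 \<le> \<delta>" "0 \<le> \<eta>"
  shows "forcing (2 * C * \<delta> * \<eta> / nu) (\<lambda>t. bil L (u t) (v t))"
proof -
  have mu: "fmeas u" and mv: "fmeas v" using u v by (auto simp: ybound_def)
  have "fmeas (\<lambda>t. bil L (u t) (v t))"
    unfolding fmeas_def using bil_measurable[OF fmeasD[OF mu] fmeasD[OF mv] ybound_finite(2)[OF u] ybound_finite(1)[OF v]] by blast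
  moreover have "wt a t (\<lambda>s. hn (bil L (u s) (v s))) \<le> ennreal (2 * C * \<delta> * \<eta> / nu)" for t
  proof -
    have "hn (bil L (u s) (v s)) \<le> ennreal (C * \<eta>) * an L (u s)" for s
    proof -
      have "hn (bil L (u s) (v s)) \<le> CL L * an L (u s) * vn L (v s)"
        by (rule hn_bil[where u="u s", OF L_pos ybound_finite(3)[OF u]])
      also have "\<dots> \<le> CL L * an L (u s) * ennreal \<eta>"
        using v by (intro mult_left_mono) (auto simp: ybound_def)
      also have "\<dots> = ennreal C * (ennreal \<eta> * an L (u s))"
        by (simp add: CL_eq ac_simps)
      also have "\<dots> = ennreal (C * \<eta>) * an L (u s)"
        by (rule ennreal_assoc[OF C_nonneg])
      finally show ?thesis .
    qed
    then have "wt a t (\<lambda>s. hn (bil L (u s) (v s))) \<le> wt a t (\<lambda>s. ennreal (C * \<eta>) * an L (u s))"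
      by (rule wt_mono)
    also have "\<dots> = ennreal (C * \<eta>) * wt a t (\<lambda>s. an L (u s))"
      by (rule wt_cmult) (rule wn_fmeas[OF mu])
    also have "\<dots> \<le> ennreal (C * \<eta>) * ennreal (2 * \<delta> / nu)"
      using u by (intro mult_left_mono) (auto simp: ybound_def)
    also have "\<dots> = ennreal (2 * C * \<delta> * \<eta> / nu)"
      using assms(3,4) C_nonneg nu_pos by (simp add: ac_simps flip: ennreal_mult)
    finally show ?thesis .
  qed
  ultimately show ?thesis by (simp add: forcing_def)
qed

lemma forcing_add:
  assumes f: "forcing K f" and g: "forcing K' g" and "0 \<le> K" "0 \<le> K'"
    and m: "fmeas h" and n: "\<And>t k. norm (h t k) \<le> norm (f t k) + norm (g t k)"
  shows "forcing (2 * K + 2 * K') h"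
proof -
  have mf: "(\<lambda>t. hn (f t)) \<in> borel_measurable borel" and mg: "(\<lambda>t. hn (g t)) \<in> borel_measurable borel"
    using f g by (auto simp: forcing_def intro: wn_fmeas)
  have "wt a t (\<lambda>s. hn (h s)) \<le> ennreal (2 * K + 2 * K')" for t
  proof -
    have "wt a t (\<lambda>s. hn (h s)) \<le> wt a t (\<lambda>s. 2 * hn (f s) + 2 * hn (g s))"
      by (intro wt_mono wn_add n) simp
    also have "\<dots> = 2 * wt a t (\<lambda>s. hn (f s)) + 2 * wt a t (\<lambda>s. hn (g s))"
      using mf mg by (simp add: wt_add wt_cmult)
    also have "\<dots> \<le> 2 * ennreal K + 2 * ennreal K'"
      using f g by (intro add_mono mult_left_mono) (auto simp: forcing_def)
    also have "\<dots> = ennreal (2 * K + 2 * K')"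
      using assms(3,4) by (simp add: ennreal_plus ennreal_mult)
    finally show ?thesis .
  qed
  then show ?thesis using m by (simp add: forcing_def)
qed

text \<open>Reality and vanishing divergence are real-linear conditions on each coefficient, so they
  commute with the time integral, and the integral ignores the null set where they fail.\<close>

lemma stokes_fld:
  assumes f: "forcing K f" and fl: "AE s in lborel. fld L (f s)"
  shows "fld L (stokes f t)"
proof -
  note fc = forcing_coeff[OF f]
  have "stokes f t (- k) = vcnj (stokes f t k)" for k
  proof (cases "k = 0")
    case False
    have m: "(\<lambda>s. vcnj (f s k)) \<in> borel_measurable borel"
      by (rule borel_measurable_continuous_on[OF linear_continuous_on[OF bounded_linear_vcnj] fc(1)])
    have "heat (nu * ksq L k) (\<lambda>s. f s (- k)) t = heat (nu * ksq L k) (\<lambda>s. vcnj (f s k)) t"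
      by (rule heat_cong_AE[OF fc(1) m], rule eventually_mono[OF fl]) (simp add: fld_def)
    also have "\<dots> = vcnj (heat (nu * ksq L k) (\<lambda>s. f s k) t)"
      by (rule heat_bounded_linear[OF fc(1) a_pos a_le[OF False] fc(2) bounded_linear_vcnj])
    finally show ?thesis using False by (simp add: stokes_def)
  qed simp
  moreover have "cdot (rvec (kappa L k)) (stokes f t k) = 0" for k
  proof (cases "k = 0")
    case False
    let ?T = "\<lambda>w. cdot (rvec (kappa L k)) w"
    have bl: "bounded_linear ?T"
    proof (rule bounded_linear_intro[where K="norm (kappa L k)"])
      show "cdot (rvec (kappa L k)) (r *\<^sub>R x) = r *\<^sub>R cdot (rvec (kappa L k)) x" for r x
        by (simp add: cdot_def scaleR_sum_right)
    qed (use norm_cdot_le[of "rvec (kappa L k)"] in \<open>auto simp: cdot_add_right mult.commute\<close>)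
    have m: "(\<lambda>s. ?T (f s k)) \<in> borel_measurable borel"
      by (rule borel_measurable_continuous_on[OF linear_continuous_on[OF bl] fc(1)])
    have "?T (heat (nu * ksq L k) (\<lambda>s. f s k) t) = heat (nu * ksq L k) (\<lambda>s. ?T (f s k)) t"
      by (rule heat_bounded_linear[OF fc(1) a_pos a_le[OF False] fc(2) bl, symmetric])
    also have "\<dots> = heat (nu * ksq L k) (\<lambda>s. 0) t"
      by (rule heat_cong_AE[OF m], simp, rule eventually_mono[OF fl]) (simp add: fld_def)
    finally show ?thesis using False by (simp add: stokes_def heat_def)
  qed simp
  ultimately show ?thesis by (simp add: fld_def)
qed

lemma stokes_cong_AE:
  assumes "fmeas f" "fmeas g" "AE s in lborel. f s = g s"
  shows "stokes f t k = stokes g t k"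
proof -
  have "AE s in lborel. f s k = g s k" by (rule eventually_mono[OF assms(3)]) simp
  with heat_cong_AE[OF fmeasD[OF assms(1)] fmeasD[OF assms(2)], of k k]
  show ?thesis by (simp add: stokes_def)
qed

lemma stokes_shift: "stokes f (t + \<rho>) k = stokes (\<lambda>s. f (s + \<rho>)) t k"
  by (simp add: stokes_def heat_shift)

end

section \<open>Picard iteration for a small force\<close>

text \<open>Lower semicontinuity of the norms under coefficientwise convergence. It allows a
  construction by limits of single coefficients, with no completeness of a trajectory space to be
  proved.\<close>

lemma wn_Fatou:
  assumes lim: "\<And>k. (\<lambda>p. u p k) \<longlonglongrightarrow> U k"
  shows "wn c U \<le> liminf (\<lambda>p. wn c (u p))"
proof -
  have "(\<lambda>p. ennreal (c k * (norm (u p k))\<^sup>2)) \<longlonglongrightarrow> ennreal (c k * (norm (U k))\<^sup>2)" for k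
    by (intro tendsto_ennrealI tendsto_intros lim)
  then have "ennreal (c k * (norm (U k))\<^sup>2) = liminf (\<lambda>p. ennreal (c k * (norm (u p k))\<^sup>2))" for k
    using lim_imp_Liminf[OF sequentially_bot] by metis
  then have "wn c U = csum (\<lambda>k. liminf (\<lambda>p. ennreal (c k * (norm (u p k))\<^sup>2)))"
    by (simp add: wn_def)
  also have "\<dots> \<le> liminf (\<lambda>p. wn c (u p))"
    unfolding wn_def by (rule nn_integral_liminf) simp
  finally show ?thesis .
qed

lemma Liminf_le_const:
  fixes f :: "nat \<Rightarrow> ennreal"
  assumes "\<And>p. f p \<le> B" shows "liminf f \<le> B"
  using Liminf_mono[of f "\<lambda>_. B" sequentially] assms by (simp add: Liminf_const)

lemma (in ns) ybound_coeff:
  assumes v: "ybound \<delta> v" and "0 \<le> \<delta>"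
  shows "ksq L k * (norm (v t k))\<^sup>2 \<le> \<delta>"
proof -
  have "ennreal (ksq L k * (norm (v t k))\<^sup>2) = csum (\<lambda>j. ennreal (ksq L j * (norm (v t j))\<^sup>2) * indicator {k} j)"
    by (simp add: nn_integral_count_space_indicator[symmetric])
  also have "\<dots> \<le> vn L (v t)" unfolding wn_def
    by (intro nn_integral_mono) (simp add: indicator_def)
  also have "\<dots> \<le> ennreal \<delta>" using v by (simp add: ybound_def)
  finally show ?thesis using \<open>0 \<le> \<delta>\<close> by simp
qed

text \<open>Fatou's lemma is used twice for the weighted bound, over the modes and then over
  time.\<close>

lemma (in ns) ybound_lim:
  assumes y: "\<And>p. ybound \<delta> (u p)" and lim: "\<And>t k. (\<lambda>p. u p t k) \<longlonglongrightarrow> U t k"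
  shows "ybound \<delta> U"
proof -
  have m: "fmeas (u p)" for p using y by (simp add: ybound_def)
  have mU: "fmeas U"
    unfolding fmeas_def using borel_measurable_LIMSEQ_metric[OF fmeasD[OF m] lim] by blast
  have "U t 0 = 0" for t
    using LIMSEQ_unique[OF lim[of t 0]] y by (simp add: ybound_def)
  moreover have "vn L (U t) \<le> ennreal \<delta>" for t
    by (rule order_trans[OF wn_Fatou[OF lim] Liminf_le_const]) (use y in \<open>simp add: ybound_def\<close>)
  moreover have "wt a t (\<lambda>s. an L (U s)) \<le> ennreal (2 * \<delta> / nu)" for t
  proof -
    have "wt a t (\<lambda>s. an L (U s)) \<le> (\<integral>\<^sup>+s. liminf (\<lambda>p. ennreal (ker a t s) * an L (u p s)) \<partial>lborel)"
      unfolding wt_def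
    proof (rule nn_integral_mono)
      fix s
      have w: "ennreal (ker a t s) * an L x = wn (\<lambda>k. ker a t s * (ksq L k)\<^sup>2) x" for x
        by (rule wn_cmult[symmetric]) simp
      show "ennreal (ker a t s) * an L (U s) \<le> liminf (\<lambda>p. ennreal (ker a t s) * an L (u p s))"
        unfolding w by (rule wn_Fatou[OF lim])
    qed
    also have "\<dots> \<le> liminf (\<lambda>p. wt a t (\<lambda>s. an L (u p s)))"
      unfolding wt_def
    proof (rule nn_integral_liminf)
      show "(\<lambda>s. ennreal (ker a t s) * an L (u p s)) \<in> borel_measurable lborel" for p
        using wn_fmeas[OF m] by (intro borel_measurable_times_ennreal) (auto intro: measurable_compose[OF ker_measurable(2)])
    qed
    also have "\<dots> \<le> ennreal (2 * \<delta> / nu)"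
      by (rule Liminf_le_const) (use y in \<open>simp add: ybound_def\<close>)
    finally show ?thesis .
  qed
  ultimately show ?thesis using mU by (simp add: ybound_def)
qed

lemma fld_lim:
  assumes f: "\<And>p. fld L (u p)" and lim: "\<And>k. (\<lambda>p. u p k) \<longlonglongrightarrow> U k"
  shows "fld L U"
proof -
  have "U (- k) = vcnj (U k)" for k
  proof (rule LIMSEQ_unique[OF lim])
    show "(\<lambda>p. u p (- k)) \<longlonglongrightarrow> vcnj (U k)"
      using bounded_linear.tendsto[OF bounded_linear_vcnj lim[of k]] f by (simp add: fld_def)
  qed
  moreover have "cdot (rvec (kappa L k)) (U k) = 0" for k
  proof (rule LIMSEQ_unique)
    show "(\<lambda>p. cdot (rvec (kappa L k)) (u p k)) \<longlonglongrightarrow> cdot (rvec (kappa L k)) (U k)"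
      unfolding cdot_def by (intro tendsto_intros lim)
  qed (use f in \<open>simp add: fld_def\<close>)
  moreover have "U 0 = 0"
    using LIMSEQ_unique[OF lim[of 0]] f by (simp add: fld_def)
  ultimately show ?thesis by (simp add: fld_def)
qed

context ns
begin

text \<open>The constant 32 makes the contraction factor for squared norms 1/4; the summand 1 only
  spares a proof that \<^term>\<open>C\<close> is positive.\<close>

definition D :: real where "D = nu\<^sup>2 / (32 * (C + 1))"

lemma D_pos: "0 < D"
  using nu_pos C_nonneg by (simp add: D_def)

lemma CD_le: "C * D \<le> nu\<^sup>2 / 32"
proof -
  have "C * D = (nu\<^sup>2 / 32) * (C / (C + 1))" by (simp add: D_def)
  also have "\<dots> \<le> (nu\<^sup>2 / 32) * 1" using C_nonneg by (intro mult_left_mono) (auto simp: divide_le_eq)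
  finally show ?thesis by simp
qed

end

locale ns_small = ns +
  fixes g :: "real \<Rightarrow> fourier"
  assumes g_forcing: "forcing (nu * D / 4) g" and g_fld: "AE s in lborel. fld L (g s)"
begin

definition nl :: "(real \<Rightarrow> fourier) \<Rightarrow> real \<Rightarrow> fourier" where
  "nl v t k = g t k - bil L (v t) (v t) k"

definition Phi :: "(real \<Rightarrow> fourier) \<Rightarrow> real \<Rightarrow> fourier" where
  "Phi v = stokes (nl v)"

definition vseq :: "nat \<Rightarrow> real \<Rightarrow> fourier" where
  "vseq n = (Phi ^^ n) (\<lambda>t k. 0)"

definition sol :: "real \<Rightarrow> fourier" where
  "sol t k = lim (\<lambda>n. vseq n t k)"

text \<open>The budget is \<open>nu * D\<close>, since \<open>stokes\<close> divides by
  \<open>nu\<close>. Adding two forces doubles each: the force of size \<open>nu * D / 4\<close>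
  takes a half, and the quadratic term at most an eighth by \<open>CD_le\<close>.\<close>

lemma nl_forcing:
  assumes v: "ybound D v" shows "forcing (nu * D) (nl v)"
proof -
  have B: "forcing (2 * C * D * D / nu) (\<lambda>t. bil L (v t) (v t))"
    by (rule forcing_bil[OF v v]) (use D_pos in auto)
  have "fmeas (nl v)"
    unfolding nl_def[abs_def] using g_forcing B by (intro fmeas_diff) (auto simp: forcing_def)
  then have f: "forcing (2 * (nu * D / 4) + 2 * (2 * C * D * D / nu)) (nl v)"
    by (intro forcing_add[OF g_forcing B]) (use D_pos nu_pos C_nonneg in \<open>auto simp: nl_def norm_triangle_ineq4\<close>)
  have "2 * (2 * C * D * D / nu) = 4 * (C * D) * (D / nu)" by simp
  also have "\<dots> \<le> 4 * (nu\<^sup>2 / 32) * (D / nu)"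
    using CD_le D_pos nu_pos by (intro mult_right_mono mult_left_mono) auto
  also have "\<dots> = nu * D / 8" using nu_pos by (simp add: power2_eq_square)
  finally have "2 * (nu * D / 4) + 2 * (2 * C * D * D / nu) \<le> nu * D"
    using mult_pos_pos[OF nu_pos D_pos] by linarith
  with f show ?thesis by (rule forcing_mono)
qed

lemma Phi_ybound:
  assumes "ybound D v" shows "ybound D (Phi v)"
  using stokes_ybound[OF nl_forcing[OF assms]] nu_pos D_pos by (simp add: Phi_def)

lemma Phi_fld:
  assumes v: "ybound D v" and fl: "\<And>t. fld L (v t)" shows "fld L (Phi v t)"
  unfolding Phi_def
proof (rule stokes_fld[OF nl_forcing[OF v]])
  show "AE s in lborel. fld L (nl v s)"
    using g_fld
  proof eventually_elim
    case (elim s)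
    have "fld L (bil L (v s) (v s))"
      by (rule fld_bil[OF L_pos fl _ fl]) (use ybound_finite[OF v] in auto)
    with elim show ?case by (simp add: fld_def nl_def vcnj_diff cdot_diff_right)
  qed
qed

text \<open>B(v,v) - B(w,w) is split into B(v-w,v) and B(w,v-w), each of force size
  \<open>2 * C * D * \<delta> / nu\<close>. Doubled and added, they amount to
  \<open>8 * (C * D) * (\<delta> / nu)\<close>, at most \<open>nu * \<delta> / 4\<close>. Since
  \<open>\<delta>\<close> measures squares, distances are halved.\<close>

lemma Phi_contraction:
  assumes v: "ybound D v" and w: "ybound D w" and d: "ybound \<delta> (\<lambda>t k. v t k - w t k)" and \<delta>: "0 \<le> \<delta>"
  shows "ybound (\<delta> / 4) (\<lambda>t k. Phi v t k - Phi w t k)"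
proof -
  let ?d = "\<lambda>t k. v t k - w t k"
  have B1: "forcing (2 * C * \<delta> * D / nu) (\<lambda>t. bil L (?d t) (v t))"
    by (rule forcing_bil[OF d v \<delta>]) (use D_pos in auto)
  have B2: "forcing (2 * C * D * \<delta> / nu) (\<lambda>t. bil L (w t) (?d t))"
    by (rule forcing_bil[OF w d _ \<delta>]) (use D_pos in auto)
  have e: "norm (nl v t k - nl w t k) \<le> norm (bil L (?d t) (v t) k) + norm (bil L (w t) (?d t) k)" for t k
  proof -
    have "nl v t k - nl w t k = - (bil L (v t) (v t) k - bil L (w t) (w t) k)" by (simp add: nl_def)
    also have "\<dots> = - (bil L (?d t) (v t) k + bil L (w t) (?d t) k)"
      by (subst bil_diff_split) (use ybound_finite[OF v] ybound_finite[OF w] in auto)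
    finally show ?thesis by (simp only: norm_minus_cancel norm_triangle_ineq)
  qed
  have "fmeas (\<lambda>t k. nl v t k - nl w t k)"
    using nl_forcing[OF v] nl_forcing[OF w] by (intro fmeas_diff) (auto simp: forcing_def)
  then have f: "forcing (2 * (2 * C * \<delta> * D / nu) + 2 * (2 * C * D * \<delta> / nu)) (\<lambda>t k. nl v t k - nl w t k)"
    by (intro forcing_add[OF B1 B2] e) (use \<delta> D_pos nu_pos C_nonneg in auto)
  have "2 * (2 * C * \<delta> * D / nu) + 2 * (2 * C * D * \<delta> / nu) = 8 * (C * D) * (\<delta> / nu)" by simp
  also have "\<dots> \<le> 8 * (nu\<^sup>2 / 32) * (\<delta> / nu)"
    using CD_le \<delta> nu_pos by (intro mult_right_mono mult_left_mono) auto
  also have "\<dots> = nu * (\<delta> / 4)" using nu_pos by (simp add: power2_eq_square)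
  finally have "forcing (nu * (\<delta> / 4)) (\<lambda>t k. nl v t k - nl w t k)" by (rule forcing_mono[OF f])
  then have "ybound (\<delta> / 4) (stokes (\<lambda>t k. nl v t k - nl w t k))"
    using stokes_ybound[of "nu * (\<delta> / 4)"] nu_pos \<delta> by simp
  moreover have "stokes (\<lambda>t k. nl v t k - nl w t k) = (\<lambda>t k. Phi v t k - Phi w t k)"
    unfolding Phi_def using stokes_diff[OF nl_forcing[OF v] nl_forcing[OF w]] by blast
  ultimately show ?thesis by simp
qed

lemma vseq_0: "vseq 0 = (\<lambda>t k. 0)" and vseq_Suc: "vseq (Suc n) = Phi (vseq n)"
  by (simp_all add: vseq_def)

lemma vseq_ybound: "ybound D (vseq n)"
proof (induction n)
  case 0
  show ?case using D_pos by (simp add: vseq_0 ybound_def fmeas_def wn_def wt_def)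
qed (simp add: vseq_Suc Phi_ybound)

lemma vseq_fld: "fld L (vseq n t)"
proof (induction n arbitrary: t)
  case 0
  show ?case by (simp add: vseq_0 fld_def)
qed (simp add: vseq_Suc Phi_fld vseq_ybound)

text \<open>Applying the contraction \<open>n\<close> times to the pair \<open>vseq p\<close> and 0
  compares distant iterates at once, without summing a geometric series.\<close>

lemma vseq_diff: "ybound (D / 4 ^ n) (\<lambda>t k. vseq (n + p) t k - vseq n t k)"
proof (induction n)
  case 0
  show ?case using vseq_ybound[of p] by (simp add: vseq_0)
next
  case (Suc n)
  show ?case
    using Phi_contraction[OF vseq_ybound vseq_ybound Suc] D_pos by (simp add: vseq_Suc mult.commute)
qed

lemma ybound_geometric_norm:
  assumes y: "ybound (D / 4 ^ n) v" and k: "k \<noteq> 0"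
  shows "norm (v t k) \<le> sqrt (D / ksq L k) * (1/2) ^ n"
proof -
  have "ksq L k * (norm (v t k))\<^sup>2 \<le> D / 4 ^ n"
    by (rule ybound_coeff[OF y]) (use D_pos in simp)
  then have "(norm (v t k))\<^sup>2 \<le> (D / ksq L k) * (1/4) ^ n"
    using ksq_pos[OF L_pos k] by (simp add: field_simps power_one_over)
  then have "norm (v t k) \<le> sqrt ((D / ksq L k) * (1/4) ^ n)" by (rule real_le_rsqrt)
  also have "\<dots> = sqrt (D / ksq L k) * sqrt ((1/4) ^ n)" by (rule real_sqrt_mult)
  also have "sqrt ((1/4) ^ n) = (1/2 :: real) ^ n"
    by (simp add: real_sqrt_power real_sqrt_divide)
  finally show ?thesis .
qed

lemma geometric_limit:
  assumes y: "\<And>n. ybound (D / 4 ^ n) (\<lambda>t k. U t k - w n t k)"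
  shows "(\<lambda>n. w n t k) \<longlonglongrightarrow> U t k"
proof (cases "k = 0")
  case True
  have "w n t 0 = U t 0" for n using y[of n] by (auto simp: ybound_def)
  then show ?thesis by (simp add: True)
next
  case False
  have "(\<lambda>n. sqrt (D / ksq L k) * (1/2) ^ n) \<longlonglongrightarrow> sqrt (D / ksq L k) * 0"
    by (intro tendsto_mult tendsto_const LIMSEQ_power_zero) simp
  then have z: "(\<lambda>n. sqrt (D / ksq L k) * (1/2) ^ n) \<longlonglongrightarrow> 0" by simp
  have "norm (U t k - w n t k) \<le> sqrt (D / ksq L k) * (1/2) ^ n" for n
    by (rule ybound_geometric_norm[OF y False])
  then have "(\<lambda>n. U t k - w n t k) \<longlonglongrightarrow> 0"
    by (rule Lim_null_comparison[OF always_eventually[OF allI] z])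
  from tendsto_diff[OF tendsto_const[of "U t k"] this] show ?thesis by simp
qed

lemma vseq_convergent: "(\<lambda>n. vseq n t k) \<longlonglongrightarrow> sol t k"
proof -
  have "Cauchy (\<lambda>n. vseq n t k)"
  proof (cases "k = 0")
    case True
    have "vseq n t 0 = 0" for n using vseq_ybound by (simp add: ybound_def)
    then show ?thesis using LIMSEQ_imp_Cauchy[OF tendsto_const[of "0 :: complex^3"]] by (simp add: True)
  next
    case False
    have b: "norm (vseq (n + p) t k - vseq n t k) \<le> sqrt (D / ksq L k) * (1/2) ^ n" for n p
      using ybound_geometric_norm[OF vseq_diff False] .
    show ?thesis
    proof (rule CauchyI')
      fix e :: real assume "0 < e"
      have "(\<lambda>n. sqrt (D / ksq L k) * (1/2) ^ n) \<longlonglongrightarrow> sqrt (D / ksq L k) * 0"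
        by (intro tendsto_mult tendsto_const LIMSEQ_power_zero) simp
      then have "eventually (\<lambda>n. sqrt (D / ksq L k) * (1/2) ^ n < e) sequentially"
        using \<open>0 < e\<close> by (intro order_tendstoD(2)) auto
      then obtain N where N: "\<And>n. n \<ge> N \<Longrightarrow> sqrt (D / ksq L k) * (1/2) ^ n < e"
        by (auto simp: eventually_sequentially)
      have "norm (vseq m t k - vseq n t k) < e" if "N \<le> m" "m < n" for m n
        using le_less_trans[OF b[of m "n - m"] N[OF that(1)]] that by (simp add: norm_minus_commute)
      then show "\<exists>M. \<forall>m\<ge>M. \<forall>n>m. dist (vseq m t k) (vseq n t k) < e" unfolding dist_norm by blast
    qed
  qed
  then show ?thesis by (simp add: sol_def Cauchy_convergent_iff convergent_LIMSEQ_iff)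
qed

lemma sol_diff: "ybound (D / 4 ^ n) (\<lambda>t k. sol t k - vseq n t k)"
proof (rule ybound_lim)
  show "ybound (D / 4 ^ n) (\<lambda>t k. vseq (n + p) t k - vseq n t k)" for p by (rule vseq_diff)
  show "(\<lambda>p. vseq (n + p) t k - vseq n t k) \<longlonglongrightarrow> sol t k - vseq n t k" for t k
    using LIMSEQ_ignore_initial_segment[OF vseq_convergent[of t k], of n]
    by (intro tendsto_diff tendsto_const) (simp add: add.commute)
qed

lemma sol_ybound: "ybound D sol"
  using sol_diff[of 0] by (simp add: vseq_0)

lemma sol_fld: "fld L (sol t)"
  by (rule fld_lim[OF vseq_fld vseq_convergent])

text \<open>The iterates \<open>vseq (Suc n)\<close> converge to \<open>sol\<close> and, by the
  contraction applied to \<open>sol\<close> and \<open>vseq n\<close>, also to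
  \<open>Phi sol\<close>. Continuity of \<open>Phi\<close> for coefficientwise convergence is not at
  issue.\<close>

lemma sol_fixpoint: "Phi sol t k = sol t k"
proof -
  have "ybound (D / 4 ^ n) (\<lambda>t k. Phi sol t k - vseq (Suc n) t k)" for n
  proof -
    have "ybound (D / 4 ^ n / 4) (\<lambda>t k. Phi sol t k - Phi (vseq n) t k)"
      by (rule Phi_contraction[OF sol_ybound vseq_ybound sol_diff]) (use D_pos in simp)
    then show ?thesis unfolding vseq_Suc
      by (rule ybound_mono) (use D_pos in \<open>simp add: field_simps\<close>)
  qed
  then have "(\<lambda>n. vseq (Suc n) t k) \<longlonglongrightarrow> Phi sol t k" by (rule geometric_limit)
  moreover have "(\<lambda>n. vseq (Suc n) t k) \<longlonglongrightarrow> sol t k"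
    using vseq_convergent by (rule LIMSEQ_Suc)
  ultimately show ?thesis by (rule LIMSEQ_unique)
qed

text \<open>The density of \<open>sol\<close> in time. The force is mean-free only for almost every
  time, so the zero mode is put to 0 by hand, which makes the primitive identity exact for every
  mode.\<close>

definition rhs :: "real \<Rightarrow> fourier" where
  "rhs t k = (if k = 0 then 0 else g t k - (nu * ksq L k) *\<^sub>R sol t k - bil L (sol t) (sol t) k)"

lemma sol_primitive: "is_primitive (\<lambda>t. sol t k) (\<lambda>t. rhs t k)"
proof (cases "k = 0")
  case True
  have "sol t 0 = 0" for t using sol_fld[of t] by (simp add: fld_def)
  then show ?thesis
    by (simp add: True rhs_def is_primitive_def set_integrable_def set_lebesgue_integral_def)
next
  case False
  have s: "stokes (nl sol) t k = sol t k" for t using sol_fixpoint[of t k] by (simp add: Phi_def)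
  show ?thesis
    by (rule is_primitive_cong[OF stokes_primitive[OF nl_forcing[OF sol_ybound] False]])
       (simp_all add: s nl_def rhs_def False)
qed

lemma fmeas_shift: "fmeas f \<Longrightarrow> fmeas (\<lambda>s. f (s + \<rho>))"
proof -
  assume f: "fmeas f"
  have "(\<lambda>s. f (s + \<rho>) k) \<in> borel_measurable borel" for k
    using measurable_compose[OF _ fmeasD[OF f, of k], of "\<lambda>s. s + \<rho>" borel] by simp
  then show ?thesis by (simp add: fmeas_def)
qed

text \<open>The force is periodic only almost everywhere, but \<open>stokes\<close> does not see
  null sets, so each iterate is periodic at every time.\<close>

lemma vseq_periodic:
  assumes "AE s in lborel. g (s + \<rho>) = g s"
  shows "vseq n (t + \<rho>) = vseq n t"
proof (induction n arbitrary: t)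
  case 0
  show ?case by (simp add: vseq_0)
next
  case (Suc n)
  have m: "fmeas (nl (vseq n))" using nl_forcing[OF vseq_ybound] by (simp add: forcing_def)
  have "vseq (Suc n) (t + \<rho>) k = vseq (Suc n) t k" for k
  proof -
    have "vseq (Suc n) (t + \<rho>) k = stokes (\<lambda>s. nl (vseq n) (s + \<rho>)) t k"
      by (simp add: vseq_Suc Phi_def stokes_shift)
    also have "\<dots> = stokes (nl (vseq n)) t k"
    proof (rule stokes_cong_AE[OF fmeas_shift[OF m] m])
      show "AE s in lborel. nl (vseq n) (s + \<rho>) = nl (vseq n) s"
        using assms by eventually_elim (auto simp: nl_def Suc fun_eq_iff)
    qed
    finally show ?thesis by (simp add: vseq_Suc Phi_def)
  qed
  then show ?case by blast
qed

lemma sol_periodic: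
  "AE s in lborel. g (s + \<rho>) = g s \<Longrightarrow> sol (t + \<rho>) = sol t"
  by (simp add: fun_eq_iff sol_def vseq_periodic)

end

section \<open>Pairings with the right-hand side\<close>

lemma ennreal_power2_le_imp_le:
  fixes x y :: ennreal
  assumes "x\<^sup>2 \<le> y\<^sup>2" shows "x \<le> y"
proof (cases "x = top")
  case True
  then have "y * y = top" using assms by (simp add: power2_eq_square top_unique ennreal_top_mult)
  then show ?thesis by (auto simp: ennreal_mult_eq_top_iff)
next
  case False
  show ?thesis
  proof (cases "y = top")
    case False
    then obtain p q where pq: "x = ennreal p" "0 \<le> p" "y = ennreal q" "0 \<le> q"
      using \<open>x \<noteq> top\<close> by (cases x; cases y) auto
    then have "p\<^sup>2 \<le> q\<^sup>2" using assms by (simp add: ennreal_power)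
    then have "p \<le> q" using pq(4) by (rule power2_le_imp_le)
    then show ?thesis unfolding pq(1,3) by (rule ennreal_leI)
  qed simp
qed

lemma csum_norm_mult_le: "csum (\<lambda>k. ennreal (norm (u k) * norm (v k))) \<le> hn u + hn v"
proof -
  have "ennreal (norm (u k) * norm (v k)) \<le> ennreal (1 * (norm (u k))\<^sup>2) + ennreal (1 * (norm (v k))\<^sup>2)" for k
  proof -
    have "norm (u k) * norm (v k) \<le> (norm (u k))\<^sup>2 + (norm (v k))\<^sup>2"
      using zero_le_power2[of "norm (u k) - norm (v k)"] zero_le_power2[of "norm (u k)"] zero_le_power2[of "norm (v k)"]
      unfolding power2_diff by linarith
    from ennreal_leI[OF this] show ?thesis by simp
  qed
  then have "csum (\<lambda>k. ennreal (norm (u k) * norm (v k))) \<le> csum (\<lambda>k. ennreal (1 * (norm (u k))\<^sup>2) + ennreal (1 * (norm (v k))\<^sup>2))"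
    by (rule nn_integral_mono)
  then show ?thesis unfolding wn_def by (subst (asm) nn_integral_add) simp_all
qed

definition lap :: "real \<Rightarrow> fourier \<Rightarrow> fourier" where
  "lap L u k = ksq L k *\<^sub>R u k"

text \<open>The weight \<open>ksq\<close> is shared evenly: one square root goes to each
  field.\<close>

lemma csum_lap_le: "csum (\<lambda>k. ennreal (norm (lap L u k) * norm (v k))) \<le> vn L u + vn L v"
proof -
  let ?s = "\<lambda>u k. sqrt (ksq L k) *\<^sub>R u k"
  have e: "norm (lap L u k) * norm (v k) = norm (?s u k) * norm (?s v k)" for k
    using real_sqrt_mult_self[of "ksq L k"] by (simp add: lap_def abs_of_nonneg)
  have h: "vn L u = hn (?s u)" for u by (simp add: wn_def power_mult_distrib)
  show ?thesis unfolding e h by (rule csum_norm_mult_le)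
qed

text \<open>Absolute convergence of the pairing, without membership of both fields in H: it also
  covers the duality between V' and V, where \<open>lap L u\<close> and \<open>bil L u u\<close>
  live.\<close>

definition ips :: "fourier \<Rightarrow> fourier \<Rightarrow> bool" where
  "ips u v \<longleftrightarrow> csum (\<lambda>k. ennreal (norm (u k) * norm (v k))) < \<infinity>"

lemma ips_integrable: "ips u v \<Longrightarrow> integrable (count_space UNIV) (\<lambda>k. u k \<bullet> v k)"
  unfolding ips_def by (rule integrable_inner_csum)

lemma ips_hn: "hn u < \<infinity> \<Longrightarrow> hn v < \<infinity> \<Longrightarrow> ips u v"
  unfolding ips_def by (rule csum_norm_mult_finite)

lemma ips_lap: "vn L u < \<infinity> \<Longrightarrow> vn L v < \<infinity> \<Longrightarrow> ips (lap L u) v"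
  unfolding ips_def by (rule le_less_trans[OF csum_lap_le]) simp

lemma ip_commute: "ip u v = ip v u"
  by (simp add: ip_def inner_commute)

lemma ip_lap_commute: "ip (lap L u) v = ip (lap L v) u"
  by (simp add: ip_def lap_def inner_commute)

lemma ip_diff_left: "ips u w \<Longrightarrow> ips v w \<Longrightarrow> ip (\<lambda>k. u k - v k) w = ip u w - ip v w"
  unfolding ip_def by (subst Bochner_Integration.integral_diff[symmetric]) (auto intro: ips_integrable simp: inner_diff_left)

lemma ip_diff_right: "ips w u \<Longrightarrow> ips w v \<Longrightarrow> ip w (\<lambda>k. u k - v k) = ip w u - ip w v"
  unfolding ip_def by (subst Bochner_Integration.integral_diff[symmetric]) (auto intro: ips_integrable simp: inner_diff_right)

lemma ip_self: "ip u u = enn2real (hn u)"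
  unfolding ip_def wn_def by (subst integral_eq_nn_integral) (auto simp: power2_norm_eq_inner)

lemma ip_lap_self: "ip (lap L u) u = enn2real (vn L u)"
  unfolding ip_def wn_def lap_def by (subst integral_eq_nn_integral) (auto simp: power2_norm_eq_inner)

lemma ip_le_csum: "ennreal \<bar>ip u v\<bar> \<le> csum (\<lambda>k. ennreal (norm (u k) * norm (v k)))"
proof (cases "ips u v")
  case True
  have "ennreal \<bar>ip u v\<bar> \<le> csum (\<lambda>k. ennreal (norm (u k \<bullet> v k)))"
    unfolding ip_def using integral_norm_bound_ennreal[OF ips_integrable[OF True]] by simp
  also have "\<dots> \<le> csum (\<lambda>k. ennreal (norm (u k) * norm (v k)))"
    by (intro nn_integral_mono ennreal_leI) (simp add: Cauchy_Schwarz_ineq2)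
  finally show ?thesis .
qed (simp add: ips_def not_less top_unique)

lemma ip_measurable:
  assumes "\<And>k. (\<lambda>t. u t k) \<in> borel_measurable M" "\<And>k. (\<lambda>t. v t k) \<in> borel_measurable M"
  shows "(\<lambda>t. ip (u t) (v t)) \<in> borel_measurable M"
  unfolding ip_def using assms by (intro integral_csum_measurable borel_measurable_inner) auto

lemma bil_diff_left:
  assumes "hn u < \<infinity>" "hn u' < \<infinity>" "vn L v < \<infinity>"
  shows "bil L (\<lambda>k. u k - u' k) v k = bil L u v k - bil L u' v k"
proof -
  let ?d = "\<lambda>k. u k - u' k"
  have d: "hn ?d < \<infinity>"
    using wn_finite_add[OF assms(1,2), of ?d] by (simp add: norm_triangle_ineq4)
  have "bterm L ?d v k j = bterm L u v k j - bterm L u' v k j" for j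
    by (simp add: bterm_def cdot_diff_left vec_eq_iff algebra_simps)
  then have "(LINT j|count_space UNIV. bterm L ?d v k j) =
     (LINT j|count_space UNIV. bterm L u v k j) - (LINT j|count_space UNIV. bterm L u' v k j)"
    using assms by (simp add: integrable_bterm)
  then show ?thesis using assms d by (simp add: bil_bterm infsum_bterm proj_diff)
qed

lemma fld_diff: "fld L u \<Longrightarrow> fld L v \<Longrightarrow> fld L (\<lambda>k. u k - v k)"
  by (simp add: fld_def vcnj_diff cdot_diff_right)

lemma fld_0: "fld L u \<Longrightarrow> u 0 = 0"
  by (simp add: fld_def)

context ns
begin

lemma ips_bil:
  assumes "fld L u" "vn L u < \<infinity>" "vn L v < \<infinity>" "fld L w" "vn L w < \<infinity>"
  shows "ips (bil L u v) w"
proof -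
  have "CL L * vn L u * vn L v * vn L w < \<infinity>"
    using assms CL_finite[OF L_pos] by (simp add: ennreal_mult_less_top)
  from le_less_trans[OF tri[where u=u and c=w and v=v, OF L_pos fld_0[OF assms(1)] fld_0[OF assms(4)]] this] show ?thesis
    by (auto simp: ips_def power2_eq_square ennreal_mult_less_top)
qed

lemma csum_bil_le:
  assumes "u 0 = 0" "w 0 = 0" "CL L * vn L u * vn L v * vn L w \<le> (ennreal c * y)\<^sup>2"
  shows "csum (\<lambda>k. ennreal (norm (bil L u v k) * norm (w k))) \<le> ennreal c * y"
  by (rule ennreal_power2_le_imp_le) (rule order_trans[OF tri[where u=u and c=w and v=v, OF L_pos assms(1,2)] assms(3)])

text \<open>Write b(x,y,z) for the pairing of B(x,y) with z. Antisymmetry turns b(u,u,v) into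
  -b(u,v,u), so the sum is -b(w,v,u); subtracting b(w,v,v) = 0 replaces the last \<open>u\<close> by
  \<open>w\<close>.\<close>

lemma b3_cross:
  assumes u: "fld L u" "vn L u < \<infinity>" and v: "fld L v" "vn L v < \<infinity>"
  defines "w \<equiv> \<lambda>k. u k - v k"
  shows "ip (bil L u u) v + ip (bil L v v) u = - ip (bil L w v) w"
proof -
  have hu: "hn u < \<infinity>" and hv: "hn v < \<infinity>"
    using hn_finite[where u=u, OF L_pos fld_0[OF u(1)] u(2)] hn_finite[where u=v, OF L_pos fld_0[OF v(1)] v(2)] by auto
  have w: "fld L w" "vn L w < \<infinity>"
    using fld_diff[OF u(1) v(1)] wn_finite_add[OF u(2) v(2), of w] by (simp_all add: w_def norm_triangle_ineq4)
  have 1: "ip (bil L u u) v = - ip (bil L u v) u"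
    by (rule b3_antisym[OF L_pos u u v])
  \<comment> \<open>A number equal to its own negative: this is b(w,v,v) = 0.\<close>
  have 2: "ip (bil L w v) v = - ip (bil L w v) v"
    by (rule b3_antisym[OF L_pos w v v])
  have "bil L w v = (\<lambda>k. bil L u v k - bil L v v k)"
    unfolding w_def using bil_diff_left[OF hu hv v(2)] by blast
  then have 3: "ip (bil L w v) u = ip (bil L u v) u - ip (bil L v v) u"
    using ip_diff_left[OF ips_bil[OF u v(2) u] ips_bil[OF v v(2) u]] by simp
  have 4: "ip (bil L w v) w = ip (bil L w v) u - ip (bil L w v) v"
    unfolding w_def[of ] using ip_diff_right[OF ips_bil[OF w v(2) u] ips_bil[OF w v(2) v]] by (simp add: w_def)
  show ?thesis using 1 2 3 4 by linarith
qed

text \<open>By \<open>tri\<close> the square of the left side is at most C D ||w||^4, and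
  \<open>C * D \<le> nu\<^sup>2 / 32\<close> is below \<open>(nu / 2)\<^sup>2\<close>. Twice this
  term thus uses up only half of the dissipation 2 nu ||w||^2.\<close>

lemma b3_small:
  assumes v: "vn L v \<le> ennreal D" and w: "fld L w" "vn L w < \<infinity>"
  shows "\<bar>ip (bil L w v) w\<bar> \<le> nu / 2 * enn2real (vn L w)"
proof -
  obtain x where x: "vn L w = ennreal x" "0 \<le> x" using w(2) by (cases "vn L w") auto
  have "CL L * vn L w * vn L v * vn L w \<le> CL L * vn L w * ennreal D * vn L w"
    by (intro mult_right_mono mult_left_mono v) auto
  also have "\<dots> = ennreal ((C * D) * x\<^sup>2)"
    using x D_pos C_nonneg by (simp add: CL_eq power2_eq_square ac_simps flip: ennreal_mult)
  also have "\<dots> \<le> ennreal ((nu / 2)\<^sup>2 * x\<^sup>2)"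
  proof (intro ennreal_leI mult_right_mono)
    have "C * D \<le> nu\<^sup>2 / 32" by (rule CD_le)
    also have "\<dots> \<le> (nu / 2)\<^sup>2" by (simp add: power_divide)
    finally show "C * D \<le> (nu / 2)\<^sup>2" .
  qed simp
  also have "\<dots> = (ennreal (nu / 2) * vn L w)\<^sup>2"
    using x nu_pos by (simp add: ennreal_power power_mult_distrib power_divide flip: ennreal_mult)
  finally have "csum (\<lambda>k. ennreal (norm (bil L w v k) * norm (w k))) \<le> ennreal (nu / 2) * vn L w"
    by (rule csum_bil_le[where u=w and v=v and w=w, OF fld_0[OF w(1)] fld_0[OF w(1)]])
  with ip_le_csum have "ennreal \<bar>ip (bil L w v) w\<bar> \<le> ennreal (nu / 2) * vn L w" by (rule order_trans)
  then show ?thesis using x nu_pos by (simp flip: ennreal_mult)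
qed

text \<open>Because the enstrophy of \<open>v\<close> is bounded by \<open>D\<close>, the cubic
  expressions are dominated linearly by the enstrophies, and these are integrable in time. This is
  where the regularity of the strong solution makes the pairing with a weak one admissible.\<close>

lemma csum_bil_sol:
  assumes u: "u 0 = 0" and v: "v 0 = 0" "vn L v \<le> ennreal D"
  shows "csum (\<lambda>k. ennreal (norm (bil L u u k) * norm (v k))) \<le> ennreal nu * (vn L u + vn L v)"
    and "csum (\<lambda>k. ennreal (norm (bil L v v k) * norm (u k))) \<le> ennreal nu * (vn L u + vn L v)"
proof -
  have cd: "CL L * ennreal D \<le> (ennreal nu)\<^sup>2"
  proof -
    have "C * D \<le> nu\<^sup>2" using CD_le zero_le_power2[of nu] by linarith
    then show ?thesis using nu_pos D_pos C_nonneg by (simp add: CL_eq ennreal_power flip: ennreal_mult)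
  qed
  have "CL L * vn L u * vn L u * vn L v = (CL L * vn L v) * (vn L u * vn L u)" by (simp add: ac_simps)
  also have "\<dots> \<le> (CL L * ennreal D) * ((vn L u + vn L v) * (vn L u + vn L v))"
    by (intro mult_mono v) auto
  also have "\<dots> \<le> (ennreal nu)\<^sup>2 * ((vn L u + vn L v) * (vn L u + vn L v))"
    by (intro mult_right_mono cd) auto
  also have "\<dots> = (ennreal nu * (vn L u + vn L v))\<^sup>2" by (simp add: power2_eq_square ac_simps)
  finally show "csum (\<lambda>k. ennreal (norm (bil L u u k) * norm (v k))) \<le> ennreal nu * (vn L u + vn L v)"
    by (rule csum_bil_le[where u=u and v=u and w=v, OF u v(1)])
  have "CL L * vn L v * vn L v * vn L u = (CL L * vn L v) * (vn L v * vn L u)" by (simp add: ac_simps)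
  also have "\<dots> \<le> (CL L * ennreal D) * ((vn L u + vn L v) * (vn L u + vn L v))"
    by (intro mult_mono v) auto
  also have "\<dots> \<le> (ennreal nu)\<^sup>2 * ((vn L u + vn L v) * (vn L u + vn L v))"
    by (intro mult_right_mono cd) auto
  also have "\<dots> = (ennreal nu * (vn L u + vn L v))\<^sup>2" by (simp add: power2_eq_square ac_simps)
  finally show "csum (\<lambda>k. ennreal (norm (bil L v v k) * norm (u k))) \<le> ennreal nu * (vn L u + vn L v)"
    by (rule csum_bil_le[where u=v and v=v and w=u, OF v(1) u])
qed

end

section \<open>Local integrability\<close>

definition locint :: "(real \<Rightarrow> ennreal) \<Rightarrow> bool" where
  "locint F \<longleftrightarrow> F \<in> borel_measurable borel \<and> (\<forall>s t. (\<integral>\<^sup>+r. F r * indicator {s..t} r \<partial>lborel) < \<infinity>)"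

lemma locint_add:
  assumes "locint F" "locint G" shows "locint (\<lambda>r. F r + G r)"
proof -
  have [measurable]: "F \<in> borel_measurable borel" "G \<in> borel_measurable borel"
    using assms by (auto simp: locint_def)
  show ?thesis using assms by (auto simp: locint_def distrib_right nn_integral_add)
qed

lemma locint_cmult:
  assumes "locint F" "c < \<infinity>" shows "locint (\<lambda>r. c * F r)"
proof -
  have [measurable]: "F \<in> borel_measurable borel" using assms by (auto simp: locint_def)
  show ?thesis using assms by (auto simp: locint_def mult.assoc nn_integral_cmult ennreal_mult_less_top)
qed

lemma locint_const: "c < \<infinity> \<Longrightarrow> locint (\<lambda>r. c)"
  by (auto simp: locint_def nn_integral_cmult ennreal_mult_less_top emeasure_lborel_Icc_eq)

lemma locint_mono:
  assumes "locint G" "F \<in> borel_measurable borel" "AE r in lborel. F r \<le> G r"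
  shows "locint F"
proof -
  have "(\<integral>\<^sup>+r. F r * indicator {s..t} r \<partial>lborel) < \<infinity>" for s t
  proof (rule le_less_trans)
    show "(\<integral>\<^sup>+r. F r * indicator {s..t} r \<partial>lborel) \<le> (\<integral>\<^sup>+r. G r * indicator {s..t} r \<partial>lborel)"
      by (rule nn_integral_mono_AE) (use assms(3) in \<open>auto elim!: eventually_mono intro!: mult_right_mono\<close>)
    show "(\<integral>\<^sup>+r. G r * indicator {s..t} r \<partial>lborel) < \<infinity>" using assms(1) by (simp add: locint_def)
  qed
  then show ?thesis using assms(2) by (simp add: locint_def)
qed

lemma locint_AE_finite:
  assumes "locint F" shows "AE r in lborel. F r < \<infinity>"
proof -
  have "AE r in lborel. \<forall>n::nat. F r * indicator {- real n..real n} r \<noteq> \<infinity>"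
    unfolding AE_all_countable
  proof
    fix n :: nat
    have [measurable]: "F \<in> borel_measurable borel" using assms by (simp add: locint_def)
    show "AE r in lborel. F r * indicator {- real n..real n} r \<noteq> \<infinity>"
    proof (rule nn_integral_PInf_AE)
      have "(\<integral>\<^sup>+r. F r * indicator {- real n..real n} r \<partial>lborel) < \<infinity>"
        using assms unfolding locint_def by blast
      then show "(\<integral>\<^sup>+r. F r * indicator {- real n..real n} r \<partial>lborel) \<noteq> \<infinity>" by simp
    qed measurable
  qed
  then show ?thesis
  proof eventually_elim
    case (elim r)
    obtain n :: nat where "\<bar>r\<bar> \<le> real n" using real_arch_simple by blast
    then have "r \<in> {- real n..real n}" by auto
    with spec[OF elim, of n] show ?case by (simp add: less_top)
  qed
qed

lemma locint_set_integrable: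
  fixes f :: "real \<Rightarrow> real"
  assumes "locint F" "f \<in> borel_measurable borel" "AE r in lborel. ennreal \<bar>f r\<bar> \<le> F r"
  shows "set_integrable lborel {s..t} f"
  unfolding set_integrable_def
proof (rule integrableI_bounded)
  show "(\<lambda>r. indicator {s..t} r *\<^sub>R f r) \<in> borel_measurable lborel"
    using assms(2) by measurable
  have "(\<integral>\<^sup>+r. ennreal (norm (indicator {s..t} r *\<^sub>R f r)) \<partial>lborel) \<le> (\<integral>\<^sup>+r. F r * indicator {s..t} r \<partial>lborel)"
    by (rule nn_integral_mono_AE) (use assms(3) in \<open>auto elim!: eventually_mono simp: indicator_def\<close>)
  also have "\<dots> < \<infinity>" using assms(1) by (simp add: locint_def)
  finally show "(\<integral>\<^sup>+r. ennreal (norm (indicator {s..t} r *\<^sub>R f r)) \<partial>lborel) < \<infinity>" .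
qed

text \<open>On \<open>{s..t}\<close> the weight is at least
  \<open>exp (- (b * (t - s)))\<close>.\<close>

lemma locint_wt:
  assumes F: "F \<in> borel_measurable borel" and b: "0 < b" and fin: "\<And>t. wt b t F < \<infinity>"
  shows "locint F"
proof -
  have "(\<integral>\<^sup>+r. F r * indicator {s..t} r \<partial>lborel) < \<infinity>" for s t
  proof (rule le_less_trans)
    have [measurable]: "F \<in> borel_measurable borel" by fact
    have "(\<integral>\<^sup>+r. F r * indicator {s..t} r \<partial>lborel) \<le> (\<integral>\<^sup>+r. ennreal (exp (b * (t - s))) * (ennreal (ker b t r) * F r) \<partial>lborel)"
    proof (rule nn_integral_mono)
      fix r
      show "F r * indicator {s..t} r \<le> ennreal (exp (b * (t - s))) * (ennreal (ker b t r) * F r)"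
      proof (cases "r \<in> {s..t}")
        case True
        then have "1 \<le> exp (b * (t - s)) * ker b t r"
          using b by (simp add: ker_def exp_add[symmetric] mult_left_mono flip: right_diff_distrib)
        then have "ennreal 1 * F r \<le> ennreal (exp (b * (t - s)) * ker b t r) * F r"
          by (intro mult_right_mono ennreal_leI) auto
        then show ?thesis using True by (simp add: ennreal_mult' mult.assoc)
      qed simp
    qed
    also have "\<dots> = ennreal (exp (b * (t - s))) * wt b t F"
      unfolding wt_def by (rule nn_integral_cmult) measurable
    finally show "(\<integral>\<^sup>+r. F r * indicator {s..t} r \<partial>lborel) \<le> ennreal (exp (b * (t - s))) * wt b t F" .
    show "ennreal (exp (b * (t - s))) * wt b t F < \<infinity>" using fin by (simp add: ennreal_mult_less_top)
  qed
  then show ?thesis using F by (simp add: locint_def)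
qed

section \<open>Trajectories and the cross energy identity\<close>

context ns
begin

text \<open>What the constructed solution and an arbitrary Leray-Hopf solution share: the equation
  and the natural regularity, but no energy inequality. The third argument names the time
  derivative.\<close>

definition traj :: "(real \<Rightarrow> fourier) \<Rightarrow> (real \<Rightarrow> fourier) \<Rightarrow> (real \<Rightarrow> fourier) \<Rightarrow> bool" where
  "traj g u u' \<longleftrightarrow> (\<forall>t. fld L (u t) \<and> hn (u t) < \<infinity>) \<and> (\<forall>k. is_primitive (\<lambda>t. u t k) (\<lambda>t. u' t k))
     \<and> locint (\<lambda>t. vn L (u t))
     \<and> (AE r in lborel. \<forall>k. u' r k = g r k - nu *\<^sub>R lap L (u r) k - bil L (u r) (u r) k)"

lemma traj_fmeas: "traj g u u' \<Longrightarrow> fmeas u"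
  unfolding fmeas_def traj_def using is_primitive_measurable by auto

lemma locint_hn:
  assumes "locint (\<lambda>t. vn L (u t))" "fmeas u" "\<And>t. u t 0 = 0"
  shows "locint (\<lambda>t. hn (u t))"
proof (rule locint_mono)
  let ?l = "lambda1 L"
  show "locint (\<lambda>t. ennreal (1 / ?l) * vn L (u t))" by (rule locint_cmult[OF assms(1)]) simp
  show "(\<lambda>t. hn (u t)) \<in> borel_measurable borel" by (rule wn_fmeas[OF assms(2)])
  have "hn (u t) \<le> ennreal (1 / ?l) * vn L (u t)" for t
  proof -
    have "ennreal (1 / ?l) * (ennreal ?l * hn (u t)) \<le> ennreal (1 / ?l) * vn L (u t)"
      by (intro mult_left_mono hn_le_vn L_pos assms(3)) simp
    moreover have "ennreal (1 / ?l) * (ennreal ?l * hn (u t)) = ennreal (1 / ?l * ?l) * hn (u t)"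
      using lambda1_pos[OF L_pos] by (intro ennreal_assoc) simp
    ultimately show ?thesis using lambda1_pos[OF L_pos] by simp
  qed
  then show "AE r in lborel. hn (u r) \<le> ennreal (1 / ?l) * vn L (u r)" by simp
qed

end

context ns_small
begin

lemma g_fmeas: "fmeas g"
  using g_forcing by (simp add: forcing_def)

lemma g_locint: "locint (\<lambda>t. hn (g t))"
  by (rule locint_wt[OF wn_fmeas[OF g_fmeas] a_pos])
     (use g_forcing in \<open>auto simp: forcing_def intro: le_less_trans\<close>)

lemma sol_vn: "vn L (sol t) \<le> ennreal D"
  using sol_ybound by (simp add: ybound_def)

lemma sol_finite: "vn L (sol t) < \<infinity>" "hn (sol t) < \<infinity>" "sol t 0 = 0"
  using ybound_finite[OF sol_ybound] by auto

lemma sol_fmeas: "fmeas sol"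
  using sol_ybound by (simp add: ybound_def)

lemma sol_traj: "traj g sol rhs"
proof -
  have "locint (\<lambda>t. vn L (sol t))"
    by (rule locint_mono[OF locint_const[of "ennreal D"] wn_fmeas[OF sol_fmeas]]) (auto simp: sol_vn)
  moreover have "AE r in lborel. \<forall>k. rhs r k = g r k - nu *\<^sub>R lap L (sol r) k - bil L (sol r) (sol r) k"
    using g_fld by eventually_elim (auto simp: rhs_def lap_def fld_def bil_bterm)
  ultimately show ?thesis using sol_fld sol_finite sol_primitive by (simp add: traj_def)
qed

text \<open>The integrand \<open>E\<close> is existential because the pairing of the derivatives
  equals the stated expression only for almost every time, namely where the equations hold and
  \<open>g\<close> and \<open>u\<close> have finite norms.\<close>

lemma cross_energy:
  assumes u: "traj g u u'" and st: "s \<le> t"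
  shows "\<exists>E. set_integrable lborel {s..t} E
     \<and> ip (u t) (sol t) - ip (u s) (sol s) = (LINT r:{s..t}|lborel. E r)
     \<and> (AE r in lborel. E r = ip (g r) (sol r) + ip (g r) (u r) - 2 * nu * ip (lap L (u r)) (sol r)
           + ip (bil L (\<lambda>k. u r k - sol r k) (sol r)) (\<lambda>k. u r k - sol r k))"
proof -
  let ?E = "\<lambda>r. LINT k|count_space UNIV. u' r k \<bullet> sol r k + u r k \<bullet> rhs r k"
  let ?X = "\<lambda>r. hn (g r) + (hn (u r) + hn (sol r)) + ennreal nu * (vn L (u r) + vn L (sol r))
       + ennreal nu * (vn L (u r) + vn L (sol r))"
  have fu: "fld L (u t)" "hn (u t) < \<infinity>" "u t 0 = 0" for t using u by (auto simp: traj_def fld_def)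
  have pu: "\<And>k. is_primitive (\<lambda>t. u t k) (\<lambda>t. u' t k)" using u by (simp add: traj_def)
  have lu: "locint (\<lambda>t. vn L (u t))" using u by (simp add: traj_def)
  have ls: "locint (\<lambda>t. vn L (sol t))" using sol_traj by (simp add: traj_def)
  have gh: "AE r in lborel. hn (g r) < \<infinity>" by (rule locint_AE_finite[OF g_locint])
  have uv: "AE r in lborel. vn L (u r) < \<infinity>" by (rule locint_AE_finite[OF lu])
  have eu: "AE r in lborel. \<forall>k. u' r k = g r k - nu *\<^sub>R lap L (u r) k - bil L (u r) (u r) k"
    using u by (simp add: traj_def)
  have es: "AE r in lborel. \<forall>k. rhs r k = g r k - nu *\<^sub>R lap L (sol r) k - bil L (sol r) (sol r) k"
    using sol_traj by (simp add: traj_def)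
  have X: "locint (\<lambda>r. ?X r + ?X r)"
    by (intro locint_add locint_cmult g_locint locint_hn lu ls sol_fmeas traj_fmeas[OF u] fu(3) sol_finite(3)) simp_all
  have bound: "AE r in lborel. csum (\<lambda>k. ennreal (norm (u' r k) * norm (sol r k) + norm (u r k) * norm (rhs r k))) \<le> ?X r + ?X r"
    using eu es
  proof eventually_elim
    case (elim r)
    \<comment> \<open>One estimate serves both halves of the pairing: \<open>x\<close> is the
      right-hand side at the state \<open>z\<close>, tested with the other solution
      \<open>y\<close>.\<close>
    have gen: "csum (\<lambda>k. ennreal (norm (x k) * norm (y k))) \<le> hn (g r) + Y + ennreal nu * V + Z"
      if x: "\<And>k. x k = g r k - nu *\<^sub>R lap L z k - bil L z z k" and "hn y \<le> Y" and V: "vn L z + vn L y = V"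
        and "csum (\<lambda>k. ennreal (norm (bil L z z k) * norm (y k))) \<le> Z" for x y z Y V Z
    proof -
      have "norm (x k) * norm (y k) \<le> norm (g r k) * norm (y k) + nu * (norm (lap L z k) * norm (y k)) + norm (bil L z z k) * norm (y k)" for k
      proof -
        have "norm (x k) \<le> norm (g r k) + norm (nu *\<^sub>R lap L z k) + norm (bil L z z k)"
          unfolding x by (meson add_right_mono norm_triangle_ineq4 order_trans)
        then have "norm (x k) * norm (y k) \<le> (norm (g r k) + norm (nu *\<^sub>R lap L z k) + norm (bil L z z k)) * norm (y k)"
          by (rule mult_right_mono) simp
        then show ?thesis using nu_pos by (simp add: algebra_simps)
      qed
      then have "csum (\<lambda>k. ennreal (norm (x k) * norm (y k))) \<le>
         csum (\<lambda>k. ennreal (norm (g r k) * norm (y k) + nu * (norm (lap L z k) * norm (y k)) + norm (bil L z z k) * norm (y k)))"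
        by (intro nn_integral_mono ennreal_leI)
      also have "\<dots> = csum (\<lambda>k. ennreal (norm (g r k) * norm (y k)) + ennreal nu * ennreal (norm (lap L z k) * norm (y k)) + ennreal (norm (bil L z z k) * norm (y k)))"
        using nu_pos by (intro nn_integral_cong) (simp add: ennreal_plus ennreal_mult)
      also have "\<dots> = csum (\<lambda>k. ennreal (norm (g r k) * norm (y k))) + ennreal nu * csum (\<lambda>k. ennreal (norm (lap L z k) * norm (y k))) + csum (\<lambda>k. ennreal (norm (bil L z z k) * norm (y k)))"
        by (simp add: nn_integral_add nn_integral_cmult)
      also have "\<dots> \<le> hn (g r) + Y + ennreal nu * V + Z"
        unfolding V[symmetric] using order_trans[OF csum_norm_mult_le add_left_mono[OF \<open>hn y \<le> Y\<close>]]
        by (intro add_mono mult_left_mono csum_lap_le that(4)) auto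
      finally show ?thesis .
    qed
    have B: "csum (\<lambda>k. ennreal (norm (bil L (u r) (u r) k) * norm (sol r k))) \<le> ennreal nu * (vn L (u r) + vn L (sol r))"
      "csum (\<lambda>k. ennreal (norm (bil L (sol r) (sol r) k) * norm (u r k))) \<le> ennreal nu * (vn L (u r) + vn L (sol r))"
      using csum_bil_sol[of "u r" "sol r", OF fu(3) sol_finite(3) sol_vn] by auto
    have "csum (\<lambda>k. ennreal (norm (u' r k) * norm (sol r k) + norm (u r k) * norm (rhs r k))) =
      csum (\<lambda>k. ennreal (norm (u' r k) * norm (sol r k)) + ennreal (norm (rhs r k) * norm (u r k)))"
      by (simp add: ennreal_plus mult.commute)
    also have "\<dots> = csum (\<lambda>k. ennreal (norm (u' r k) * norm (sol r k))) + csum (\<lambda>k. ennreal (norm (rhs r k) * norm (u r k)))"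
      by (rule nn_integral_add) auto
    also have "\<dots> \<le> ?X r + ?X r"
    proof (rule add_mono)
      show "csum (\<lambda>k. ennreal (norm (u' r k) * norm (sol r k))) \<le> ?X r"
        by (rule gen[where z="u r", OF _ _ refl B(1)]) (use elim in auto)
      show "csum (\<lambda>k. ennreal (norm (rhs r k) * norm (u r k))) \<le> ?X r"
        by (rule gen[where z="sol r", OF _ _ add.commute B(2)]) (use elim in auto)
    qed
    finally show ?case .
  qed
  have L1: "(\<integral>\<^sup>+r. csum (\<lambda>k. ennreal (norm (u' r k) * norm (sol r k) + norm (u r k) * norm (rhs r k))) * indicator {s..t} r \<partial>lborel) < \<infinity>"
  proof (rule le_less_trans)
    show "(\<integral>\<^sup>+r. csum (\<lambda>k. ennreal (norm (u' r k) * norm (sol r k) + norm (u r k) * norm (rhs r k))) * indicator {s..t} r \<partial>lborel)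
       \<le> (\<integral>\<^sup>+r. (?X r + ?X r) * indicator {s..t} r \<partial>lborel)"
      by (rule nn_integral_mono_AE, rule eventually_mono[OF bound]) (rule mult_right_mono, auto)
    show "(\<integral>\<^sup>+r. (?X r + ?X r) * indicator {s..t} r \<partial>lborel) < \<infinity>"
      using X unfolding locint_def by blast
  qed
  note EP = energy_pairing[OF pu sol_primitive st fu(2) fu(2) sol_finite(2) sol_finite(2) L1]
  have "AE r in lborel. ?E r = ip (g r) (sol r) + ip (g r) (u r) - 2 * nu * ip (lap L (u r)) (sol r)
           + ip (bil L (\<lambda>k. u r k - sol r k) (sol r)) (\<lambda>k. u r k - sol r k)"
    using eu es gh uv
  proof eventually_elim
    case (elim r)
    have "u' r k \<bullet> sol r k + u r k \<bullet> rhs r k =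
       (g r k \<bullet> sol r k - nu * (lap L (u r) k \<bullet> sol r k) - bil L (u r) (u r) k \<bullet> sol r k)
       + (g r k \<bullet> u r k - nu * (lap L (sol r) k \<bullet> u r k) - bil L (sol r) (sol r) k \<bullet> u r k)" for k
      using elim by (simp add: inner_diff_left inner_diff_right inner_commute[of "u r k"])
    then have "?E r = (ip (g r) (sol r) - nu * ip (lap L (u r)) (sol r) - ip (bil L (u r) (u r)) (sol r))
       + (ip (g r) (u r) - nu * ip (lap L (sol r)) (u r) - ip (bil L (sol r) (sol r)) (u r))"
      using ips_integrable[OF ips_hn[OF elim(3) sol_finite(2)], of r] ips_integrable[OF ips_hn[OF elim(3) fu(2)], of r]
        ips_integrable[OF ips_lap[OF elim(4) sol_finite(1)], of r] ips_integrable[OF ips_lap[OF sol_finite(1) elim(4)], of r]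
        ips_integrable[OF ips_bil[OF fu(1) elim(4) elim(4) sol_fld sol_finite(1)], of r]
        ips_integrable[OF ips_bil[OF sol_fld sol_finite(1) sol_finite(1) fu(1) elim(4)], of r]
      unfolding ip_def by simp
    then show ?case
      using b3_cross[OF fu(1) elim(4) sol_fld sol_finite(1), of r] ip_lap_commute[of L "sol r" "u r"] by (simp add: algebra_simps)
  qed
  then show ?thesis using EP by blast
qed

end

section \<open>Leray--Hopf solutions as trajectories\<close>

text \<open>For complex families summability and absolute summability coincide, so both sides
  default to 0 together.\<close>

lemma infsum_eq_integral_complex:
  fixes f :: "'a \<Rightarrow> complex"
  shows "infsum f UNIV = (LINT k|count_space UNIV. f k)"
proof (cases "integrable (count_space UNIV) f")
  case False
  then have "\<not> f summable_on UNIV"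
    using abs_summable_equivalent[of f UNIV] summable_on_iff_abs_summable_on_complex[of f UNIV]
    by (simp add: abs_summable_on_def)
  then show ?thesis using False by (simp add: infsum_not_exists not_integrable_integral_eq)
qed (rule infsum_eq_integral)

lemma inner_H_eq:
  assumes "ips u v" shows "inner_H L u v = L^3 * ip u v"
proof -
  have "csum (\<lambda>k. ennreal (norm (cdot (u k) (vcnj (v k))))) \<le> csum (\<lambda>k. ennreal (norm (u k) * norm (v k)))"
  proof (intro nn_integral_mono ennreal_leI)
    show "norm (cdot (u k) (vcnj (v k))) \<le> norm (u k) * norm (v k)" for k
      using norm_cdot_le[of "u k" "vcnj (v k)"] by simp
  qed
  then have "csum (\<lambda>k. ennreal (norm (cdot (u k) (vcnj (v k))))) < \<infinity>"
    using assms unfolding ips_def by (rule le_less_trans)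
  then have i: "integrable (count_space UNIV) (\<lambda>k. cdot (u k) (vcnj (v k)))" by (rule integrable_csum)
  show ?thesis
    using integral_Re[OF i] by (simp add: inner_H_def infsum_eq_integral_complex ip_def inner_eq_cdot)
qed

lemma inner_H_measurable:
  assumes "fmeas u" "fmeas v" shows "(\<lambda>t. inner_H L (u t) (v t)) \<in> borel_measurable borel"
proof -
  have "continuous_on UNIV (\<lambda>p. cdot (fst p) (vcnj (snd p)))"
    unfolding cdot_def vcnj_def by (simp) (intro continuous_intros)
  from borel_measurable_continuous_Pair[OF fmeasD[OF assms(1)] fmeasD[OF assms(2)] this]
  have "(\<lambda>t. LINT k|count_space UNIV. cdot (u t k) (vcnj (v t k))) \<in> borel_measurable borel"
    by (intro integral_csum_measurable) simp
  then show ?thesis unfolding inner_H_def infsum_eq_integral_complex by measurable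
qed

lemma enn2real_le: "ennreal (enn2real x) \<le> x"
  by (cases x) auto

lemma enn2real_mono': "x \<le> y \<Longrightarrow> y < \<infinity> \<Longrightarrow> enn2real x \<le> enn2real y"
  by (simp add: enn2real_mono)

lemma vnorm2_set_integrable:
  assumes "locint (\<lambda>t. vn L (u t))" shows "set_integrable lborel {s..t} (\<lambda>t. enn2real (vn L (u t)))"
proof (rule locint_set_integrable[OF assms])
  show "(\<lambda>t. enn2real (vn L (u t))) \<in> borel_measurable borel"
    using assms by (intro borel_measurable_enn2real) (simp add: locint_def)
qed (simp add: enn2real_le)

lemma set_integral_cong_AE':
  fixes f h :: "real \<Rightarrow> real"
  assumes "set_integrable lborel {s..t} f" "h \<in> borel_measurable borel" "AE r in lborel. h r = f r"
  shows "(LINT r:{s..t}|lborel. h r) = (LINT r:{s..t}|lborel. f r)"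
proof -
  have m: "(\<lambda>r. indicator {s..t} r *\<^sub>R h r) \<in> borel_measurable lborel" using assms(2) by measurable
  have "(\<lambda>r. indicator {s..t} r *\<^sub>R f r) \<in> borel_measurable lborel"
    using assms(1) unfolding set_integrable_def by auto
  with m show ?thesis unfolding set_lebesgue_integral_def
    by (rule integral_cong_AE) (use assms(3) in \<open>auto elim!: eventually_mono\<close>)
qed

lemma set_integral_mono_AE':
  fixes f h :: "real \<Rightarrow> real"
  assumes "set_integrable lborel {s..t} f" "set_integrable lborel {s..t} h"
    "AE r in lborel. r \<in> {s..t} \<longrightarrow> f r \<le> h r"
  shows "(LINT r:{s..t}|lborel. f r) \<le> (LINT r:{s..t}|lborel. h r)"
  unfolding set_lebesgue_integral_def
  by (rule integral_mono_AE) (use assms in \<open>auto simp: set_integrable_def indicator_def elim!: eventually_mono\<close>)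

context ns
begin

lemma L3_pos: "0 < L ^ 3"
  using L_pos by simp

lemma LH_sol_traj:
  assumes u: "LH_sol L nu g u" shows "\<exists>u'. traj g u u'"
proof -
  have H: "\<And>t. u t \<in> H_sp L" and V: "AE t in lborel. u t \<in> V_sp L"
    and iv: "\<And>a b. set_integrable lborel {a..b} (\<lambda>t. vnorm2 L (u t))"
    using u unfolding LH_sol_def by blast+
  obtain w where w: "\<And>k a b. set_integrable lborel {a..b} (\<lambda>t. w t k)"
      "\<And>k s t. s \<le> t \<Longrightarrow> u t k - u s k = (LINT r:{s..t}|lborel. w r k)"
      "AE t in lborel. \<forall>k. w t k = g t k - complex_of_real (nu * ksq L k) *s u t k - bil L (u t) (u t) k"
    using u unfolding LH_sol_def by blast
  have p: "is_primitive (\<lambda>t. u t k) (\<lambda>t. w t k)" for k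
    using w(1,2) by (simp add: is_primitive_def)
  then have m: "fmeas u" unfolding fmeas_def using is_primitive_measurable by auto
  have "locint (\<lambda>t. vn L (u t))"
    unfolding locint_def
  proof (intro conjI allI)
    show "(\<lambda>t. vn L (u t)) \<in> borel_measurable borel" by (rule wn_fmeas[OF m])
    fix s t
    have "(\<integral>\<^sup>+r. vn L (u r) * indicator {s..t} r \<partial>lborel)
       \<le> (\<integral>\<^sup>+r. ennreal (1 / L^3) * ennreal (norm (indicator {s..t} r *\<^sub>R vnorm2 L (u r))) \<partial>lborel)"
    \<comment> \<open>The function \<open>vnorm2\<close> is 0 where the enstrophy is infinite, so
      its integrability alone says nothing there; \<open>V\<close> excludes these times up to a null
      set.\<close>
    proof (rule nn_integral_mono_AE, use V in eventually_elim)
      fix r assume "u r \<in> V_sp L"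
      then have "vn L (u r) < \<infinity>" by (simp add: V_sp_iff[OF L_pos])
      then have "vn L (u r) = ennreal (1 / L^3 * vnorm2 L (u r))" using L3_pos by (simp add: vnorm2_eq)
      moreover have "0 \<le> vnorm2 L (u r)" using L3_pos by (simp add: vnorm2_eq)
      ultimately show "vn L (u r) * indicator {s..t} r \<le> ennreal (1 / L^3) * ennreal (norm (indicator {s..t} r *\<^sub>R vnorm2 L (u r)))"
        using L_pos by (simp add: indicator_def flip: ennreal_mult)
    qed
    also have "\<dots> = ennreal (1 / L^3) * (\<integral>\<^sup>+r. ennreal (norm (indicator {s..t} r *\<^sub>R vnorm2 L (u r))) \<partial>lborel)"
      using iv[of s t] unfolding set_integrable_def by (intro nn_integral_cmult) auto
    also have "\<dots> < \<infinity>"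
      using iv[of s t] unfolding set_integrable_def integrable_iff_bounded by (simp add: ennreal_mult_less_top)
    finally show "(\<integral>\<^sup>+r. vn L (u r) * indicator {s..t} r \<partial>lborel) < \<infinity>" .
  qed
  moreover have "AE r in lborel. \<forall>k. w r k = g r k - nu *\<^sub>R lap L (u r) k - bil L (u r) (u r) k"
  proof -
    have sc: "complex_of_real x *s y = x *\<^sub>R y" for x and y :: "complex^3"
      by (simp add: vec_eq_iff scaleR_conv_of_real[where 'a=complex])
    show ?thesis using w(3) unfolding sc by (simp add: lap_def)
  qed
  ultimately show ?thesis using H p by (auto simp: traj_def H_sp_iff)
qed

lemma ip_set_integrable:
  assumes "locint (\<lambda>t. hn (u t))" "locint (\<lambda>t. hn (v t))" "fmeas u" "fmeas v"
  shows "set_integrable lborel {s..t} (\<lambda>t. ip (u t) (v t))"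
proof (rule locint_set_integrable[OF locint_add[OF assms(1,2)]])
  show "(\<lambda>t. ip (u t) (v t)) \<in> borel_measurable borel"
    by (intro ip_measurable fmeasD assms)
  show "AE r in lborel. ennreal \<bar>ip (u r) (v r)\<bar> \<le> hn (u r) + hn (v r)"
    using order_trans[OF ip_le_csum csum_norm_mult_le] by blast
qed

section \<open>Weak continuity in time from continuity of the coefficients\<close>

lemma tail_tendsto:
  assumes "hn h < \<infinity>"
  shows "((\<lambda>F. enn2real (hn (\<lambda>k. if k \<in> F then 0 else h k))) \<longlongrightarrow> 0) (finite_subsets_at_top UNIV)"
proof -
  let ?H = "\<lambda>k. (norm (h k))\<^sup>2"
  have s: "?H summable_on UNIV" using assms by (simp add: summable_on_csum wn_def)
  then have "(sum ?H \<longlongrightarrow> infsum ?H UNIV) (finite_subsets_at_top UNIV)" by (rule infsum_tendsto)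
  then have "((\<lambda>F. infsum ?H UNIV - sum ?H F) \<longlongrightarrow> infsum ?H UNIV - infsum ?H UNIV) (finite_subsets_at_top UNIV)"
    by (intro tendsto_diff tendsto_const)
  moreover have "enn2real (hn (\<lambda>k. if k \<in> F then 0 else h k)) = infsum ?H UNIV - sum ?H F" if "finite F" for F
  proof -
    have "enn2real (hn (\<lambda>k. if k \<in> F then 0 else h k)) = infsum (\<lambda>k. (norm (if k \<in> F then 0 else h k))\<^sup>2) UNIV"
      by (simp add: wn_def infsum_eq_csum)
    also have "\<dots> = infsum ?H (UNIV - F)" by (rule infsum_cong_neutral) auto
    also have "\<dots> = infsum ?H UNIV - infsum ?H F"
      using s that by (intro infsum_Diff) (auto intro: summable_on_finite)
    finally show ?thesis using that by simp
  qed
  ultimately show ?thesis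
    using eventually_finite_subsets_at_top_weakI[of UNIV "\<lambda>F. infsum ?H UNIV - sum ?H F = enn2real (hn (\<lambda>k. if k \<in> F then 0 else h k))"]
    by (auto elim: Lim_transform_eventually)
qed

text \<open>The pairing is a limit of finite sums, uniformly in time: the error is the pairing with
  a tail of \<open>h\<close>, and Cauchy-Schwarz bounds it through the common bound
  \<open>K\<close>. The denominator \<open>K + 1\<close> avoids division by 0.\<close>

lemma weak_continuity:
  assumes u: "\<And>k. continuous_on UNIV (\<lambda>t. u t k)" and K: "\<And>t. hn (u t) \<le> ennreal K" "0 \<le> K" and h: "hn h < \<infinity>"
  shows "continuous_on UNIV (\<lambda>t. ip (u t) h)"
proof (rule uniform_limit_theorem[where F="finite_subsets_at_top UNIV" and f="\<lambda>F t. \<Sum>k\<in>F. u t k \<bullet> h k"])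
  show "\<forall>\<^sub>F F in finite_subsets_at_top UNIV. continuous_on UNIV (\<lambda>t. \<Sum>k\<in>F. u t k \<bullet> h k)"
    by (intro always_eventually allI continuous_intros u)
  show "uniform_limit UNIV (\<lambda>F t. \<Sum>k\<in>F. u t k \<bullet> h k) (\<lambda>t. ip (u t) h) (finite_subsets_at_top UNIV)"
  proof (rule uniform_limitI)
    fix e :: real assume e: "0 < e"
    have "\<forall>\<^sub>F F in finite_subsets_at_top UNIV. enn2real (hn (\<lambda>k. if k \<in> F then 0 else h k)) < e\<^sup>2 / (K + 1)"
      using e K by (intro order_tendstoD(2)[OF tail_tendsto[OF h]]) simp
    moreover have "\<forall>\<^sub>F F in finite_subsets_at_top UNIV. finite (F :: (int^3) set)"
      by (rule eventually_finite_subsets_at_top_weakI) simp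
    ultimately show "\<forall>\<^sub>F F in finite_subsets_at_top UNIV. \<forall>t\<in>UNIV. dist (\<Sum>k\<in>F. u t k \<bullet> h k) (ip (u t) h) < e"
    proof eventually_elim
      case (elim F)
      let ?x = "\<lambda>k. if k \<in> F then 0 else h k"
      show ?case
      proof
        fix t
        have fu: "hn (u t) < \<infinity>" using K(1)[of t] by (simp add: le_less_trans)
        have "hn ?x \<le> hn h" by (rule wn_mono) simp
        then have fx: "hn ?x < \<infinity>" using h by (rule le_less_trans)
        obtain x where x: "hn ?x = ennreal x" "0 \<le> x" using fx by (cases "hn ?x") auto
        have "ip (u t) h - (\<Sum>k\<in>F. u t k \<bullet> h k) = ip (u t) ?x"
        proof -
          have "(\<Sum>k\<in>F. u t k \<bullet> h k) = (LINT k|count_space UNIV. u t k \<bullet> (if k \<in> F then h k else 0))"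
            using elim by (subst lebesgue_integral_count_space_finite_support)
              (auto intro!: sum.mono_neutral_cong_right split: if_splits elim: finite_subset[rotated])
          moreover have "hn (\<lambda>k. if k \<in> F then h k else 0) \<le> hn h" by (rule wn_mono) simp
          then have "hn (\<lambda>k. if k \<in> F then h k else 0) < \<infinity>" using h by (rule le_less_trans)
          then have "ip (u t) (\<lambda>k. h k - (if k \<in> F then h k else 0)) = ip (u t) h - ip (u t) (\<lambda>k. if k \<in> F then h k else 0)"
            by (intro ip_diff_right ips_hn fu h)
          moreover have "(\<lambda>k. h k - (if k \<in> F then h k else 0)) = ?x" by auto
          ultimately show ?thesis by (simp add: ip_def)
        qed
        then have d: "dist (\<Sum>k\<in>F. u t k \<bullet> h k) (ip (u t) h) = \<bar>ip (u t) ?x\<bar>"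
          by (simp add: dist_real_def abs_minus_commute)
        have "(ennreal \<bar>ip (u t) ?x\<bar>)\<^sup>2 \<le> hn (u t) * hn ?x"
          by (rule order_trans[OF power_mono[OF ip_le_csum] csum_norm_mult]) simp
        also have "\<dots> \<le> ennreal K * ennreal x" unfolding x(1) by (intro mult_right_mono K) simp
        finally have "\<bar>ip (u t) ?x\<bar>\<^sup>2 \<le> K * x" using K(2) x(2) by (simp add: ennreal_power flip: ennreal_mult)
        also have "\<dots> \<le> (K + 1) * x" using x(2) by (intro mult_right_mono) auto
        also have "\<dots> < e\<^sup>2"
          using elim(1) x K(2) by (simp add: less_divide_eq mult.commute)
        finally have "\<bar>ip (u t) ?x\<bar> < e" using e by (rule power2_less_imp_less[OF _ less_imp_le])
        then show "dist (\<Sum>k\<in>F. u t k \<bullet> h k) (ip (u t) h) < e" using d by simp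
      qed
    qed
  qed
qed simp

end

context ns_small
begin

section \<open>The constructed solution as a strong Leray-Hopf solution\<close>

lemma sol_hn: "hn (sol t) \<le> ennreal (D / lambda1 L)"
proof -
  have l: "0 < lambda1 L" by (rule lambda1_pos[OF L_pos])
  have "ennreal (lambda1 L) * hn (sol t) \<le> ennreal D"
    using hn_le_vn[where u="sol t", OF L_pos sol_finite(3)] sol_vn by (rule order_trans)
  then have "ennreal (1 / lambda1 L) * (ennreal (lambda1 L) * hn (sol t)) \<le> ennreal (1 / lambda1 L) * ennreal D"
    by (rule mult_left_mono) simp
  moreover have "ennreal (1 / lambda1 L) * (ennreal (lambda1 L) * hn (sol t)) = ennreal (1 / lambda1 L * lambda1 L) * hn (sol t)"
    using l by (intro ennreal_assoc) simp
  moreover have "ennreal (1 / lambda1 L) * ennreal D = ennreal (D / lambda1 L)"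
    using l D_pos by (simp flip: ennreal_mult)
  ultimately show ?thesis using l by simp
qed

lemma sol_locint: "locint (\<lambda>t. vn L (sol t))"
  using sol_traj by (simp add: traj_def)

lemma sol_hn_locint: "locint (\<lambda>t. hn (sol t))"
  by (rule locint_hn[OF sol_locint sol_fmeas sol_finite(3)])

text \<open>The cross identity of \<open>sol\<close> with itself: the difference is 0, so the
  trilinear term disappears.\<close>

lemma sol_energy:
  assumes st: "s \<le> t"
  shows "enn2real (hn (sol t)) + 2 * nu * (LINT r:{s..t}|lborel. enn2real (vn L (sol r)))
    = enn2real (hn (sol s)) + 2 * (LINT r:{s..t}|lborel. ip (g r) (sol r))"
proof -
  obtain E where E: "set_integrable lborel {s..t} E"
    "ip (sol t) (sol t) - ip (sol s) (sol s) = (LINT r:{s..t}|lborel. E r)"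
    "AE r in lborel. E r = ip (g r) (sol r) + ip (g r) (sol r) - 2 * nu * ip (lap L (sol r)) (sol r)
           + ip (bil L (\<lambda>k. sol r k - sol r k) (sol r)) (\<lambda>k. sol r k - sol r k)"
    using cross_energy[OF sol_traj st] by blast
  have i1: "set_integrable lborel {s..t} (\<lambda>r. ip (g r) (sol r))"
    by (rule ip_set_integrable[OF g_locint sol_hn_locint g_fmeas sol_fmeas])
  have i2: "set_integrable lborel {s..t} (\<lambda>r. enn2real (vn L (sol r)))"
    by (rule vnorm2_set_integrable[OF sol_locint])
  have i3: "set_integrable lborel {s..t} (\<lambda>r. 2 * ip (g r) (sol r) - 2 * nu * enn2real (vn L (sol r)))"
    using i1 i2 by (intro set_integral_diff set_integrable_mult_right) auto
  have "(LINT r:{s..t}|lborel. E r) = (LINT r:{s..t}|lborel. 2 * ip (g r) (sol r) - 2 * nu * enn2real (vn L (sol r)))"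
    unfolding set_lebesgue_integral_def
  proof (rule integral_cong_AE)
    show "AE r in lborel. indicator {s..t} r *\<^sub>R E r = indicator {s..t} r *\<^sub>R (2 * ip (g r) (sol r) - 2 * nu * enn2real (vn L (sol r)))"
      using E(3) by eventually_elim (simp add: ip_lap_self ip_def[of _ "\<lambda>k. 0"])
  qed (use E(1) i3 in \<open>auto simp: set_integrable_def\<close>)
  also have "\<dots> = 2 * (LINT r:{s..t}|lborel. ip (g r) (sol r)) - 2 * nu * (LINT r:{s..t}|lborel. enn2real (vn L (sol r)))"
    using i1 i2 by (subst set_integral_diff(2)) auto
  finally show ?thesis using E(2) by (simp add: ip_self)
qed

lemma energy_convert:
  assumes u: "traj g u u'"
  shows "hnorm2 L (u t) + 2 * nu * (LINT s:{t0..t}|lborel. vnorm2 L (u s))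
        \<le> hnorm2 L (u t0) + 2 * (LINT s:{t0..t}|lborel. inner_H L (g s) (u s))
     \<longleftrightarrow> enn2real (hn (u t)) + 2 * nu * (LINT r:{t0..t}|lborel. enn2real (vn L (u r)))
    \<le> enn2real (hn (u t0)) + 2 * (LINT r:{t0..t}|lborel. ip (g r) (u r))"
proof -
  have fu: "hn (u t) < \<infinity>" "u t 0 = 0" for t using u by (auto simp: traj_def fld_def)
  have m: "fmeas u" by (rule traj_fmeas[OF u])
  have lu: "locint (\<lambda>t. hn (u t))" using u by (intro locint_hn m fu) (simp add: traj_def)
  have "(LINT s:{t0..t}|lborel. inner_H L (g s) (u s)) = (LINT s:{t0..t}|lborel. L^3 * ip (g s) (u s))"
  proof (rule set_integral_cong_AE')
    show "set_integrable lborel {t0..t} (\<lambda>s. L^3 * ip (g s) (u s))"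
      using ip_set_integrable[OF g_locint lu g_fmeas m] by simp
    show "(\<lambda>s. inner_H L (g s) (u s)) \<in> borel_measurable borel"
      by (rule inner_H_measurable[OF g_fmeas m])
    show "AE r in lborel. inner_H L (g r) (u r) = L^3 * ip (g r) (u r)"
      using locint_AE_finite[OF g_locint] by eventually_elim (intro inner_H_eq ips_hn fu)
  qed
  then have i: "(LINT s:{t0..t}|lborel. inner_H L (g s) (u s)) = L^3 * (LINT s:{t0..t}|lborel. ip (g s) (u s))"
    by simp
  have "hnorm2 L (u t) + 2 * nu * (LINT s:{t0..t}|lborel. vnorm2 L (u s)) =
    L^3 * (enn2real (hn (u t)) + 2 * nu * (LINT r:{t0..t}|lborel. enn2real (vn L (u r))))"
    by (simp add: hnorm2_eq vnorm2_eq distrib_left)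
  moreover have "hnorm2 L (u t0) + 2 * (LINT s:{t0..t}|lborel. inner_H L (g s) (u s)) =
    L^3 * (enn2real (hn (u t0)) + 2 * (LINT r:{t0..t}|lborel. ip (g r) (u r)))"
    by (simp add: hnorm2_eq i distrib_left)
  ultimately show ?thesis using L3_pos by simp
qed

text \<open>All three terms are square integrable in H locally in time, thanks to the weighted bound
  on |Au|^2; the norm of V' is weaker by Poincare's inequality.\<close>

lemma rhs_locint: "locint (\<lambda>t. dn L (rhs t))"
proof -
  let ?l = "lambda1 L"
  have l: "0 < ?l" by (rule lambda1_pos[OF L_pos])
  have la: "locint (\<lambda>t. an L (sol t))"
    by (rule locint_wt[OF wn_fmeas[OF sol_fmeas] a_pos])
       (use sol_ybound in \<open>auto simp: ybound_def intro: le_less_trans\<close>)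
  have lB: "locint (\<lambda>t. hn (bil L (sol t) (sol t)))"
  proof -
    have f: "forcing (2 * C * D * D / nu) (\<lambda>t. bil L (sol t) (sol t))"
      by (rule forcing_bil[OF sol_ybound sol_ybound]) (use D_pos in auto)
    show ?thesis
      by (rule locint_wt[OF _ a_pos]) (use f in \<open>auto simp: forcing_def intro: wn_fmeas le_less_trans\<close>)
  qed
  have mr: "fmeas rhs"
    unfolding fmeas_def
  proof
    fix k
    have mb: "(\<lambda>t. bil L (sol t) (sol t) k) \<in> borel_measurable borel"
      by (rule bil_measurable[OF fmeasD[OF sol_fmeas] fmeasD[OF sol_fmeas] sol_finite(2) sol_finite(1)])
    show "(\<lambda>t. rhs t k) \<in> borel_measurable borel"
      unfolding rhs_def using fmeasD[OF g_fmeas, of k] fmeasD[OF sol_fmeas, of k] mb by (cases "k = 0") auto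
  qed
  show ?thesis
  proof (rule locint_mono[OF _ wn_fmeas[OF mr]])
    let ?G = "\<lambda>t. ennreal (1 / ?l) * (2 * (2 * hn (g t) + 2 * (ennreal (nu\<^sup>2) * an L (sol t))) + 2 * hn (bil L (sol t) (sol t)))"
    show "locint ?G" by (intro locint_cmult locint_add g_locint la lB) simp_all
    have "dn L (rhs t) \<le> ?G t" for t
    proof -
      have "dn L (rhs t) \<le> wn (\<lambda>k. 1 / ?l * 1) (rhs t)"
      proof (rule wn_mono)
        fix k
        have "1 / ksq L k \<le> 1 / ?l * 1"
          using ksq_ge[OF L_pos, of k] l by (cases "k = 0") (auto intro: divide_left_mono)
        then show "1 / ksq L k * (norm (rhs t k))\<^sup>2 \<le> 1 / ?l * 1 * (norm (rhs t k))\<^sup>2"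
          by (rule mult_right_mono) simp
      qed
      also have "\<dots> = ennreal (1 / ?l) * hn (rhs t)" using l by (intro wn_cmult) simp
      finally have 1: "dn L (rhs t) \<le> ennreal (1 / ?l) * hn (rhs t)" .
      have 2: "hn (rhs t) \<le> 2 * hn (\<lambda>k. g t k - nu *\<^sub>R lap L (sol t) k) + 2 * hn (bil L (sol t) (sol t))"
        by (rule wn_add) (auto simp: rhs_def lap_def norm_triangle_ineq4)
      have 3: "hn (\<lambda>k. g t k - nu *\<^sub>R lap L (sol t) k) \<le> 2 * hn (g t) + 2 * hn (\<lambda>k. nu *\<^sub>R lap L (sol t) k)"
        by (rule wn_diff) simp
      have 4: "hn (\<lambda>k. nu *\<^sub>R lap L (sol t) k) = ennreal (nu\<^sup>2) * an L (sol t)"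
        by (subst wn_cmult[symmetric]) (simp_all add: wn_def lap_def power_mult_distrib)
      have "hn (rhs t) \<le> 2 * (2 * hn (g t) + 2 * (ennreal (nu\<^sup>2) * an L (sol t))) + 2 * hn (bil L (sol t) (sol t))"
        by (rule order_trans[OF 2], rule add_right_mono, rule mult_left_mono[OF 3[unfolded 4]]) simp
      with 1 show ?thesis by (meson mult_left_mono order_trans zero_le)
    qed
    then show "AE r in lborel. dn L (rhs r) \<le> ?G r" by simp
  qed
qed

lemma sol_LH: "LH_sol L nu g sol"
proof -
  have H: "sol t \<in> H_sp L" for t using sol_fld sol_finite by (simp add: H_sp_iff)
  have V: "sol t \<in> V_sp L" for t using sol_fld sol_finite by (simp add: V_sp_iff[OF L_pos])
  have c: "continuous_on UNIV (\<lambda>t. inner_H L (sol t) h)" if "h \<in> H_sp L" for h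
  proof -
    have h: "hn h < \<infinity>" using that by (simp add: H_sp_iff)
    have "continuous_on UNIV (\<lambda>t. ip (sol t) h)"
      by (rule weak_continuity[OF is_primitive_continuous[OF sol_primitive] sol_hn _ h])
         (use D_pos lambda1_pos[OF L_pos] in simp)
    then have "continuous_on UNIV (\<lambda>t. L^3 * ip (sol t) h)" by (intro continuous_intros)
    then show ?thesis using inner_H_eq[OF ips_hn[OF sol_finite(2) h]] by simp
  qed
  have iv: "set_integrable lborel {a..b} (\<lambda>t. vnorm2 L (sol t))" for a b
    unfolding vnorm2_eq using vnorm2_set_integrable[OF sol_locint] by simp
  have r1: "set_integrable lborel {a..b} (\<lambda>t. rhs t k)" for k a b
    using sol_primitive[of k] by (simp add: is_primitive_def)
  have r2: "sol t k - sol s k = (LINT r:{s..t}|lborel. rhs r k)" if "s \<le> t" for k s t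
    using sol_primitive[of k] that by (simp add: is_primitive_def)
  have r3: "AE t in lborel. dsummable L (rhs t)"
    using locint_AE_finite[OF rhs_locint] by (simp add: dsummable_iff)
  have r4: "set_integrable lborel {a..b} (\<lambda>t. sqrt (dnorm2 L (rhs t)))" for a b
  proof (rule locint_set_integrable)
    show "locint (\<lambda>t. 1 + ennreal (L^3) * dn L (rhs t))"
      by (intro locint_add locint_const locint_cmult rhs_locint) simp_all
    show "(\<lambda>t. sqrt (dnorm2 L (rhs t))) \<in> borel_measurable borel"
    proof -
      have F: "(\<lambda>t. dn L (rhs t)) \<in> borel_measurable borel"
        using rhs_locint by (simp add: locint_def)
      have G: "(\<lambda>x. sqrt (L^3 * enn2real x)) \<in> borel_measurable borel" by measurable
      show ?thesis unfolding dnorm2_eq by (rule measurable_compose[OF F G])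
    qed
    have "ennreal \<bar>sqrt (dnorm2 L (rhs t))\<bar> \<le> 1 + ennreal (L^3) * dn L (rhs t)" for t
    proof -
      let ?x = "dnorm2 L (rhs t)"
      have x: "0 \<le> ?x" using L3_pos by (simp add: dnorm2_eq)
      \<comment> \<open>Passes from local integrability of the squared V' norm to that of the norm
        itself.\<close>
      have "sqrt ?x \<le> 1 + ?x" using x zero_le_power2[of "sqrt ?x - 1"] by (simp add: power2_diff)
      then have "ennreal \<bar>sqrt ?x\<bar> \<le> ennreal (1 + ?x)" using x by (intro ennreal_leI) simp
      also have "\<dots> = 1 + ennreal (L^3) * ennreal (enn2real (dn L (rhs t)))"
        using x L3_pos by (simp add: ennreal_plus dnorm2_eq ennreal_mult)
      also have "\<dots> \<le> 1 + ennreal (L^3) * dn L (rhs t)"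
        by (intro add_mono mult_left_mono enn2real_le) auto
      finally show ?thesis .
    qed
    then show "AE r in lborel. ennreal \<bar>sqrt (dnorm2 L (rhs r))\<bar> \<le> 1 + ennreal (L^3) * dn L (rhs r)"
      by simp
  qed
  have sc: "complex_of_real x *s y = x *\<^sub>R y" for x and y :: "complex^3"
    by (simp add: vec_eq_iff scaleR_conv_of_real[where 'a=complex])
  have r5: "AE t in lborel. \<forall>k. rhs t k = g t k - complex_of_real (nu * ksq L k) *s sol t k - bil L (sol t) (sol t) k"
    unfolding sc using sol_traj by (simp add: traj_def lap_def)
  have en: "AE t0 in lborel. \<forall>t \<ge> t0.
        hnorm2 L (sol t) + 2 * nu * (LINT s:{t0..t}|lborel. vnorm2 L (sol s))
        \<le> hnorm2 L (sol t0) + 2 * (LINT s:{t0..t}|lborel. inner_H L (g s) (sol s))"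
    unfolding energy_convert[OF sol_traj] using sol_energy by simp
  show ?thesis unfolding LH_sol_def
    using H V c iv r1 r2 r3 r4 r5 en by (intro conjI exI[of _ rhs]) auto
qed

lemma sol_strong: "strong_sol L nu g sol"
  unfolding strong_sol_def
proof (intro conjI allI sol_LH)
  fix a b
  have "sol t \<in> V_sp L \<and> vnorm2 L (sol t) \<le> L^3 * D" for t
  proof -
    have "enn2real (vn L (sol t)) \<le> D"
      using enn2real_mono'[OF sol_vn] D_pos by simp
    then show ?thesis using sol_fld sol_finite L3_pos by (simp add: V_sp_iff[OF L_pos] vnorm2_eq)
  qed
  then show "\<exists>M. AE t in lborel. t \<in> {a..b} \<longrightarrow> sol t \<in> V_sp L \<and> vnorm2 L (sol t) \<le> M" by auto
qed

end

section \<open>Uniqueness\<close>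

lemma AE_real_exists:
  assumes "AE x in lborel. P x" "a < (b::real)"
  obtains x where "a < x" "x < b" "P x"
proof -
  have "\<not> (\<forall>x. a < x \<longrightarrow> x < b \<longrightarrow> \<not> P x)"
  proof
    assume n: "\<forall>x. a < x \<longrightarrow> x < b \<longrightarrow> \<not> P x"
    have "AE x in lborel. x \<notin> {a<..<b}" using assms(1) by eventually_elim (use n in auto)
    then have "{a<..<b} \<in> null_sets lborel" by (subst AE_iff_null_sets) auto
    then show False using assms(2) by (simp add: null_sets_def)
  qed
  then show ?thesis using that by blast
qed

lemma set_integral_const_Icc: "s \<le> t \<Longrightarrow> (LINT r:{s..t}|lborel. (c::real)) = c * (t - s)"
  by (simp add: set_lebesgue_integral_def mult.commute)

lemma set_integrable_const_Icc: "set_integrable lborel {s..t::real} (\<lambda>r. c::real)"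
  using borel_integrable_atLeastAtMost'[of s t "\<lambda>_. c"] unfolding set_integrable_def by simp

lemma archimedean_zero:
  fixes x M c :: real
  assumes "0 \<le> x" "0 < c" "\<And>n::nat. x * (1 + c * real n) \<le> M" shows "x = 0"
proof (rule ccontr)
  assume "x \<noteq> 0"
  then have p: "0 < x * c" using assms by simp
  obtain n :: nat where "M < real n * (x * c)" using ex_less_of_nat_mult[OF p] by auto
  also have "\<dots> \<le> x * (1 + c * real n)" using assms(1) by (simp add: algebra_simps)
  also have "\<dots> \<le> M" by (rule assms(3))
  finally show False by simp
qed

lemma wn_eq_0: "hn u = 0 \<Longrightarrow> u k = 0"
  by (simp add: wn_def nn_integral_0_iff_AE AE_count_space)

context ns
begin

lemma vn_ge_hn:
  assumes "u 0 = 0" "vn L u < \<infinity>"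
  shows "lambda1 L * enn2real (hn u) \<le> enn2real (vn L u)"
proof -
  have "enn2real (ennreal (lambda1 L) * hn u) \<le> enn2real (vn L u)"
    by (rule enn2real_mono'[OF hn_le_vn[where u=u, OF L_pos assms(1)] assms(2)])
  then show ?thesis using lambda1_pos[OF L_pos] by (simp add: enn2real_mult)
qed

end

context ns_small
begin

text \<open>The difference \<open>\<phi>\<close> of the two solutions is measured first by monotonicity from almost every
  starting time; that lower bound for \<open>\<phi> r\<close> then replaces \<open>\<phi> r\<close> in the integrated decay.\<close>
lemma uniqueness:
  assumes u: "traj g u u'"
    and en: "AE s in lborel. \<forall>t\<ge>s. enn2real (hn (u t)) + 2 * nu * (LINT r:{s..t}|lborel. enn2real (vn L (u r)))
       \<le> enn2real (hn (u s)) + 2 * (LINT r:{s..t}|lborel. ip (g r) (u r))"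
    and M: "\<And>t. enn2real (hn (u t)) \<le> M"
  shows "u t k = sol t k"
proof -
  define w where "w t = (\<lambda>k. u t k - sol t k)" for t
  define \<phi> where "\<phi> t = enn2real (hn (w t))" for t
  define c where "c = nu * lambda1 L"
  have c: "0 < c" using nu_pos lambda1_pos[OF L_pos] by (simp add: c_def)
  have fu: "fld L (u t)" "hn (u t) < \<infinity>" "u t 0 = 0" for t using u by (auto simp: traj_def fld_def)
  have m: "fmeas u" by (rule traj_fmeas[OF u])
  have lv: "locint (\<lambda>t. vn L (u t))" using u by (simp add: traj_def)
  have lu: "locint (\<lambda>t. hn (u t))" by (rule locint_hn[OF lv m fu(3)])
  have hw: "hn (w t) < \<infinity>" for t
    unfolding w_def by (rule wn_finite_add[OF fu(2)[of t] sol_finite(2)[of t]]) (simp_all add: norm_triangle_ineq4)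
  have \<phi>0: "0 \<le> \<phi> t" for t by (simp add: \<phi>_def)
  have expand: "\<phi> t = enn2real (hn (u t)) + enn2real (hn (sol t)) - 2 * ip (u t) (sol t)" for t
  proof -
    note i = ips_hn[OF fu(2)[of t] fu(2)[of t]] ips_hn[OF fu(2)[of t] sol_finite(2)[of t]]
      ips_hn[OF sol_finite(2)[of t] fu(2)[of t]] ips_hn[OF sol_finite(2)[of t] sol_finite(2)[of t]]
    have "\<phi> t = ip (w t) (w t)" by (simp add: \<phi>_def ip_self)
    also have "\<dots> = ip (u t) (w t) - ip (sol t) (w t)"
      by (subst w_def) (intro ip_diff_left ips_hn fu(2) sol_finite(2) hw)
    also have "\<dots> = (ip (u t) (u t) - ip (u t) (sol t)) - (ip (sol t) (u t) - ip (sol t) (sol t))"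
      unfolding w_def by (simp only: ip_diff_right[OF i(1,2)] ip_diff_right[OF i(3,4)])
    finally show ?thesis by (simp add: ip_self ip_commute[of "sol t"])
  qed
  have \<phi>M: "\<phi> t \<le> 2 * M + 2 * (D / lambda1 L)" for t
  proof -
    have "hn (w t) \<le> 2 * hn (u t) + 2 * hn (sol t)" unfolding w_def by (rule wn_diff) simp
    then have "\<phi> t \<le> enn2real (2 * hn (u t) + 2 * hn (sol t))"
      unfolding \<phi>_def using fu(2)[of t] sol_finite(2)[of t] by (intro enn2real_mono') (auto simp: ennreal_mult_less_top)
    also have "\<dots> = 2 * enn2real (hn (u t)) + 2 * enn2real (hn (sol t))"
      using fu(2)[of t] sol_finite(2)[of t] by (simp add: enn2real_plus enn2real_mult ennreal_mult_less_top)
    also have "enn2real (hn (sol t)) \<le> D / lambda1 L"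
      using enn2real_mono'[OF sol_hn[of t]] D_pos lambda1_pos[OF L_pos] by simp
    finally show ?thesis using M[of t] by simp
  qed
  \<comment> \<open>Formally \<open>G\<close> is the time derivative of \<open>\<phi>\<close>; with
    only an energy inequality for \<open>u\<close>, its integral is an upper bound for increments of
    \<open>\<phi>\<close>.\<close>
  define G where "G r = - 2 * nu * enn2real (vn L (w r)) - 2 * ip (bil L (w r) (sol r)) (w r)" for r
  have Gle: "AE r in lborel. G r \<le> - (c * \<phi> r)"
    using locint_AE_finite[OF lv]
  proof eventually_elim
    case (elim r)
    have fw: "fld L (w r)" unfolding w_def by (rule fld_diff[OF fu(1) sol_fld])
    have vw: "vn L (w r) < \<infinity>"
      unfolding w_def by (rule wn_finite_add[OF elim sol_finite(1)[of r]]) (simp_all add: norm_triangle_ineq4)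
    have b: "\<bar>ip (bil L (w r) (sol r)) (w r)\<bar> \<le> nu / 2 * enn2real (vn L (w r))"
      by (rule b3_small[OF sol_vn fw vw])
    have "nu * (lambda1 L * \<phi> r) \<le> nu * enn2real (vn L (w r))"
      unfolding \<phi>_def using nu_pos vn_ge_hn[OF fld_0[OF fw] vw] by (intro mult_left_mono) auto
    then show ?case using b unfolding G_def c_def by (simp add: algebra_simps)
  qed
  \<comment> \<open>\<open>G'\<close> is assembled from functions already known to be integrable and
    represents \<open>G\<close> almost everywhere.\<close>
  have step: "AE s in lborel. \<forall>t\<ge>s. \<exists>G'. set_integrable lborel {s..t} G' \<and> (AE r in lborel. G' r = G r)
      \<and> \<phi> t - \<phi> s \<le> (LINT r:{s..t}|lborel. G' r)"
    using en
  proof eventually_elim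
    case (elim s)
    show ?case
    proof (intro allI impI)
      fix t assume st: "s \<le> t"
      obtain E where E: "set_integrable lborel {s..t} E"
        "ip (u t) (sol t) - ip (u s) (sol s) = (LINT r:{s..t}|lborel. E r)"
        "AE r in lborel. E r = ip (g r) (sol r) + ip (g r) (u r) - 2 * nu * ip (lap L (u r)) (sol r)
           + ip (bil L (w r) (sol r)) (w r)"
        using cross_energy[OF u st] unfolding w_def by blast
      let ?F1 = "\<lambda>r. ip (g r) (u r)" and ?F2 = "\<lambda>r. ip (g r) (sol r)"
      let ?V1 = "\<lambda>r. enn2real (vn L (u r))" and ?V2 = "\<lambda>r. enn2real (vn L (sol r))"
      have i: "set_integrable lborel {s..t} ?F1" "set_integrable lborel {s..t} ?F2"
        "set_integrable lborel {s..t} ?V1" "set_integrable lborel {s..t} ?V2"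
        by (rule ip_set_integrable[OF g_locint lu g_fmeas m] ip_set_integrable[OF g_locint sol_hn_locint g_fmeas sol_fmeas]
            vnorm2_set_integrable[OF lv] vnorm2_set_integrable[OF sol_locint])+
      define G' where "G' r = 2 * ?F1 r - 2 * nu * ?V1 r + (2 * ?F2 r - 2 * nu * ?V2 r) - 2 * E r" for r
      have iA: "set_integrable lborel {s..t} (\<lambda>r. 2 * ?F1 r)" "set_integrable lborel {s..t} (\<lambda>r. 2 * nu * ?V1 r)"
        "set_integrable lborel {s..t} (\<lambda>r. 2 * ?F2 r)" "set_integrable lborel {s..t} (\<lambda>r. 2 * nu * ?V2 r)"
        "set_integrable lborel {s..t} (\<lambda>r. 2 * E r)"
        using i E(1) by simp_all
      note iB = set_integral_diff(1)[OF iA(1,2)] set_integral_diff(1)[OF iA(3,4)]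
      note iC = set_integral_add(1)[OF iB]
      have iG: "set_integrable lborel {s..t} G'"
        unfolding G'_def[abs_def] by (rule set_integral_diff(1)[OF iC iA(5)])
      have IG: "(LINT r:{s..t}|lborel. G' r) = 2 * (LINT r:{s..t}|lborel. ?F1 r) - 2 * nu * (LINT r:{s..t}|lborel. ?V1 r)
         + (2 * (LINT r:{s..t}|lborel. ?F2 r) - 2 * nu * (LINT r:{s..t}|lborel. ?V2 r)) - 2 * (LINT r:{s..t}|lborel. E r)"
        unfolding G'_def set_integral_diff(2)[OF iC iA(5)] set_integral_add(2)[OF iB]
          set_integral_diff(2)[OF iA(1,2)] set_integral_diff(2)[OF iA(3,4)] by simp
      have "AE r in lborel. G' r = G r"
        using E(3) locint_AE_finite[OF lv]
      proof eventually_elim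
        case (elim r)
        note i = ips_lap[OF elim(2) elim(2)] ips_lap[OF elim(2) sol_finite(1)[of r]]
          ips_lap[OF sol_finite(1)[of r] elim(2)] ips_lap[OF sol_finite(1)[of r] sol_finite(1)[of r]]
        have vw: "vn L (w r) < \<infinity>"
          unfolding w_def by (rule wn_finite_add[OF elim(2) sol_finite(1)[of r]]) (simp_all add: norm_triangle_ineq4)
        have lw: "lap L (w r) = (\<lambda>k. lap L (u r) k - lap L (sol r) k)"
          by (simp add: fun_eq_iff lap_def w_def scaleR_diff_right)
        have "enn2real (vn L (w r)) = ip (lap L (w r)) (w r)" by (simp add: ip_lap_self)
        also have "\<dots> = ip (lap L (u r)) (w r) - ip (lap L (sol r)) (w r)"
          unfolding lw by (intro ip_diff_left ips_lap elim(2) sol_finite(1) vw)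
        also have "\<dots> = (ip (lap L (u r)) (u r) - ip (lap L (u r)) (sol r)) - (ip (lap L (sol r)) (u r) - ip (lap L (sol r)) (sol r))"
          unfolding w_def by (simp only: ip_diff_right[OF i(1,2)] ip_diff_right[OF i(3,4)])
        finally have vw: "enn2real (vn L (w r)) = ?V1 r + ?V2 r - 2 * ip (lap L (u r)) (sol r)"
          by (simp add: ip_lap_self ip_lap_commute[of L "sol r" "u r"])
        show ?case unfolding G'_def G_def elim(1) vw by (simp add: algebra_simps)
      qed
      \<comment> \<open>Energy inequality of \<open>u\<close> plus energy equality of
        \<open>sol\<close> minus twice the cross identity.\<close>
      moreover have "\<phi> t - \<phi> s \<le> (LINT r:{s..t}|lborel. G' r)"
        using elim[rule_format, OF st] sol_energy[OF st] E(2) unfolding IG expand by linarith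
      ultimately show "\<exists>G'. set_integrable lborel {s..t} G' \<and> (AE r in lborel. G' r = G r)
         \<and> \<phi> t - \<phi> s \<le> (LINT r:{s..t}|lborel. G' r)" using iG by blast
    qed
  qed
  have mono: "AE s in lborel. \<forall>t\<ge>s. \<phi> t \<le> \<phi> s"
    using step
  proof eventually_elim
    case (elim s)
    show ?case
    proof (intro allI impI)
      fix t assume st: "s \<le> t"
      obtain G' where G': "set_integrable lborel {s..t} G'" "AE r in lborel. G' r = G r"
        "\<phi> t - \<phi> s \<le> (LINT r:{s..t}|lborel. G' r)" using elim st by blast
      have "(LINT r:{s..t}|lborel. G' r) \<le> (LINT r:{s..t}|lborel. 0)"
      proof (rule set_integral_mono_AE'[OF G'(1) set_integrable_const_Icc])
        show "AE r in lborel. r \<in> {s..t} \<longrightarrow> G' r \<le> 0"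
          using G'(2) Gle
        proof eventually_elim
          case (elim r)
          then show ?case using mult_nonneg_nonneg[OF less_imp_le[OF c] \<phi>0[of r]] by linarith
        qed
      qed
      then show "\<phi> t \<le> \<phi> s" using G'(3) by (simp add: set_lebesgue_integral_def)
    qed
  qed
  have "\<phi> t = 0" for t
  proof (rule archimedean_zero[OF \<phi>0 c])
    fix n :: nat
    \<comment> \<open>The bound does not contain \<open>s\<close>, so a single admissible starting
      time suffices, and an interval of length 1 before \<open>t - real n\<close> cannot consist of
      exceptional times only.\<close>
    have "AE s in lborel. s < t - real n \<longrightarrow> \<phi> t * (1 + c * real n) \<le> 2 * M + 2 * (D / lambda1 L)"
      using step
    proof eventually_elim
      case (elim s)
      show ?case
      proof
        assume sn: "s < t - real n"
        then have st: "s \<le> t" by simp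
        obtain G' where G': "set_integrable lborel {s..t} G'" "AE r in lborel. G' r = G r"
          "\<phi> t - \<phi> s \<le> (LINT r:{s..t}|lborel. G' r)" using elim st by blast
        have "(LINT r:{s..t}|lborel. G' r) \<le> (LINT r:{s..t}|lborel. - (c * \<phi> t))"
        proof (rule set_integral_mono_AE'[OF G'(1) set_integrable_const_Icc])
          show "AE r in lborel. r \<in> {s..t} \<longrightarrow> G' r \<le> - (c * \<phi> t)"
            using G'(2) Gle mono
          proof eventually_elim
            case (elim r)
            show ?case
            proof
              assume "r \<in> {s..t}"
              then have "c * \<phi> t \<le> c * \<phi> r" using elim(3) c by (intro mult_left_mono) auto
              then show "G' r \<le> - (c * \<phi> t)" using elim(1,2) by linarith
            qed
          qed
        qed
        also have "\<dots> = - ((c * \<phi> t) * (t - s))" using set_integral_const_Icc[OF st] by simp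
        finally have "\<phi> t + (c * \<phi> t) * (t - s) \<le> \<phi> s" using G'(3) by linarith
        moreover have "(c * \<phi> t) * real n \<le> (c * \<phi> t) * (t - s)"
          using sn c \<phi>0 by (intro mult_left_mono) auto
        ultimately have "\<phi> t + (c * \<phi> t) * real n \<le> 2 * M + 2 * (D / lambda1 L)"
          using \<phi>M[of s] by linarith
        then show "\<phi> t * (1 + c * real n) \<le> 2 * M + 2 * (D / lambda1 L)" by (simp add: algebra_simps)
      qed
    qed
    from AE_real_exists[OF this, of "t - real n - 1" "t - real n"]
    show "\<phi> t * (1 + c * real n) \<le> 2 * M + 2 * (D / lambda1 L)" by auto
  qed
  then have "hn (w t) = 0" unfolding \<phi>_def using hw[of t] by (metis enn2real_eq_0_iff infinity_ennreal_def less_irrefl)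
  from wn_eq_0[OF this, of k] show ?thesis by (simp add: w_def)
qed

section \<open>The absorbing ball\<close>

lemma dn_le_hn: "dn L u \<le> ennreal (1 / lambda1 L) * hn u"
proof -
  have l: "0 < lambda1 L" by (rule lambda1_pos[OF L_pos])
  have "dn L u \<le> wn (\<lambda>k. 1 / lambda1 L * 1) u"
  proof (rule wn_mono)
    fix k
    have "1 / ksq L k \<le> 1 / lambda1 L * 1"
      using ksq_ge[OF L_pos, of k] l by (cases "k = 0") (auto intro: divide_left_mono)
    then show "1 / ksq L k * (norm (u k))\<^sup>2 \<le> 1 / lambda1 L * 1 * (norm (u k))\<^sup>2"
      by (rule mult_right_mono) simp
  qed
  also have "\<dots> = ennreal (1 / lambda1 L) * hn u" using l by (intro wn_cmult) simp
  finally show ?thesis .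
qed

lemma dn_locint: "locint (\<lambda>t. dn L (g t))"
proof (rule locint_mono)
  show "locint (\<lambda>t. ennreal (1 / lambda1 L) * hn (g t))" by (rule locint_cmult[OF g_locint]) simp
  show "AE r in lborel. dn L (g r) \<le> ennreal (1 / lambda1 L) * hn (g r)"
    by (simp add: dn_le_hn)
qed (rule wn_fmeas[OF g_fmeas])

lemma dn_set_integrable: "set_integrable lborel {s..t} (\<lambda>r. enn2real (dn L (g r)))"
proof (rule locint_set_integrable[OF dn_locint])
  show "(\<lambda>r. enn2real (dn L (g r))) \<in> borel_measurable borel"
    by (intro borel_measurable_enn2real wn_fmeas g_fmeas)
qed (simp add: enn2real_le)

text \<open>Young's inequality mode by mode, balanced with the weight \<open>nu * ksq L k\<close> so
  that the force is measured in V' and exactly half of the dissipation 2 nu ||v||^2 is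
  spent.\<close>

lemma pairing_le:
  assumes f: "hn f < \<infinity>" and v: "v 0 = 0" "vn L v < \<infinity>"
  shows "2 * ip f v \<le> 1 / nu * enn2real (dn L f) + nu * enn2real (vn L v)"
proof -
  have hv: "hn v < \<infinity>" by (rule hn_finite[where u=v, OF L_pos v])
  have df: "dn L f < \<infinity>"
    by (rule le_less_trans[OF dn_le_hn]) (use f in \<open>simp add: ennreal_mult_less_top\<close>)
  have i1: "integrable (count_space UNIV) (\<lambda>k. 1 / ksq L k * (norm (f k))\<^sup>2)"
    by (rule integrable_csum) (use df in \<open>simp add: wn_def\<close>)
  have i2: "integrable (count_space UNIV) (\<lambda>k. ksq L k * (norm (v k))\<^sup>2)"
    by (rule integrable_csum) (use v(2) in \<open>simp add: wn_def\<close>)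
  have e1: "enn2real (dn L f) = (LINT k|count_space UNIV. 1 / ksq L k * (norm (f k))\<^sup>2)"
    unfolding wn_def by (subst integral_eq_nn_integral) auto
  have e2: "enn2real (vn L v) = (LINT k|count_space UNIV. ksq L k * (norm (v k))\<^sup>2)"
    unfolding wn_def by (subst integral_eq_nn_integral) auto
  have "2 * (f k \<bullet> v k) \<le> 1 / nu * (1 / ksq L k * (norm (f k))\<^sup>2) + nu * (ksq L k * (norm (v k))\<^sup>2)" for k
  proof (cases "k = 0")
    case False
    define q where "q = sqrt (nu * ksq L k)"
    have q: "0 < q" "q\<^sup>2 = nu * ksq L k" using nuksq_pos[OF False] by (simp_all add: q_def)
    have "2 * (f k \<bullet> v k) \<le> 2 * (norm (f k) * norm (v k))" using norm_cauchy_schwarz[of "f k" "v k"] by simp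
    also have "\<dots> = 2 * (norm (f k) / q) * (q * norm (v k))" using q(1) by simp
    also have "\<dots> \<le> (norm (f k) / q)\<^sup>2 + (q * norm (v k))\<^sup>2" by (rule sum_squares_bound)
    also have "\<dots> = 1 / nu * (1 / ksq L k * (norm (f k))\<^sup>2) + nu * (ksq L k * (norm (v k))\<^sup>2)"
      by (simp add: power_divide power_mult_distrib q(2))
    finally show ?thesis .
  qed (simp add: v)
  then have "(LINT k|count_space UNIV. 2 * (f k \<bullet> v k)) \<le>
    (LINT k|count_space UNIV. 1 / nu * (1 / ksq L k * (norm (f k))\<^sup>2) + nu * (ksq L k * (norm (v k))\<^sup>2))"
    using i1 i2 integrable_ip[OF f hv] by (intro integral_mono) (auto simp del: times_divide_eq_left)
  also have "\<dots> = 1 / nu * enn2real (dn L f) + nu * enn2real (vn L v)"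
    unfolding e1 e2 using i1 i2 by (subst Bochner_Integration.integral_add) (auto simp del: times_divide_eq_left)
  finally show ?thesis by (simp add: ip_def)
qed

text \<open>Links the factor \<open>1 + 1 / x\<close> of the energy argument, with
  \<open>x = nu * lambda1 L * tau\<close>, to the one in \<open>Rad\<close>. It rests on
  \<open>1 - exp (- x)\<close> being at most 1 and at most \<open>x\<close>.\<close>

lemma exp_bound_absorbing:
  fixes x :: real
  assumes "0 < x" shows "1 + 1 / x \<le> 2 / (1 - exp (- x))"
proof -
  have e: "exp (- x) < 1" using assms by simp
  have "1 - exp (- x) \<le> x" using exp_ge_add_one_self[of "- x"] by simp
  moreover have "x * (1 - exp (- x)) \<le> x * 1" using assms by (intro mult_left_mono) auto
  ultimately have "(x + 1) * (1 - exp (- x)) \<le> 2 * x" by (simp add: algebra_simps)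
  then show ?thesis using assms e by (simp add: field_simps)
qed

text \<open>Within a window of length \<open>tau\<close> the energy rises by at most
  \<open>J / nu\<close>, so before \<open>t\<close> it was at least
  \<open>\<phi> t - J / nu\<close>. By Poincare this lower bound forces dissipation, which yields an
  inequality between \<open>\<phi> t\<close> and \<open>\<phi> (t - tau)\<close>. The supremum over
  all times, finite since \<open>sol\<close> is bounded, closes it without Gronwall's lemma.\<close>

lemma sol_absorbing:
  assumes tau: "0 < tau"
    and J: "\<And>t. (LINT r:{t..t+tau}|lborel. enn2real (dn L (g r))) \<le> J"
  shows "enn2real (hn (sol t)) \<le> 2 * J / (nu * (1 - exp (- nu * lambda1 L * tau)))"
proof -
  define \<phi> where "\<phi> t = enn2real (hn (sol t))" for t
  define c where "c = nu * lambda1 L"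
  let ?d = "\<lambda>r. enn2real (dn L (g r))" and ?V = "\<lambda>r. enn2real (vn L (sol r))"
  have c: "0 < c" using nu_pos lambda1_pos[OF L_pos] by (simp add: c_def)
  have J0: "0 \<le> J"
  proof -
    have "0 \<le> (LINT r:{0..0+tau}|lborel. ?d r)"
      unfolding set_lebesgue_integral_def by (rule Bochner_Integration.integral_nonneg) simp
    also have "\<dots> \<le> J" by (rule J)
    finally show ?thesis .
  qed
  have iv: "set_integrable lborel {s..t} ?V" for s t by (rule vnorm2_set_integrable[OF sol_locint])
  have en: "\<phi> t - \<phi> s \<le> 1 / nu * (LINT r:{s..t}|lborel. ?d r) - nu * (LINT r:{s..t}|lborel. ?V r)" if "s \<le> t" for s t
  proof -
    have i1: "set_integrable lborel {s..t} (\<lambda>r. 2 * ip (g r) (sol r))"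
      using ip_set_integrable[OF g_locint sol_hn_locint g_fmeas sol_fmeas] by simp
    have i2: "set_integrable lborel {s..t} (\<lambda>r. 1 / nu * ?d r)" "set_integrable lborel {s..t} (\<lambda>r. nu * ?V r)"
      using dn_set_integrable iv by (simp_all del: times_divide_eq_left)
    have "(LINT r:{s..t}|lborel. 2 * ip (g r) (sol r)) \<le> (LINT r:{s..t}|lborel. 1 / nu * ?d r + nu * ?V r)"
    proof (rule set_integral_mono_AE'[OF i1 set_integral_add(1)[OF i2]])
      show "AE r in lborel. r \<in> {s..t} \<longrightarrow> 2 * ip (g r) (sol r) \<le> 1 / nu * ?d r + nu * ?V r"
        using locint_AE_finite[OF g_locint]
        by eventually_elim (intro impI pairing_le sol_finite)
    qed
    also have "\<dots> = 1 / nu * (LINT r:{s..t}|lborel. ?d r) + nu * (LINT r:{s..t}|lborel. ?V r)"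
      by (subst set_integral_add(2)[OF i2]) (simp del: times_divide_eq_left)
    finally show ?thesis using sol_energy[OF that] by (simp add: \<phi>_def)
  qed
  have mono: "(LINT r:{s..t}|lborel. ?d r) \<le> J" if "s \<le> t" "t \<le> s + tau" for s t
  proof -
    have "(LINT r:{s..t}|lborel. ?d r) \<le> (LINT r:{s..s+tau}|lborel. ?d r)"
      unfolding set_lebesgue_integral_def
      using dn_set_integrable[of s t] dn_set_integrable[of s "s + tau"] that
      by (intro integral_mono) (auto simp: set_integrable_def indicator_def)
    then show ?thesis using J[of s] by linarith
  qed
  have V0: "0 \<le> (LINT r:{s..t}|lborel. ?V r)" for s t
    unfolding set_lebesgue_integral_def by (rule Bochner_Integration.integral_nonneg) simp
  have low: "\<phi> t - J / nu \<le> \<phi> s" if "s \<le> t" "t \<le> s + tau" for s t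
  proof -
    have "1 / nu * (LINT r:{s..t}|lborel. ?d r) \<le> 1 / nu * J"
      using mono[OF that] nu_pos by (intro mult_left_mono) auto
    moreover have "0 \<le> nu * (LINT r:{s..t}|lborel. ?V r)" using nu_pos V0[of s t] by simp
    ultimately show ?thesis using en[OF that(1)] by simp
  qed
  have key: "\<phi> t * (1 + c * tau) \<le> \<phi> (t - tau) + (1 + c * tau) * (J / nu)" for t
  proof -
    have "lambda1 L * (\<phi> t - J / nu) * (t - (t - tau)) = (LINT r:{t - tau..t}|lborel. lambda1 L * (\<phi> t - J / nu))"
      by (rule set_integral_const_Icc[symmetric]) (use tau in simp)
    also have "\<dots> \<le> (LINT r:{t - tau..t}|lborel. ?V r)"
    proof (rule set_integral_mono_AE'[OF set_integrable_const_Icc iv], rule AE_I2, rule impI)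
      fix r assume "r \<in> {t - tau..t}"
      then have "\<phi> t - J / nu \<le> \<phi> r" by (intro low) auto
      then have "lambda1 L * (\<phi> t - J / nu) \<le> lambda1 L * \<phi> r"
        using lambda1_pos[OF L_pos] by (intro mult_left_mono) auto
      also have "\<dots> \<le> ?V r"
        unfolding \<phi>_def by (rule vn_ge_hn[OF sol_finite(3,1)])
      finally show "lambda1 L * (\<phi> t - J / nu) \<le> ?V r" .
    qed
    finally have "nu * (lambda1 L * (\<phi> t - J / nu) * tau) \<le> nu * (LINT r:{t - tau..t}|lborel. ?V r)"
      using nu_pos by (intro mult_left_mono) auto
    moreover have "1 / nu * (LINT r:{t - tau..t}|lborel. ?d r) \<le> 1 / nu * J"
      using mono[of "t - tau" t] tau nu_pos by (intro mult_left_mono) auto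
    moreover have "\<phi> t - \<phi> (t - tau) \<le> 1 / nu * (LINT r:{t - tau..t}|lborel. ?d r) - nu * (LINT r:{t - tau..t}|lborel. ?V r)"
      using tau by (intro en) simp
    ultimately have "\<phi> t \<le> \<phi> (t - tau) + J / nu - c * tau * (\<phi> t - J / nu)"
      by (simp add: c_def algebra_simps)
    then show ?thesis by (simp add: algebra_simps)
  qed
  define S where "S = (SUP t. \<phi> t)"
  have bdd: "bdd_above (range \<phi>)"
  proof (rule bdd_aboveI2)
    show "\<phi> t \<le> D / lambda1 L" for t
      unfolding \<phi>_def using enn2real_mono'[OF sol_hn[of t]] D_pos lambda1_pos[OF L_pos] by simp
  qed
  have up: "\<phi> t \<le> S" for t unfolding S_def by (rule cSUP_upper[OF _ bdd]) simp
  have ct: "0 < 1 + c * tau" using c tau by (simp add: add_pos_pos)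
  have "S \<le> (S + (1 + c * tau) * (J / nu)) / (1 + c * tau)"
    unfolding S_def[unfolded atomize_eq]
  proof (rule cSUP_least)
    fix t
    have "\<phi> t * (1 + c * tau) \<le> S + (1 + c * tau) * (J / nu)"
      using key[of t] up[of "t - tau"] by linarith
    then show "\<phi> t \<le> ((SUP t. \<phi> t) + (1 + c * tau) * (J / nu)) / (1 + c * tau)"
      using ct by (simp add: pos_le_divide_eq S_def)
  qed simp
  then have "S * (1 + c * tau) \<le> S + (1 + c * tau) * (J / nu)"
    using ct by (simp add: pos_le_divide_eq)
  then have "S * (c * tau) \<le> (1 + c * tau) * (J / nu)" by (simp add: algebra_simps)
  then have "S \<le> (1 + c * tau) * (J / nu) / (c * tau)"
    by (simp only: pos_le_divide_eq[OF mult_pos_pos[OF c tau]])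
  also have "\<dots> = (1 + 1 / (c * tau)) * (J / nu)" using c tau by (simp add: field_simps)
  also have "\<dots> \<le> 2 / (1 - exp (- (c * tau))) * (J / nu)"
    using exp_bound_absorbing[of "c * tau"] c tau J0 nu_pos by (intro mult_right_mono) auto
  also have "\<dots> = 2 * J / (nu * (1 - exp (- nu * lambda1 L * tau)))" by (simp add: c_def mult.commute)
  finally show ?thesis using up[of t] by (simp add: \<phi>_def)
qed

end

section \<open>Window averages and the exponential weight\<close>

text \<open>The past is cut into windows of length \<open>tau\<close>. On the n-th one the weight is
  at most the n-th power of \<open>exp (- (b * tau))\<close>, and the geometric series gives the
  constant.\<close>

lemma wt_window:
  assumes F [measurable]: "F \<in> borel_measurable borel" and b: "0 < b" and tau: "0 < tau" and K: "0 \<le> K"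
    and win: "\<And>t. (\<integral>\<^sup>+s. F s * indicator {t..t+tau} s \<partial>lborel) \<le> ennreal K"
  shows "wt b t F \<le> ennreal (K / (1 - exp (- (b * tau))))"
proof -
  let ?q = "exp (- (b * tau))"
  let ?I = "\<lambda>n. {t - (real n + 1) * tau..t - (real n + 1) * tau + tau}"
  have q: "0 < ?q" "?q < 1" using b tau by auto
  have pt: "ennreal (ker b t s) * F s \<le> (\<Sum>n. ennreal (?q ^ n) * (F s * indicator (?I n) s))" for s
  proof (cases "s \<le> t")
    case True
    \<comment> \<open>The number of complete windows between \<open>s\<close> and
      \<open>t\<close>.\<close>
    define n where "n = nat \<lfloor>(t - s) / tau\<rfloor>"
    have "0 \<le> (t - s) / tau" using True tau by simp
    then have n: "real n \<le> (t - s) / tau" "(t - s) / tau < real n + 1" unfolding n_def by linarith+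
    then have n': "real n * tau \<le> t - s" "t - s < (real n + 1) * tau"
      using tau by (simp_all add: pos_le_divide_eq pos_divide_less_eq)
    have "ker b t s \<le> ?q ^ n"
    proof -
      have "b * (real n * tau) \<le> b * (t - s)" using n'(1) b by (intro mult_left_mono) auto
      then show ?thesis using True by (simp add: ker_def exp_of_nat_mult[symmetric] algebra_simps)
    qed
    moreover have "s \<in> ?I n" using n' by (auto simp: algebra_simps)
    ultimately have "ennreal (ker b t s) * F s \<le> ennreal (?q ^ n) * (F s * indicator (?I n) s)"
      by (auto intro!: mult_right_mono ennreal_leI)
    also have "\<dots> = (\<Sum>m\<in>{n}. ennreal (?q ^ m) * (F s * indicator (?I m) s))" by simp
    also have "\<dots> \<le> (\<Sum>m. ennreal (?q ^ m) * (F s * indicator (?I m) s))"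
      by (rule sum_le_suminf) auto
    finally show ?thesis .
  qed (simp add: ker_def)
  have "wt b t F \<le> (\<integral>\<^sup>+s. (\<Sum>n. ennreal (?q ^ n) * (F s * indicator (?I n) s)) \<partial>lborel)"
    unfolding wt_def by (rule nn_integral_mono) (rule pt)
  also have "\<dots> = (\<Sum>n. \<integral>\<^sup>+s. ennreal (?q ^ n) * (F s * indicator (?I n) s) \<partial>lborel)"
    by (rule nn_integral_suminf) measurable
  also have "\<dots> = (\<Sum>n. ennreal (?q ^ n) * (\<integral>\<^sup>+s. F s * indicator (?I n) s \<partial>lborel))"
    by (simp add: nn_integral_cmult)
  also have "\<dots> \<le> (\<Sum>n. ennreal (?q ^ n) * ennreal K)"
    by (intro suminf_le mult_left_mono win) auto
  also have "\<dots> = (\<Sum>n. ennreal (?q ^ n * K))" using K by (simp add: ennreal_mult)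
  also have "\<dots> = ennreal (1 / (1 - ?q) * K)"
    using q K by (intro suminf_ennreal_eq sums_mult2 geometric_sums) auto
  finally show ?thesis by simp
qed

section \<open>Choice of the smallness threshold and conclusion\<close>

theorem theorem3p7:
  fixes nu L tau :: real
  assumes "nu > 0" and "L > 0" and "tau > 0"
  shows "\<exists>\<epsilon>>0. \<forall>\<rho>>0. \<forall>g :: real \<Rightarrow> fourier.
     L2loc_H L g \<and> (AE t in lborel. g (t + \<rho>) = g t)
     \<and> (\<forall>t. (1 / tau) * (LINT s:{t..t+tau}|lborel. hnorm2 L (g s)) \<le> \<epsilon>^2)
     \<longrightarrow> (\<exists>v. strong_sol L nu g v \<and> (\<forall>t. v (t + \<rho>) = v t)
            \<and> (\<forall>t. v t \<in> X_set L nu tau g)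
            \<and> (\<forall>u. LH_sol L nu g u \<and> (\<forall>t. u t \<in> X_set L nu tau g) \<longrightarrow> u = v))"
proof -
  interpret ns L nu by unfold_locales fact+
  have q1: "0 < 1 - exp (- (a * tau))" using a_pos assms(3) by simp
  \<comment> \<open>Solved from the requirement that \<open>wt_window\<close> turn the window bound
    \<open>tau * \<epsilon>\<^sup>2 / L^3\<close> into exactly the admissible force size
    \<open>nu * D / 4\<close>. It is fixed before \<open>\<rho>\<close> and \<open>g\<close> and
    depends only on \<open>nu\<close>, \<open>L\<close> and \<open>tau\<close>.\<close>
  define \<epsilon> where "\<epsilon> = sqrt (nu * D * L^3 * (1 - exp (- (a * tau))) / (4 * tau))"
  have e2: "\<epsilon>\<^sup>2 = nu * D * L^3 * (1 - exp (- (a * tau))) / (4 * tau)"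
    unfolding \<epsilon>_def using nu_pos D_pos L_pos q1 assms(3) by (intro real_sqrt_pow2) simp
  have "0 < \<epsilon>" unfolding \<epsilon>_def using nu_pos D_pos L_pos q1 assms(3) by simp
  moreover have "\<exists>v. strong_sol L nu g v \<and> (\<forall>t. v (t + \<rho>) = v t)
            \<and> (\<forall>t. v t \<in> X_set L nu tau g)
            \<and> (\<forall>u. LH_sol L nu g u \<and> (\<forall>t. u t \<in> X_set L nu tau g) \<longrightarrow> u = v)"
    if g: "L2loc_H L g" and per: "AE t in lborel. g (t + \<rho>) = g t"
      and small: "\<And>t. (1 / tau) * (LINT s:{t..t+tau}|lborel. hnorm2 L (g s)) \<le> \<epsilon>\<^sup>2"
    for \<rho> and g :: "real \<Rightarrow> fourier"
  proof -
    have gH: "AE t in lborel. g t \<in> H_sp L" and gi: "\<And>a b. set_integrable lborel {a..b} (\<lambda>t. hnorm2 L (g t))"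
      and gm: "fmeas g" using g by (auto simp: L2loc_H_def fmeas_def)
    have gfin: "AE t in lborel. hn (g t) < \<infinity>" using gH by (simp add: H_sp_iff)
    have small': "(LINT s:{t..t+tau}|lborel. hnorm2 L (g s)) \<le> tau * \<epsilon>\<^sup>2" for t
      using small[of t] assms(3) by (simp add: pos_divide_le_eq mult.commute)
    have h0: "0 \<le> hnorm2 L x" for x using L3_pos by (simp add: hnorm2_eq)
    have win: "(\<integral>\<^sup>+s. hn (g s) * indicator {t..t+tau} s \<partial>lborel) \<le> ennreal (tau * \<epsilon>\<^sup>2 / L^3)" for t
    proof -
      have "(\<integral>\<^sup>+s. hn (g s) * indicator {t..t+tau} s \<partial>lborel)
        = (\<integral>\<^sup>+s. ennreal (1 / L^3) * ennreal (indicator {t..t+tau} s *\<^sub>R hnorm2 L (g s)) \<partial>lborel)"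
      proof (rule nn_integral_cong_AE, use gfin in eventually_elim)
        fix s assume "hn (g s) < \<infinity>"
        then have "hn (g s) = ennreal (1 / L^3 * hnorm2 L (g s))" using L3_pos by (simp add: hnorm2_eq)
        then show "hn (g s) * indicator {t..t+tau} s = ennreal (1 / L^3) * ennreal (indicator {t..t+tau} s *\<^sub>R hnorm2 L (g s))"
          using L_pos h0[of "g s"] by (simp add: indicator_def flip: ennreal_mult)
      qed
      also have "\<dots> = ennreal (1 / L^3) * (\<integral>\<^sup>+s. ennreal (indicator {t..t+tau} s *\<^sub>R hnorm2 L (g s)) \<partial>lborel)"
        using gi[of t "t + tau"] unfolding set_integrable_def by (intro nn_integral_cmult) auto
      also have "(\<integral>\<^sup>+s. ennreal (indicator {t..t+tau} s *\<^sub>R hnorm2 L (g s)) \<partial>lborel)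
         = ennreal (LINT s:{t..t+tau}|lborel. hnorm2 L (g s))"
        unfolding set_lebesgue_integral_def using gi[of t "t + tau"] h0
        by (intro nn_integral_eq_integral) (auto simp: set_integrable_def)
      also have "ennreal (1 / L^3) * \<dots> \<le> ennreal (1 / L^3) * ennreal (tau * \<epsilon>\<^sup>2)"
        by (intro mult_left_mono ennreal_leI small') simp
      also have "\<dots> = ennreal (tau * \<epsilon>\<^sup>2 / L^3)" using L_pos assms(3) by (simp flip: ennreal_mult)
      finally show ?thesis .
    qed
    have "forcing (nu * D / 4) g"
      unfolding forcing_def
    proof (intro conjI gm allI)
      fix t
      have "wt a t (\<lambda>s. hn (g s)) \<le> ennreal ((tau * \<epsilon>\<^sup>2 / L^3) / (1 - exp (- (a * tau))))"
        by (rule wt_window[OF wn_fmeas[OF gm] a_pos assms(3) _ win]) (use L_pos assms(3) in simp)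
      also have "(tau * \<epsilon>\<^sup>2 / L^3) / (1 - exp (- (a * tau))) = nu * D / 4"
      proof -
        have "(tau * (nu * D * L^3 * x / (4 * tau)) / L^3) / x = nu * D / 4" if "0 < x" for x
          using that assms(3) L_pos by simp
        from this[OF q1] show ?thesis by (simp only: e2)
      qed
      finally show "wt a t (\<lambda>s. hn (g s)) \<le> ennreal (nu * D / 4)" .
    qed
    moreover have "AE s in lborel. fld L (g s)" using gH by (simp add: H_sp_iff)
    ultimately interpret ns_small L nu g by unfold_locales
    let ?d = "\<lambda>r. enn2real (dn L (g r))"
    let ?J = "tau * L2b_sq L tau g / L^3"
    have dn: "(LINT s:{t..t+tau}|lborel. dnorm2 L (g s)) = L^3 * (LINT r:{t..t+tau}|lborel. ?d r)" for t
      by (simp add: dnorm2_eq)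
    \<comment> \<open>The supremum in \<open>L2b_sq\<close> bounds its members only once the range
      is known to be bounded; the smallness of \<open>g\<close> in H provides this through
      Poincare's inequality.\<close>
    have bdd: "bdd_above (range (\<lambda>t. (1 / tau) * (LINT s:{t..t+tau}|lborel. dnorm2 L (g s))))"
    proof (rule bdd_aboveI2)
      fix t
      have "(LINT s:{t..t+tau}|lborel. dnorm2 L (g s)) \<le> (LINT s:{t..t+tau}|lborel. 1 / lambda1 L * hnorm2 L (g s))"
      proof (rule set_integral_mono_AE')
        show "set_integrable lborel {t..t+tau} (\<lambda>s. dnorm2 L (g s))"
          unfolding dnorm2_eq using dn_set_integrable by simp
        show "set_integrable lborel {t..t+tau} (\<lambda>s. 1 / lambda1 L * hnorm2 L (g s))"
          using gi by (simp del: times_divide_eq_left)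
        show "AE r in lborel. r \<in> {t..t+tau} \<longrightarrow> dnorm2 L (g r) \<le> 1 / lambda1 L * hnorm2 L (g r)"
          using gfin
        proof eventually_elim
          case (elim r)
          have "?d r \<le> enn2real (ennreal (1 / lambda1 L) * hn (g r))"
            using elim by (intro enn2real_mono'[OF dn_le_hn]) (simp add: ennreal_mult_less_top)
          also have "\<dots> = 1 / lambda1 L * enn2real (hn (g r))"
            using lambda1_pos[OF L_pos] by (simp add: enn2real_mult)
          finally have "L^3 * ?d r \<le> L^3 * (1 / lambda1 L * enn2real (hn (g r)))"
            using L3_pos by (intro mult_left_mono) auto
          then show ?case by (simp add: dnorm2_eq hnorm2_eq mult.left_commute)
        qed
      qed
      also have "\<dots> = 1 / lambda1 L * (LINT s:{t..t+tau}|lborel. hnorm2 L (g s))"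
        by (rule set_integral_mult_right)
      also have "\<dots> \<le> 1 / lambda1 L * (tau * \<epsilon>\<^sup>2)"
        using small'[of t] lambda1_pos[OF L_pos] by (intro mult_left_mono) auto
      finally show "(1 / tau) * (LINT s:{t..t+tau}|lborel. dnorm2 L (g s)) \<le> (1 / tau) * (1 / lambda1 L * (tau * \<epsilon>\<^sup>2))"
        using assms(3) by (intro mult_left_mono) auto
    qed
    have J: "(LINT r:{t..t+tau}|lborel. ?d r) \<le> ?J" for t
    proof -
      have "(1 / tau) * (LINT s:{t..t+tau}|lborel. dnorm2 L (g s)) \<le> L2b_sq L tau g"
        unfolding L2b_sq_def by (rule cSUP_upper[OF _ bdd]) simp
      then show ?thesis unfolding dn using assms(3) L3_pos by (simp add: field_simps)
    qed
    have Rad: "L^3 * (2 * ?J / (nu * (1 - exp (- nu * lambda1 L * tau)))) = Rad L nu tau g"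
      using L_pos by (simp add: Rad_def)
    have X: "sol t \<in> X_set L nu tau g" for t
    proof -
      have "L^3 * enn2real (hn (sol t)) \<le> L^3 * (2 * ?J / (nu * (1 - exp (- nu * lambda1 L * tau))))"
        using sol_absorbing[OF assms(3) J] L3_pos by (intro mult_left_mono) auto
      then show ?thesis unfolding Rad using sol_fld sol_finite by (simp add: X_set_def H_sp_iff hnorm2_eq)
    qed
    have un: "u = sol" if u: "LH_sol L nu g u" and uX: "\<And>t. u t \<in> X_set L nu tau g" for u
    proof -
      obtain u' where t: "traj g u u'" using LH_sol_traj[OF u] by blast
      have "AE s in lborel. \<forall>t\<ge>s. enn2real (hn (u t)) + 2 * nu * (LINT r:{s..t}|lborel. enn2real (vn L (u r)))
         \<le> enn2real (hn (u s)) + 2 * (LINT r:{s..t}|lborel. ip (g r) (u r))"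
        using u unfolding LH_sol_def energy_convert[OF t] by blast
      moreover have "enn2real (hn (u t)) \<le> Rad L nu tau g / L^3" for t
        using uX[of t] L3_pos by (simp add: X_set_def hnorm2_eq pos_le_divide_eq mult.commute)
      ultimately have "u t k = sol t k" for t k by (rule uniqueness[OF t])
      then show ?thesis by blast
    qed
    show ?thesis using sol_strong sol_periodic[OF per] X un by blast
  qed
  ultimately show ?thesis by blast
qed

end
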